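(* There is a universal constant $C>0$ such that the following holds. Let $n\ge 1$, $r\ge 1$ and $0<\varepsilon<1/2$. Suppose $K\subseteq\mathbb{R}^n$ has geometric width at most $r$. Then there is a set $L\subseteq\mathbb{R}^n$, which is an intersection of at most $$\alpha(r,\varepsilon):=\exp\left(C\,\frac{\log(1/\varepsilon)\,\bigl(r+\sqrt{\log(1/\varepsilon)}\bigr)^4}{\varepsilon^2}\right)$$ halfspaces, such that $\mathrm{dist}_{\mathrm{G}}(K,L)\le\varepsilon$. (Equivalently, in notation suppressing polylogarithmic factors, $\alpha(r,\varepsilon)=\exp(\widetilde{O}(r^4/\varepsilon^2))$.)
   Context: For measurable $K,L\subseteq\mathbb{R}^n$, $\mathrm{dist}_{\mathrm{G}}(K,L):=\Pr_{g\sim N(0,I_n)}[g\in K\triangle L]$, where $K\triangle L=(K\setminus L)\cup(L\setminus K)$. A convex set $K\subseteq\mathbb{R}^n$ has geometric width at most $r$ if it can be written as $K=\bigcap_{t\in T}\{x\in\mathbb{R}^n: t\cdot x\le r_t\}$ for some $T\subseteq\mathbb{S}^{n-1}$ (the Euclidean unit sphere, $T$ possibly infinite) and reals $r_t$ with $|r_t|\le r$ for all $t\in T$. *)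

theory Defs
  imports "HOL-Probability.Probability"
begin

(* The dimension n is quantified inside the statement (the constant must not depend on it),
   so R^n is modelled by the functions nat => real with index set {..<n}, extended by undefined.
   This is exactly the carrier of a product measure over {..<n}. *)
definition Rn :: "nat \<Rightarrow> (nat \<Rightarrow> real) set" where
  "Rn n = {..<n} \<rightarrow>\<^sub>E UNIV"

definition inner_prod :: "nat \<Rightarrow> (nat \<Rightarrow> real) \<Rightarrow> (nat \<Rightarrow> real) \<Rightarrow> real" where
  "inner_prod n x y = (\<Sum>i<n. x i * y i)"

definition unit_sphere :: "nat \<Rightarrow> (nat \<Rightarrow> real) set" where
  "unit_sphere n = {t \<in> Rn n. sqrt (inner_prod n t t) = 1}"

definition gaussian :: "nat \<Rightarrow> (nat \<Rightarrow> real) measure" where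
  "gaussian n = (\<Pi>\<^sub>M i\<in>{..<n}. std_normal_distribution)"

(* Meaningful for measurable K and L only; the lemmas below show that the sets
   of the theorem are measurable. *)
definition dist_G :: "nat \<Rightarrow> (nat \<Rightarrow> real) set \<Rightarrow> (nat \<Rightarrow> real) set \<Rightarrow> real" where
  "dist_G n K L = measure (gaussian n) ((K - L) \<union> (L - K))"

(* For T = {} this says K = R^n. Convexity of K is automatic from the representation. *)
definition geom_width_le :: "nat \<Rightarrow> (nat \<Rightarrow> real) set \<Rightarrow> real \<Rightarrow> bool" where
  "geom_width_le n K r \<longleftrightarrow>
     (\<exists>T b. T \<subseteq> unit_sphere n \<and> (\<forall>t\<in>T. \<bar>b t\<bar> \<le> r) \<and>
            K = {x \<in> Rn n. \<forall>t\<in>T. inner_prod n t x \<le> b t})"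

definition is_halfspace :: "nat \<Rightarrow> (nat \<Rightarrow> real) set \<Rightarrow> bool" where
  "is_halfspace n H \<longleftrightarrow>
     (\<exists>w c. w \<in> Rn n \<and> (\<exists>i<n. w i \<noteq> 0) \<and> H = {x \<in> Rn n. inner_prod n w x \<le> c})"

(* The empty intersection is R^n. *)
definition inter_of_halfspaces :: "nat \<Rightarrow> real \<Rightarrow> (nat \<Rightarrow> real) set \<Rightarrow> bool" where
  "inter_of_halfspaces n m L \<longleftrightarrow>
     (\<exists>\<H>. finite \<H> \<and> real (card \<H>) \<le> m \<and> (\<forall>H\<in>\<H>. is_halfspace n H) \<and> L = Rn n \<inter> \<Inter>\<H>)"

definition alpha :: "real \<Rightarrow> real \<Rightarrow> real \<Rightarrow> real" where
  "alpha C r \<epsilon> = exp (C * (ln (1 / \<epsilon>) * (r + sqrt (ln (1 / \<epsilon>))) ^ 4 / \<epsilon>\<^sup>2))"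

lemma space_gaussian: "space (gaussian n) = Rn n"
  by (simp add: gaussian_def Rn_def space_PiM)

lemma prob_space_gaussian: "prob_space (gaussian n)"
  unfolding gaussian_def
  by (intro prob_space_PiM) (simp add: prob_space_normal_density)

lemma sets_halfspace: "{x \<in> Rn n. inner_prod n w x \<le> c} \<in> sets (gaussian n)"
proof -
  have "(\<lambda>x. inner_prod n w x) \<in> borel_measurable (gaussian n)"
    unfolding inner_prod_def gaussian_def by measurable
  then have "{x \<in> space (gaussian n). inner_prod n w x \<le> c} \<in> sets (gaussian n)"
    by measurable
  then show ?thesis by (simp add: space_gaussian)
qed

lemma sets_geom_width_le:
  assumes "geom_width_le n K r"
  shows "K \<in> sets (gaussian n)"
proof -
  obtain T b where K: "K = {x \<in> Rn n. \<forall>t\<in>T. inner_prod n t x \<le> b t}"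
    using assms unfolding geom_width_le_def by blast
  define S where "S = (\<lambda>t. (t, b t)) ` T"
  obtain D where D: "countable D" "D \<subseteq> S" "S \<subseteq> closure D"
    using separable by blast
  have "inner_prod n t x \<le> b t"
    if t: "t \<in> T" and x: "\<forall>(s, c)\<in>D. inner_prod n s x \<le> c" for t x
  proof -
    have "continuous_on UNIV (\<lambda>p :: (nat \<Rightarrow> real) \<times> real. inner_prod n (fst p) x)"
      unfolding inner_prod_def
      by (intro continuous_intros continuous_on_product_then_coordinatewise)
    then have "closed {p. inner_prod n (fst p) x \<le> snd p}"
      by (intro closed_Collect_le continuous_intros)
    moreover have "D \<subseteq> {p. inner_prod n (fst p) x \<le> snd p}"
      using x by auto
    ultimately have "closure D \<subseteq> {p. inner_prod n (fst p) x \<le> snd p}"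
      by (rule closure_minimal[rotated])
    moreover have "(t, b t) \<in> closure D"
      using D(3) t by (auto simp: S_def)
    ultimately show ?thesis by auto
  qed
  with D(2) have "K = Rn n \<inter> (\<Inter>(s, c)\<in>D. {x \<in> Rn n. inner_prod n s x \<le> c})"
    unfolding K S_def by fastforce
  also have "\<dots> = (\<Inter>(s, c)\<in>D. {x \<in> Rn n. inner_prod n s x \<le> c}) \<inter> space (gaussian n)"
    by (simp add: space_gaussian Int_commute)
  also have "\<dots> \<in> sets (gaussian n)"
  proof (cases "D = {}")
    case False
    then show ?thesis
      by (intro sets.Int sets.countable_INT' D(1)) (auto intro: sets_halfspace)
  qed simp
  finally show ?thesis .
qed

lemma sets_inter_of_halfspaces:
  assumes "inter_of_halfspaces n m L"
  shows "L \<in> sets (gaussian n)"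
proof -
  obtain \<H> where H: "finite \<H>" "\<forall>H\<in>\<H>. is_halfspace n H" "L = Rn n \<inter> \<Inter>\<H>"
    using assms unfolding inter_of_halfspaces_def by blast
  have "\<forall>H\<in>\<H>. H \<in> sets (gaussian n)"
    using H(2) sets_halfspace unfolding is_halfspace_def by fastforce
  then have "\<Inter>\<H> \<inter> space (gaussian n) \<in> sets (gaussian n)"
  proof (cases "\<H> = {}")
    case False
    with \<open>\<forall>H\<in>\<H>. H \<in> sets (gaussian n)\<close> H(1) show ?thesis
      using sets.countable_INT'[of \<H> "\<lambda>H. H" "gaussian n"]
      by (auto simp: countable_finite)
  qed simp
  then show ?thesis
    by (simp add: H(3) space_gaussian Int_commute)
qed

end

(*
  If gamma(K) <= epsilon, the empty set will do. Otherwise K is the sublevel set {F <= 0} of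
  F(x) = max (t.x - b_t) over a finite set of unit vectors (up to small measure), and F is
  anticoncentrated: gamma(|F| <= a) <= O(a r), because translating the cell where t is the
  maximiser by u t raises F by exactly u. So it suffices to approximate F within a = c epsilon / r
  by a maximum over a delta-net of T, with delta of order a / sqrt (log (1/epsilon)); by Sudakov
  minoration such a net has exp (O((r + sqrt (log (1/epsilon)))^2 / delta^2)) points.

  To replace every t by its net point without a union bound, move t continuously towards it and
  subtract at each time the conditional mean of the increment over the current cell of t. The cells
  are convex (in the softmax version: the weights are log-concave), so by Prekopa-Leindler the
  centred increments are sub-Gaussian with parameter O(delta) on every cell, however small, and
  Jensen's inequality in time bounds the total change of the maximum.
*)
theory Submission
  imports Defs
begin

section \<open>The Prekopa-Leindler inequality\<close>

text \<open>The finite family that cuts out K up to small measure has no size bound, so no final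
  estimate may contain the logarithm of its cardinality; only the points of the net may be counted.
  The subtracted means are fixed numbers, one for each t and time step, and are absorbed into the
  offsets: the offset of a new halfspace need not resemble any b_t, and all t with the same net
  point share one halfspace with the least of their offsets. The cardinality of the family does
  enter the softmax parameter, the number of time steps and a crude bound on the means, but these
  only steer the discretisation and leave no trace in the result.

  The error budget is \<epsilon>/4 for the finite family, \<epsilon>/4 for |F| \<le> a and
  \<epsilon>/2 for a deviation above a. Hence a = \<epsilon> / (1000 r), and \<delta>^2 = a^2 / (160
  log (1/\<epsilon>)) makes the sub-Gaussian tail \<epsilon>^5. In the exponent, r^2 comes from a^2,
  the single logarithm from \<delta>^2 and (r + sqrt (log (1/\<epsilon>)))^2 from Sudakov
  minoration; the fourth power in the statement bounds the product.\<close>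

lemma emeasure_lborel_affine_vimage:
  fixes c t :: real
  assumes [measurable]: "A \<in> sets borel" and c: "0 < c"
  shows "emeasure lborel ((\<lambda>z. (z - t) / c) -` A) = ennreal c * emeasure lborel A"
proof -
  let ?X = "(\<lambda>z. (z - t) / c) -` A"
  have [measurable]: "?X \<in> sets borel"
    using measurable_sets[of "\<lambda>z. (z - t) / c" borel borel A] by simp
  have "emeasure lborel ?X = (\<integral>\<^sup>+z. indicator ?X z \<partial>lborel)" by simp
  also have "\<dots> = ennreal \<bar>c\<bar> * (\<integral>\<^sup>+z. indicator ?X (t + c * z) \<partial>lborel)"
    using c by (subst nn_integral_real_affine[of _ c t]) auto
  also have "(\<integral>\<^sup>+z. indicator ?X (t + c * z) \<partial>lborel) = (\<integral>\<^sup>+z. indicator A z \<partial>lborel)"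
    using c by (intro nn_integral_cong) (simp add: indicator_def)
  finally show ?thesis using c by simp
qed

text \<open>With \<open>a0\<close> in \<open>A\<close> near its supremum and \<open>b0\<close> in
  \<open>B\<close> near its infimum, \<open>X\<close> is (1 - \<theta>) A moved by \<theta> b0, and
  \<open>Y\<close> is \<theta> B moved by (1 - \<theta>) a0. Both lie in \<open>C\<close>, and they
  overlap in an interval of length at most \<open>e\<close>. A measurable superset \<open>C\<close>
  appears because the Minkowski sum of Borel sets need not be Borel.\<close>

lemma Brunn_Minkowski_real_bounded:
  fixes A B C :: "real set"
  assumes [measurable]: "A \<in> sets borel" "B \<in> sets borel" "C \<in> sets borel"
    and ne: "A \<noteq> {}" "B \<noteq> {}" and bd: "bounded A" "bounded B" and \<theta>: "0 < \<theta>" "\<theta> < 1"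
    and sub: "\<And>a b. a \<in> A \<Longrightarrow> b \<in> B \<Longrightarrow> (1 - \<theta>) * a + \<theta> * b \<in> C"
  shows "ennreal (1 - \<theta>) * emeasure lborel A + ennreal \<theta> * emeasure lborel B \<le> emeasure lborel C"
proof (rule ennreal_le_epsilon)
  fix e :: real assume e: "0 < e"
  have bdd: "bdd_above A" "bdd_below B"
    using bd by (auto intro: bounded_imp_bdd_above bounded_imp_bdd_below)
  obtain a0 where a0: "a0 \<in> A" "Sup A - e < a0"
    using less_cSupD[of A "Sup A - e"] ne e by auto
  obtain b0 where b0: "b0 \<in> B" "b0 < Inf B + e"
    using cInf_lessD[of B "Inf B + e"] ne e by auto
  define X where "X = (\<lambda>z. (z - \<theta> * b0) / (1 - \<theta>)) -` A"
  define Y where "Y = (\<lambda>z. (z - (1 - \<theta>) * a0) / \<theta>) -` B"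
  have [measurable]: "X \<in> sets borel" "Y \<in> sets borel"
    unfolding X_def Y_def by (auto intro!: measurable_sets_borel[of _ borel])
  have XY: "X \<union> Y \<subseteq> C"
  proof
    fix z assume "z \<in> X \<union> Y"
    then show "z \<in> C"
    proof
      assume "z \<in> X"
      then have "(1 - \<theta>) * ((z - \<theta> * b0) / (1 - \<theta>)) + \<theta> * b0 \<in> C"
        unfolding X_def using b0 by (intro sub) auto
      then show ?thesis using \<theta> by simp
    next
      assume "z \<in> Y"
      then have "(1 - \<theta>) * a0 + \<theta> * ((z - (1 - \<theta>) * a0) / \<theta>) \<in> C"
        unfolding Y_def using a0 by (intro sub) auto
      then show ?thesis using \<theta> by simp
    qed
  qed
  have "X \<inter> Y \<subseteq> {(1 - \<theta>) * a0 + \<theta> * Inf B .. (1 - \<theta>) * Sup A + \<theta> * b0}"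
  proof
    fix z assume "z \<in> X \<inter> Y"
    then have "(z - \<theta> * b0) / (1 - \<theta>) \<le> Sup A" "Inf B \<le> (z - (1 - \<theta>) * a0) / \<theta>"
      unfolding X_def Y_def using bdd by (auto intro: cSup_upper cInf_lower)
    then show "z \<in> {(1 - \<theta>) * a0 + \<theta> * Inf B .. (1 - \<theta>) * Sup A + \<theta> * b0}"
      using \<theta> by (auto simp: field_simps)
  qed
  then have "emeasure lborel (X \<inter> Y)
      \<le> emeasure lborel {(1 - \<theta>) * a0 + \<theta> * Inf B .. (1 - \<theta>) * Sup A + \<theta> * b0}"
    by (intro emeasure_mono) auto
  also have "\<dots> \<le> ennreal e"
  proof -
    have "(1 - \<theta>) * (Sup A - a0) \<le> (1 - \<theta>) * e" "\<theta> * (b0 - Inf B) \<le> \<theta> * e"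
      using a0 b0 \<theta> by (intro mult_left_mono; simp)+
    then have "((1 - \<theta>) * Sup A + \<theta> * b0) - ((1 - \<theta>) * a0 + \<theta> * Inf B) \<le> e"
      by (simp add: algebra_simps)
    then show ?thesis by (auto simp: emeasure_lborel_Icc_eq intro!: ennreal_leI)
  qed
  finally have I: "emeasure lborel (X \<inter> Y) \<le> ennreal e" .
  have "ennreal (1 - \<theta>) * emeasure lborel A + ennreal \<theta> * emeasure lborel B
      = emeasure lborel X + emeasure lborel Y"
    unfolding X_def Y_def using \<theta> by (simp add: emeasure_lborel_affine_vimage)
  also have "\<dots> = emeasure lborel (X \<union> Y) + emeasure lborel (X \<inter> Y)"
    by (rule emeasure_Un_Int) auto
  also have "\<dots> \<le> emeasure lborel C + ennreal e"
    using XY I by (intro add_mono emeasure_mono) auto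
  finally show "ennreal (1 - \<theta>) * emeasure lborel A + ennreal \<theta> * emeasure lborel B
      \<le> emeasure lborel C + ennreal e" .
qed

text \<open>Continuity from below along the truncations to [-k, k]; from \<open>k0\<close> on both
  truncated sets are nonempty.\<close>

lemma Brunn_Minkowski_real:
  fixes A B C :: "real set"
  assumes [measurable]: "A \<in> sets borel" "B \<in> sets borel" "C \<in> sets borel"
    and ne: "A \<noteq> {}" "B \<noteq> {}" and \<theta>: "0 < \<theta>" "\<theta> < 1"
    and sub: "\<And>a b. a \<in> A \<Longrightarrow> b \<in> B \<Longrightarrow> (1 - \<theta>) * a + \<theta> * b \<in> C"
  shows "ennreal (1 - \<theta>) * emeasure lborel A + ennreal \<theta> * emeasure lborel B \<le> emeasure lborel C"
proof -
  let ?I = "\<lambda>k::nat. {- real k .. real k}"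
  have lim: "(\<lambda>k. emeasure lborel (D \<inter> ?I k)) \<longlonglongrightarrow> emeasure lborel D"
    if [measurable]: "D \<in> sets borel" for D :: "real set"
  proof -
    have "(\<Union>k. D \<inter> ?I k) = D"
    proof (intro equalityI subsetI)
      fix x assume x: "x \<in> D"
      obtain k :: nat where "\<bar>x\<bar> \<le> real k" using real_arch_simple by blast
      with x show "x \<in> (\<Union>k. D \<inter> ?I k)" by (auto simp: abs_le_iff intro!: exI[of _ k])
    qed auto
    moreover have "incseq (\<lambda>k. D \<inter> ?I k)" by (auto simp: incseq_def)
    ultimately show ?thesis
      using Lim_emeasure_incseq[of "\<lambda>k. D \<inter> ?I k" lborel] by (auto simp: image_subset_iff)
  qed
  obtain a b where ab: "a \<in> A" "b \<in> B" using ne by auto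
  obtain k0 :: nat where k0: "max \<bar>a\<bar> \<bar>b\<bar> \<le> real k0" using real_arch_simple by blast
  have "(\<lambda>k. ennreal (1 - \<theta>) * emeasure lborel (A \<inter> ?I k) + ennreal \<theta> * emeasure lborel (B \<inter> ?I k))
      \<longlonglongrightarrow> ennreal (1 - \<theta>) * emeasure lborel A + ennreal \<theta> * emeasure lborel B"
    by (intro tendsto_add ennreal_tendsto_cmult lim) auto
  moreover have "ennreal (1 - \<theta>) * emeasure lborel (A \<inter> ?I k) + ennreal \<theta> * emeasure lborel (B \<inter> ?I k)
      \<le> emeasure lborel C" if "k0 \<le> k" for k
  proof -
    have "real k0 \<le> real k" using that by simp
    then have "a \<in> A \<inter> ?I k" "b \<in> B \<inter> ?I k" using k0 ab by auto
    then show ?thesis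
      using \<theta> sub by (intro Brunn_Minkowski_real_bounded) (auto intro: bounded_Int)
  qed
  ultimately show ?thesis
    by (intro LIMSEQ_le_const2) auto
qed

lemma nn_integral_layer_cake:
  assumes [measurable]: "sigma_finite_measure M" "f \<in> borel_measurable M" and "\<And>x. 0 \<le> f x"
  shows "(\<integral>\<^sup>+x. ennreal (f x) \<partial>M)
    = (\<integral>\<^sup>+s. emeasure M {x \<in> space M. s < f x} * indicator {0..} s \<partial>lborel)"
proof -
  interpret sigma_finite_measure M by fact
  interpret pair_sigma_finite M lborel by standard
  have "(\<integral>\<^sup>+x. ennreal (f x) \<partial>M) = (\<integral>\<^sup>+x. (\<integral>\<^sup>+s. indicator {0..<f x} s \<partial>lborel) \<partial>M)"
    using assms by (intro nn_integral_cong) (simp add: emeasure_lborel_Ico)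
  also have "\<dots> = (\<integral>\<^sup>+x. (\<integral>\<^sup>+s. indicator {p \<in> space (M \<Otimes>\<^sub>M lborel). 0 \<le> snd p \<and> snd p < f (fst p)} (x, s) \<partial>lborel) \<partial>M)"
    by (intro nn_integral_cong) (auto simp: indicator_def space_pair_measure)
  also have "\<dots> = (\<integral>\<^sup>+s. (\<integral>\<^sup>+x. indicator {p \<in> space (M \<Otimes>\<^sub>M lborel). 0 \<le> snd p \<and> snd p < f (fst p)} (x, s) \<partial>M) \<partial>lborel)"
    by (rule Fubini'[symmetric]) measurable
  also have "\<dots> = (\<integral>\<^sup>+s. (\<integral>\<^sup>+x. indicator {x \<in> space M. s < f x} x * indicator {0..} s \<partial>M) \<partial>lborel)"
    by (intro nn_integral_cong) (auto simp: indicator_def space_pair_measure)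
  also have "\<dots> = (\<integral>\<^sup>+s. emeasure M {x \<in> space M. s < f x} * indicator {0..} s \<partial>lborel)"
    by (intro nn_integral_cong) (simp add: nn_integral_multc)
  finally show ?thesis .
qed

lemma weighted_AM_GM:
  fixes a b :: real
  assumes "0 \<le> a" "0 \<le> b" "0 < \<theta>" "\<theta> < 1"
  shows "a powr (1 - \<theta>) * b powr \<theta> \<le> (1 - \<theta>) * a + \<theta> * b"
proof (cases "a = 0 \<or> b = 0")
  case False
  then show ?thesis using assms by (intro Youngs_inequality_0) auto
qed (use assms in auto)

text \<open>At each level s in [0, 1) the superlevel sets of \<open>f\<close> and \<open>g\<close>
  are nonempty and their weighted sum lies in that of \<open>h\<close>, so Brunn-Minkowski applies
  level by level and the layer cake formula integrates it. The common supremum 1 makes the same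
  levels usable for both functions; it is also what yields an arithmetic mean on the left.\<close>

lemma Prekopa_Leindler_real_normalized:
  fixes f g h :: "real \<Rightarrow> real"
  assumes [measurable]: "f \<in> borel_measurable borel" "g \<in> borel_measurable borel" "h \<in> borel_measurable borel"
    and f: "\<And>x. 0 \<le> f x" "\<And>x. f x \<le> 1" "\<And>s. s < 1 \<Longrightarrow> \<exists>x. s < f x"
    and g: "\<And>x. 0 \<le> g x" "\<And>x. g x \<le> 1" "\<And>s. s < 1 \<Longrightarrow> \<exists>x. s < g x"
    and h: "\<And>x. 0 \<le> h x" and \<theta>: "0 < \<theta>" "\<theta> < 1"
    and le: "\<And>x y. f x powr (1 - \<theta>) * g y powr \<theta> \<le> h ((1 - \<theta>) * x + \<theta> * y)"
  shows "ennreal (1 - \<theta>) * (\<integral>\<^sup>+x. f x \<partial>lborel) + ennreal \<theta> * (\<integral>\<^sup>+x. g x \<partial>lborel) \<le> (\<integral>\<^sup>+x. h x \<partial>lborel)"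
proof -
  have cake: "(\<integral>\<^sup>+x. u x \<partial>lborel) = (\<integral>\<^sup>+s. emeasure lborel {x. s < u x} * indicator {0..} s \<partial>lborel)"
    if "u \<in> borel_measurable borel" "\<And>x. 0 \<le> u x" for u :: "real \<Rightarrow> real"
    using nn_integral_layer_cake[of lborel u] that by (simp add: sigma_finite_lborel)
  have meas: "(\<lambda>s. emeasure lborel {x. s < u x}) \<in> borel_measurable borel"
    if [measurable]: "u \<in> borel_measurable borel" for u :: "real \<Rightarrow> real"
  proof -
    have "(\<lambda>s. emeasure lborel (Pair s -` {p \<in> space (borel \<Otimes>\<^sub>M lborel). fst p < u (snd p)})) \<in> borel_measurable borel"
      by (rule lborel.measurable_emeasure_Pair) measurable
    then show ?thesis by (simp add: space_pair_measure vimage_def)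
  qed
  have [measurable]: "(\<lambda>s. emeasure lborel {x. s < f x}) \<in> borel_measurable borel"
    "(\<lambda>s. emeasure lborel {x. s < g x}) \<in> borel_measurable borel"
    by (intro meas; measurable)+
  have "ennreal (1 - \<theta>) * (\<integral>\<^sup>+x. f x \<partial>lborel) + ennreal \<theta> * (\<integral>\<^sup>+x. g x \<partial>lborel)
     = (\<integral>\<^sup>+s. ennreal (1 - \<theta>) * (emeasure lborel {x. s < f x} * indicator {0..} s)
          + ennreal \<theta> * (emeasure lborel {x. s < g x} * indicator {0..} s) \<partial>lborel)"
    using f g by (simp add: cake nn_integral_add nn_integral_cmult)
  also have "\<dots> \<le> (\<integral>\<^sup>+s. emeasure lborel {x. s < h x} * indicator {0..} s \<partial>lborel)"
  proof (intro nn_integral_mono)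
    fix s :: real
    consider "s < 0" | "0 \<le> s" "s < 1" | "1 \<le> s" by linarith
    then show "ennreal (1 - \<theta>) * (emeasure lborel {x. s < f x} * indicator {0..} s)
        + ennreal \<theta> * (emeasure lborel {x. s < g x} * indicator {0..} s)
      \<le> emeasure lborel {x. s < h x} * indicator {0..} s"
    proof cases
      case 2
      have "(1 - \<theta>) * x + \<theta> * y \<in> {x. s < h x}" if "s < f x" "s < g y" for x y
      proof -
        have "s = s powr (1 - \<theta>) * s powr \<theta>"
          using 2 by (simp flip: powr_add)
        also have "\<dots> < f x powr (1 - \<theta>) * g y powr \<theta>"
          using that 2 \<theta> by (intro mult_strict_mono powr_less_mono2) auto
        also have "\<dots> \<le> h ((1 - \<theta>) * x + \<theta> * y)" by (rule le)
        finally show ?thesis by simp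
      qed
      then have "ennreal (1 - \<theta>) * emeasure lborel {x. s < f x} + ennreal \<theta> * emeasure lborel {x. s < g x}
          \<le> emeasure lborel {x. s < h x}"
        using f(3)[of s] g(3)[of s] 2 \<theta> by (intro Brunn_Minkowski_real) auto
      with 2 show ?thesis by simp
    next
      case 3
      have "{x. s < f x} = {}" "{x. s < g x} = {}"
        using f(2) g(2) 3 by (auto simp: not_less intro: order_trans)
      then show ?thesis by simp
    qed simp
  qed
  also have "\<dots> = (\<integral>\<^sup>+x. h x \<partial>lborel)"
    using h by (simp add: cake)
  finally show ?thesis .
qed

text \<open>Division of \<open>f\<close> and \<open>g\<close> by their suprema \<open>a\<close> and
  \<open>b\<close> forces division of \<open>h\<close> by \<open>\<kappa>\<close>. The normalised
  inequality bounds a weighted arithmetic mean, which dominates the geometric one, and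
  \<open>\<kappa>\<close> cancels.\<close>

lemma Prekopa_Leindler_real:
  fixes f g h :: "real \<Rightarrow> real"
  assumes int: "integrable lborel f" "integrable lborel g" "integrable lborel h"
    and f: "\<And>x. 0 \<le> f x" "\<And>x. f x \<le> B"
    and g: "\<And>x. 0 \<le> g x" "\<And>x. g x \<le> B"
    and h: "\<And>x. 0 \<le> h x" and \<theta>: "0 < \<theta>" "\<theta> < 1"
    and le: "\<And>x y. f x powr (1 - \<theta>) * g y powr \<theta> \<le> h ((1 - \<theta>) * x + \<theta> * y)"
  shows "(LINT x|lborel. f x) powr (1 - \<theta>) * (LINT x|lborel. g x) powr \<theta> \<le> (LINT x|lborel. h x)"
proof -
  define a where "a = Sup (range f)"
  define b where "b = Sup (range g)"
  have bdd: "bdd_above (range f)" "bdd_above (range g)" using f g by (auto intro!: bdd_aboveI)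
  have fa: "f x \<le> a" and gb: "g x \<le> b" for x
    unfolding a_def b_def by (intro cSup_upper bdd; simp)+
  have h0: "0 \<le> (LINT x|lborel. h x)" using h by simp
  consider "a = 0" | "b = 0" | "0 < a" "0 < b"
    using fa[of 0] gb[of 0] f(1)[of 0] g(1)[of 0] by linarith
  then show ?thesis
  proof cases
    case 1
    then have "f = (\<lambda>_. 0)" using fa f by (intro ext antisym) auto
    then show ?thesis using h0 by simp
  next
    case 2
    then have "g = (\<lambda>_. 0)" using gb g by (intro ext antisym) auto
    then show ?thesis using h0 by simp
  next
    case 3
    define \<kappa> where "\<kappa> = a powr (1 - \<theta>) * b powr \<theta>"
    have \<kappa>: "0 < \<kappa>" unfolding \<kappa>_def using 3 by simp
    have [measurable]: "f \<in> borel_measurable borel" "g \<in> borel_measurable borel" "h \<in> borel_measurable borel"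
      using int by (auto dest: borel_measurable_integrable)
    have sup: "\<exists>x. s < u x / c"
      if "c = Sup (range u)" "0 < c" "bdd_above (range u)" "s < 1" for u :: "real \<Rightarrow> real" and c s
    proof -
      have "s * c < Sup (range u)" using that mult_strict_right_mono[of s 1 c] by simp
      then obtain x where "s * c < u x" using less_cSupD[of "range u"] by auto
      then show ?thesis using that by (auto simp: field_simps)
    qed
    have "ennreal (1 - \<theta>) * (\<integral>\<^sup>+x. f x / a \<partial>lborel) + ennreal \<theta> * (\<integral>\<^sup>+x. g x / b \<partial>lborel) \<le> (\<integral>\<^sup>+x. h x / \<kappa> \<partial>lborel)"
    proof (rule Prekopa_Leindler_real_normalized)
      show "(f x / a) powr (1 - \<theta>) * (g y / b) powr \<theta> \<le> h ((1 - \<theta>) * x + \<theta> * y) / \<kappa>" for x y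
        using le[of x y] f g 3 \<kappa>
        by (simp add: powr_divide \<kappa>_def divide_right_mono)
    qed (use f g h fa gb 3 \<kappa> \<theta> sup[OF a_def] sup[OF b_def] bdd in auto)
    then have "ennreal ((1 - \<theta>) * (LINT x|lborel. f x / a) + \<theta> * (LINT x|lborel. g x / b)) \<le> ennreal (LINT x|lborel. h x / \<kappa>)"
      using int f g h 3 \<kappa> \<theta> by (subst (asm) (1 2 3) nn_integral_eq_integral) (auto simp flip: ennreal_mult ennreal_plus)
    then have *: "(1 - \<theta>) * ((LINT x|lborel. f x) / a) + \<theta> * ((LINT x|lborel. g x) / b) \<le> (LINT x|lborel. h x) / \<kappa>"
      using h \<kappa> by (subst (asm) ennreal_le_iff) auto
    have "(LINT x|lborel. f x) powr (1 - \<theta>) * (LINT x|lborel. g x) powr \<theta> / \<kappa>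
       = ((LINT x|lborel. f x) / a) powr (1 - \<theta>) * ((LINT x|lborel. g x) / b) powr \<theta>"
      using f g 3 unfolding \<kappa>_def by (simp add: powr_divide)
    also have "\<dots> \<le> (1 - \<theta>) * ((LINT x|lborel. f x) / a) + \<theta> * ((LINT x|lborel. g x) / b)"
      using f g 3 \<theta> by (intro weighted_AM_GM) auto
    also note *
    finally show ?thesis using \<kappa> by (simp add: divide_le_cancel)
  qed
qed

section \<open>Prekopa-Leindler relative to Gaussian measure\<close>

lemma sq_dist_convex_comb:
  fixes x y \<theta> :: real
  shows "(1 - \<theta>) * x\<^sup>2 + \<theta> * y\<^sup>2 - \<theta> * (1 - \<theta>) * (x - y)\<^sup>2 = ((1 - \<theta>) * x + \<theta> * y)\<^sup>2"
  by (simp add: power2_eq_square algebra_simps)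

lemma prob_space_std_normal: "prob_space std_normal_distribution"
  by (rule prob_space_normal_density) simp

text \<open>The normal density is log-concave with an explicit gain: the weighted geometric mean of
  its values at x and y is its value at the convex combination times exp (- \<theta> (1 - \<theta>)
  (x - y)^2 / 2). Relative to Gaussian measure the hypothesis therefore only has to hold after
  multiplication by this factor, which later pays for linear exponents.\<close>

lemma Prekopa_Leindler_std_normal:
  fixes f g h :: "real \<Rightarrow> real"
  assumes [measurable]: "f \<in> borel_measurable borel" "g \<in> borel_measurable borel" "h \<in> borel_measurable borel"
    and f: "\<And>x. 0 \<le> f x" "\<And>x. f x \<le> B"
    and g: "\<And>x. 0 \<le> g x" "\<And>x. g x \<le> B"
    and h: "\<And>x. 0 \<le> h x" "\<And>x. h x \<le> B" and \<theta>: "0 < \<theta>" "\<theta> < 1"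
    and le: "\<And>x y. f x powr (1 - \<theta>) * g y powr \<theta> * exp (- (\<theta> * (1 - \<theta>) / 2 * (x - y)\<^sup>2)) \<le> h ((1 - \<theta>) * x + \<theta> * y)"
  shows "(LINT x|std_normal_distribution. f x) powr (1 - \<theta>) * (LINT x|std_normal_distribution. g x) powr \<theta>
    \<le> (LINT x|std_normal_distribution. h x)"
proof -
  interpret N: prob_space std_normal_distribution by (rule prob_space_std_normal)
  let ?\<phi> = std_normal_density
  have int: "integrable lborel (\<lambda>x. ?\<phi> x * u x)"
    if [measurable]: "u \<in> borel_measurable borel" and "\<And>x. 0 \<le> u x" "\<And>x. u x \<le> B" for u
  proof -
    have "integrable std_normal_distribution u"
      using that by (intro N.integrable_const_bound[where B=B]) auto
    then show ?thesis by (subst (asm) integrable_density) auto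
  qed
  have eq: "(LINT x|std_normal_distribution. u x) = (LINT x|lborel. ?\<phi> x * u x)"
    if [measurable]: "u \<in> borel_measurable borel" for u
    by (subst integral_density) auto
  have \<phi>1: "?\<phi> x \<le> 1" for x
  proof -
    have "1 \<le> sqrt (2 * pi)" using pi_gt3 by (intro real_le_rsqrt) simp
    then have "?\<phi> x \<le> 1 * 1"
      unfolding std_normal_density_def by (intro mult_mono) (auto simp: field_simps)
    then show ?thesis by simp
  qed
  have B: "0 \<le> B" using f[of 0] by linarith
  have bd: "?\<phi> x * u x \<le> B" if "\<And>x. 0 \<le> u x" "\<And>x. u x \<le> B" for u x
    using mult_mono[OF \<phi>1 that(2)[of x]] that B by simp
  have \<phi>: "?\<phi> x powr (1 - \<theta>) * ?\<phi> y powr \<theta> = ?\<phi> ((1 - \<theta>) * x + \<theta> * y) * exp (- (\<theta> * (1 - \<theta>) / 2 * (x - y)\<^sup>2))" for x y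
  proof -
    define c where "c = 1 / sqrt (2 * pi)"
    have c: "c > 0" by (simp add: c_def)
    have "?\<phi> x powr (1 - \<theta>) * ?\<phi> y powr \<theta> = (c powr (1 - \<theta>) * c powr \<theta>) * (exp (- x\<^sup>2 / 2) powr (1 - \<theta>) * exp (- y\<^sup>2 / 2) powr \<theta>)"
      unfolding std_normal_density_def c_def[symmetric] using c by (simp add: powr_mult)
    also have "c powr (1 - \<theta>) * c powr \<theta> = c" using c by (simp flip: powr_add)
    also have "exp (- x\<^sup>2 / 2) powr (1 - \<theta>) * exp (- y\<^sup>2 / 2) powr \<theta> = exp (- ((1 - \<theta>) * x\<^sup>2 + \<theta> * y\<^sup>2) / 2)"
      by (simp add: powr_def field_simps flip: exp_add)
    also have "(1 - \<theta>) * x\<^sup>2 + \<theta> * y\<^sup>2 = ((1 - \<theta>) * x + \<theta> * y)\<^sup>2 + \<theta> * (1 - \<theta>) * (x - y)\<^sup>2"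
      using sq_dist_convex_comb[of \<theta> x y] by simp
    finally show ?thesis
      unfolding std_normal_density_def c_def[symmetric] by (simp add: add_divide_distrib flip: exp_add)
  qed
  have "(LINT x|lborel. ?\<phi> x * f x) powr (1 - \<theta>) * (LINT x|lborel. ?\<phi> x * g x) powr \<theta> \<le> (LINT x|lborel. ?\<phi> x * h x)"
  proof (rule Prekopa_Leindler_real[where B=B])
    fix x y
    have "(?\<phi> x * f x) powr (1 - \<theta>) * (?\<phi> y * g y) powr \<theta>
      = (?\<phi> x powr (1 - \<theta>) * ?\<phi> y powr \<theta>) * (f x powr (1 - \<theta>) * g y powr \<theta>)"
      using f g by (simp add: powr_mult)
    also have "\<dots> = ?\<phi> ((1 - \<theta>) * x + \<theta> * y) * (f x powr (1 - \<theta>) * g y powr \<theta> * exp (- (\<theta> * (1 - \<theta>) / 2 * (x - y)\<^sup>2)))"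
      unfolding \<phi> by simp
    also have "\<dots> \<le> ?\<phi> ((1 - \<theta>) * x + \<theta> * y) * h ((1 - \<theta>) * x + \<theta> * y)"
      using le by (intro mult_left_mono) auto
    finally show "(?\<phi> x * f x) powr (1 - \<theta>) * (?\<phi> y * g y) powr \<theta>
      \<le> ?\<phi> ((1 - \<theta>) * x + \<theta> * y) * h ((1 - \<theta>) * x + \<theta> * y)" .
  qed (use f g h \<theta> int bd in auto)
  then show ?thesis by (simp add: eq)
qed

definition convex_comb :: "nat \<Rightarrow> real \<Rightarrow> (nat \<Rightarrow> real) \<Rightarrow> (nat \<Rightarrow> real) \<Rightarrow> nat \<Rightarrow> real" where
  "convex_comb n \<theta> x y = (\<lambda>i\<in>{..<n}. (1 - \<theta>) * x i + \<theta> * y i)"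

definition sq_dist :: "nat \<Rightarrow> (nat \<Rightarrow> real) \<Rightarrow> (nat \<Rightarrow> real) \<Rightarrow> real" where
  "sq_dist n x y = (\<Sum>i<n. (x i - y i)\<^sup>2)"

lemma product_sigma_finite_std_normal: "product_sigma_finite (\<lambda>_::nat. std_normal_distribution)"
  by (intro product_sigma_finite.intro prob_space_imp_sigma_finite prob_space_std_normal)

lemma gaussian_Suc: "gaussian (Suc n) = (\<Pi>\<^sub>M i\<in>insert n {..<n}. std_normal_distribution)"
  by (simp add: gaussian_def lessThan_Suc)

lemma Rn_fun_upd: "x \<in> Rn n \<Longrightarrow> x(n := y) \<in> Rn (Suc n)"
  unfolding Rn_def lessThan_Suc by (auto simp: PiE_def extensional_def)

lemma convex_comb_Rn: "convex_comb n \<theta> x y \<in> Rn n"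
  by (simp add: convex_comb_def Rn_def)

lemma measurable_gaussian_Suc_upd:
  assumes "f \<in> borel_measurable (gaussian (Suc n))"
  shows "(\<lambda>(x, y). f (x(n := y))) \<in> borel_measurable (gaussian n \<Otimes>\<^sub>M std_normal_distribution)"
proof -
  have "(\<lambda>(x, y). x(n := y)) \<in> gaussian n \<Otimes>\<^sub>M std_normal_distribution \<rightarrow>\<^sub>M gaussian (Suc n)"
    unfolding gaussian_Suc unfolding gaussian_def by (rule measurable_add_dim)
  from measurable_compose[OF this assms] show ?thesis by (simp add: case_prod_beta')
qed

lemma measurable_gaussian_Suc_section:
  assumes "f \<in> borel_measurable (gaussian (Suc n))" "x \<in> Rn n"
  shows "(\<lambda>y. f (x(n := y))) \<in> borel_measurable borel"
proof -
  have "(\<lambda>y. (x, y)) \<in> std_normal_distribution \<rightarrow>\<^sub>M gaussian n \<Otimes>\<^sub>M std_normal_distribution"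
    using assms(2) by (intro measurable_Pair1') (simp add: space_gaussian)
  from measurable_compose[OF this measurable_gaussian_Suc_upd[OF assms(1)]]
  show ?thesis by simp
qed

text \<open>Induction on the dimension: integrating out the last coordinate gives functions that
  satisfy the hypothesis in one dimension less, by the one-dimensional inequality, since
  \<open>sq_dist\<close> and \<open>convex_comb\<close> split by coordinates. A uniform bound
  \<open>B\<close> is carried instead of integrability because it passes to every section, not just
  to almost every one.\<close>

lemma Prekopa_Leindler_gaussian_bounded:
  fixes f g h :: "(nat \<Rightarrow> real) \<Rightarrow> real"
  assumes "f \<in> borel_measurable (gaussian n)" "g \<in> borel_measurable (gaussian n)" "h \<in> borel_measurable (gaussian n)"
    and "\<And>x. x \<in> Rn n \<Longrightarrow> 0 \<le> f x" "\<And>x. x \<in> Rn n \<Longrightarrow> f x \<le> B"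
    and "\<And>x. x \<in> Rn n \<Longrightarrow> 0 \<le> g x" "\<And>x. x \<in> Rn n \<Longrightarrow> g x \<le> B"
    and "\<And>x. x \<in> Rn n \<Longrightarrow> 0 \<le> h x" "\<And>x. x \<in> Rn n \<Longrightarrow> h x \<le> B" and \<theta>: "0 < \<theta>" "\<theta> < 1"
    and "\<And>x y. x \<in> Rn n \<Longrightarrow> y \<in> Rn n \<Longrightarrow>
      f x powr (1 - \<theta>) * g y powr \<theta> * exp (- (\<theta> * (1 - \<theta>) / 2 * sq_dist n x y)) \<le> h (convex_comb n \<theta> x y)"
  shows "(LINT x|gaussian n. f x) powr (1 - \<theta>) * (LINT x|gaussian n. g x) powr \<theta> \<le> (LINT x|gaussian n. h x)"
  using assms(1-9,12)
proof (induction n arbitrary: f g h B)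
  case 0
  let ?u = "\<lambda>_::nat. undefined :: real"
  have eq: "(LINT x|gaussian 0. u x) = u ?u" for u :: "(nat \<Rightarrow> real) \<Rightarrow> real"
  proof -
    have "gaussian 0 = count_space {?u}" by (simp add: gaussian_def PiM_empty)
    then show ?thesis by (simp add: lebesgue_integral_count_space_finite)
  qed
  have u: "?u \<in> Rn 0" by (simp add: Rn_def)
  have "convex_comb 0 \<theta> ?u ?u = ?u" by (simp add: convex_comb_def fun_eq_iff)
  with "0.prems"(10)[OF u u] show ?case by (simp add: eq sq_dist_def)
next
  case (Suc n)
  note m = Suc.prems(1-3)
  have fb: "0 \<le> f x" "f x \<le> B" and gb: "0 \<le> g x" "g x \<le> B" and hb: "0 \<le> h x" "h x \<le> B"
    if "x \<in> Rn (Suc n)" for x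
    using that by (rule Suc.prems)+
  have le: "f x powr (1 - \<theta>) * g y powr \<theta> * exp (- (\<theta> * (1 - \<theta>) / 2 * sq_dist (Suc n) x y))
      \<le> h (convex_comb (Suc n) \<theta> x y)" if "x \<in> Rn (Suc n)" "y \<in> Rn (Suc n)" for x y
    using that by (rule Suc.prems)
  let ?N = std_normal_distribution
  interpret N: prob_space ?N by (rule prob_space_std_normal)
  interpret product_sigma_finite "\<lambda>_::nat. ?N" by (rule product_sigma_finite_std_normal)
  interpret G: prob_space "gaussian (Suc n)" by (rule prob_space_gaussian)
  let ?P = "\<lambda>u x. LINT y|?N. u (x(n := y))"
  have eq: "(LINT x|gaussian (Suc n). u x) = (LINT x|gaussian n. ?P u x)"
    if u: "u \<in> borel_measurable (gaussian (Suc n))"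
      "\<And>x. x \<in> Rn (Suc n) \<Longrightarrow> 0 \<le> u x" "\<And>x. x \<in> Rn (Suc n) \<Longrightarrow> u x \<le> B" for u :: "(nat \<Rightarrow> real) \<Rightarrow> real"
  proof -
    have "integrable (gaussian (Suc n)) u"
      using u by (intro G.integrable_const_bound[where B=B] AE_I2) (auto simp: space_gaussian)
    then show ?thesis
      unfolding gaussian_Suc by (subst product_integral_insert) (auto simp: gaussian_def)
  qed
  have meas: "?P u \<in> borel_measurable (gaussian n)"
    if "u \<in> borel_measurable (gaussian (Suc n))" for u :: "(nat \<Rightarrow> real) \<Rightarrow> real"
    using N.borel_measurable_lebesgue_integral[OF measurable_gaussian_Suc_upd[OF that]] by simp
  have bnd: "0 \<le> ?P u x" "?P u x \<le> B"
    if u: "u \<in> borel_measurable (gaussian (Suc n))" and x: "x \<in> Rn n"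
      and b: "\<And>x. x \<in> Rn (Suc n) \<Longrightarrow> 0 \<le> u x" "\<And>x. x \<in> Rn (Suc n) \<Longrightarrow> u x \<le> B" for u :: "(nat \<Rightarrow> real) \<Rightarrow> real" and x
  proof -
    note [measurable] = measurable_gaussian_Suc_section[OF u x]
    show "0 \<le> ?P u x" using b Rn_fun_upd[OF x] by simp
    have "integrable ?N (\<lambda>y. u (x(n := y)))"
      using b Rn_fun_upd[OF x] by (intro N.integrable_const_bound[where B=B] AE_I2) auto
    then show "?P u x \<le> B" using b Rn_fun_upd[OF x] by (intro N.integral_le_const) auto
  qed
  have "(LINT x|gaussian n. ?P f x) powr (1 - \<theta>) * (LINT x|gaussian n. ?P g x) powr \<theta> \<le> (LINT x|gaussian n. ?P h x)"
  proof (rule Suc.IH[where B=B])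
    fix x1 x2 assume x: "x1 \<in> Rn n" "x2 \<in> Rn n"
    \<comment> \<open>The gain from the first n coordinates is constant along a section. Both
      functions are multiplied by it, and the exponents 1 - \<theta> and \<theta> reassemble a
      single factor.\<close>
    let ?e = "exp (- (\<theta> * (1 - \<theta>) / 2 * sq_dist n x1 x2))"
    let ?z = "convex_comb n \<theta> x1 x2"
    have [measurable]: "(\<lambda>y. f (x1(n := y))) \<in> borel_measurable borel" "(\<lambda>y. g (x2(n := y))) \<in> borel_measurable borel"
       "(\<lambda>y. h (?z(n := y))) \<in> borel_measurable borel"
      using m x convex_comb_Rn by (auto intro: measurable_gaussian_Suc_section)
    have e: "0 < ?e" "?e \<le> 1"
      using \<theta> by (auto simp: sq_dist_def sum_nonneg)
    have B: "0 \<le> B" using fb[OF Rn_fun_upd[OF x(1), of 0]] by linarith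
    have "(LINT y|?N. ?e * f (x1(n := y))) powr (1 - \<theta>) * (LINT y|?N. ?e * g (x2(n := y))) powr \<theta>
      \<le> (LINT y|?N. h (?z(n := y)))"
    proof (rule Prekopa_Leindler_std_normal[where B=B])
      fix y1 y2
      have "sq_dist (Suc n) (x1(n := y1)) (x2(n := y2)) = sq_dist n x1 x2 + (y1 - y2)\<^sup>2"
        by (simp add: sq_dist_def)
      then have 1: "exp (- (\<theta> * (1 - \<theta>) / 2 * sq_dist (Suc n) (x1(n := y1)) (x2(n := y2))))
          = ?e * exp (- (\<theta> * (1 - \<theta>) / 2 * (y1 - y2)\<^sup>2))"
        by (simp only: distrib_left minus_add_distrib exp_add)
      have 2: "convex_comb (Suc n) \<theta> (x1(n := y1)) (x2(n := y2)) = ?z(n := (1 - \<theta>) * y1 + \<theta> * y2)"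
        by (auto simp: convex_comb_def fun_eq_iff less_Suc_eq)
      have "f (x1(n := y1)) powr (1 - \<theta>) * g (x2(n := y2)) powr \<theta> * (?e * exp (- (\<theta> * (1 - \<theta>) / 2 * (y1 - y2)\<^sup>2)))
         \<le> h (?z(n := (1 - \<theta>) * y1 + \<theta> * y2))"
        using le[OF Rn_fun_upd[OF x(1), of y1] Rn_fun_upd[OF x(2), of y2]] unfolding 1 2 .
      moreover have "(?e * f (x1(n := y1))) powr (1 - \<theta>) * (?e * g (x2(n := y2))) powr \<theta>
         = ?e * (f (x1(n := y1)) powr (1 - \<theta>) * g (x2(n := y2)) powr \<theta>)"
      proof -
        have "?e powr (1 - \<theta>) * ?e powr \<theta> = ?e" by (simp flip: powr_add)
        then show ?thesis
          using fb gb Rn_fun_upd x e by (simp add: powr_mult mult_ac)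
      qed
      ultimately show "(?e * f (x1(n := y1))) powr (1 - \<theta>) * (?e * g (x2(n := y2))) powr \<theta> * exp (- (\<theta> * (1 - \<theta>) / 2 * (y1 - y2)\<^sup>2))
        \<le> h (?z(n := (1 - \<theta>) * y1 + \<theta> * y2))"
        by (simp add: mult_ac)
    next
      show "?e * f (x1(n := y)) \<le> B" for y
        by (rule order_trans[OF mult_left_le_one_le[OF _ less_imp_le] fb(2)]) (intro e fb Rn_fun_upd x)+
      show "?e * g (x2(n := y)) \<le> B" for y
        by (rule order_trans[OF mult_left_le_one_le[OF _ less_imp_le] gb(2)]) (intro e gb Rn_fun_upd x)+
      show "h (?z(n := y)) \<le> B" "0 \<le> h (?z(n := y))" for y
        by (intro hb Rn_fun_upd convex_comb_Rn)+
      show "0 \<le> ?e * f (x1(n := y))" "0 \<le> ?e * g (x2(n := y))" for y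
        by (intro mult_nonneg_nonneg fb gb Rn_fun_upd x less_imp_le e)+
    qed (use \<theta> in simp_all)
    moreover have "(?e * ?P f x1) powr (1 - \<theta>) * (?e * ?P g x2) powr \<theta> = ?P f x1 powr (1 - \<theta>) * ?P g x2 powr \<theta> * ?e"
    proof -
      have "?e powr (1 - \<theta>) * ?e powr \<theta> = ?e" by (simp flip: powr_add)
      then show ?thesis
        using bnd(1)[OF m(1) x(1) fb] bnd(1)[OF m(2) x(2) gb] e by (simp add: powr_mult mult_ac)
    qed
    ultimately show "?P f x1 powr (1 - \<theta>) * ?P g x2 powr \<theta> * ?e \<le> ?P h ?z" by simp
  qed (intro meas m bnd fb gb hb; assumption)+
  then show ?case using m fb gb hb by (simp add: eq)
qed

text \<open>Truncation at k keeps the hypothesis: a weighted geometric mean of numbers at most k is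
  at most k, so \<open>h\<close> can be truncated as well. Dominated convergence then removes the
  bound.\<close>

lemma Prekopa_Leindler_gaussian:
  fixes f g h :: "(nat \<Rightarrow> real) \<Rightarrow> real"
  assumes int: "integrable (gaussian n) f" "integrable (gaussian n) g" "integrable (gaussian n) h"
    and nn: "\<And>x. x \<in> Rn n \<Longrightarrow> 0 \<le> f x" "\<And>x. x \<in> Rn n \<Longrightarrow> 0 \<le> g x" "\<And>x. x \<in> Rn n \<Longrightarrow> 0 \<le> h x"
    and \<theta>: "0 < \<theta>" "\<theta> < 1"
    and le: "\<And>x y. x \<in> Rn n \<Longrightarrow> y \<in> Rn n \<Longrightarrow>
      f x powr (1 - \<theta>) * g y powr \<theta> * exp (- (\<theta> * (1 - \<theta>) / 2 * sq_dist n x y)) \<le> h (convex_comb n \<theta> x y)"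
  shows "(LINT x|gaussian n. f x) powr (1 - \<theta>) * (LINT x|gaussian n. g x) powr \<theta> \<le> (LINT x|gaussian n. h x)"
proof -
  note [measurable] = int[THEN borel_measurable_integrable]
  have lim: "(\<lambda>k. LINT x|gaussian n. min (u x) (real k)) \<longlonglongrightarrow> (LINT x|gaussian n. u x)"
    if u: "integrable (gaussian n) u" "\<And>x. x \<in> Rn n \<Longrightarrow> 0 \<le> u x" for u :: "(nat \<Rightarrow> real) \<Rightarrow> real"
  proof (rule integral_dominated_convergence[where w=u])
    note [measurable] = u(1)[THEN borel_measurable_integrable]
    show "AE x in gaussian n. (\<lambda>k. min (u x) (real k)) \<longlonglongrightarrow> u x"
    proof (rule AE_I2)
      fix x
      obtain k0 :: nat where "u x \<le> real k0" using real_arch_simple by blast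
      then have "\<forall>\<^sub>F k in sequentially. min (u x) (real k) = u x"
        by (intro eventually_sequentiallyI[of k0]) auto
      then show "(\<lambda>k. min (u x) (real k)) \<longlonglongrightarrow> u x" by (rule tendsto_eventually)
    qed
    show "AE x in gaussian n. norm (min (u x) (real k)) \<le> u x" for k
      using u by (intro AE_I2) (auto simp: space_gaussian min_def)
  qed (use u in auto)
  have "(LINT x|gaussian n. min (f x) (real k)) powr (1 - \<theta>) * (LINT x|gaussian n. min (g x) (real k)) powr \<theta>
     \<le> (LINT x|gaussian n. min (h x) (real k))" for k
  proof (rule Prekopa_Leindler_gaussian_bounded[where B="real k"])
    fix x y assume xy: "x \<in> Rn n" "y \<in> Rn n"
    let ?e = "exp (- (\<theta> * (1 - \<theta>) / 2 * sq_dist n x y))"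
    have e: "0 < ?e" "?e \<le> 1"
      using \<theta> by (auto simp: sq_dist_def sum_nonneg)
    have 1: "min (f x) (real k) powr (1 - \<theta>) * min (g y) (real k) powr \<theta> \<le> f x powr (1 - \<theta>) * g y powr \<theta>"
      using nn xy \<theta> by (intro mult_mono powr_mono2) auto
    have "min (f x) (real k) powr (1 - \<theta>) * min (g y) (real k) powr \<theta> \<le> real k powr (1 - \<theta>) * real k powr \<theta>"
      using nn xy \<theta> by (intro mult_mono powr_mono2) auto
    also have "\<dots> = real k" by (simp flip: powr_add)
    finally have 2: "min (f x) (real k) powr (1 - \<theta>) * min (g y) (real k) powr \<theta> \<le> real k" .
    show "min (f x) (real k) powr (1 - \<theta>) * min (g y) (real k) powr \<theta> * ?e \<le> min (h (convex_comb n \<theta> x y)) (real k)"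
      using order_trans[OF mult_right_mono[OF 1, of ?e] le[OF xy]] mult_mono[OF 2 e(2)] e by auto
  qed (use nn \<theta> in auto)
  moreover have "(\<lambda>k. (LINT x|gaussian n. min (f x) (real k)) powr (1 - \<theta>) * (LINT x|gaussian n. min (g x) (real k)) powr \<theta>)
     \<longlonglongrightarrow> (LINT x|gaussian n. f x) powr (1 - \<theta>) * (LINT x|gaussian n. g x) powr \<theta>"
  proof (intro tendsto_mult tendsto_powr' lim int nn tendsto_const)
    show "(LINT x|gaussian n. f x) \<noteq> 0 \<or> 0 < 1 - \<theta> \<and> (\<forall>\<^sub>F k in sequentially. 0 \<le> (LINT x|gaussian n. min (f x) (real k)))"
      "(LINT x|gaussian n. g x) \<noteq> 0 \<or> 0 < \<theta> \<and> (\<forall>\<^sub>F k in sequentially. 0 \<le> (LINT x|gaussian n. min (g x) (real k)))"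
      using nn \<theta> by (auto intro!: always_eventually integral_nonneg_AE AE_I2 simp: space_gaussian)
  qed
  ultimately show ?thesis
    by (intro LIMSEQ_le[OF _ lim[OF int(3) nn(3)]]) auto
qed

section \<open>Gaussian shifts and exponential moments\<close>

lemma nn_integral_std_normal_shift:
  fixes w :: real
  assumes [measurable]: "f \<in> borel_measurable borel"
  shows "(\<integral>\<^sup>+x. f (x + w) \<partial>std_normal_distribution)
    = (\<integral>\<^sup>+x. f x * ennreal (exp (w * x - w\<^sup>2 / 2)) \<partial>std_normal_distribution)"
proof -
  have \<phi>: "std_normal_density x * exp (w * x - w\<^sup>2 / 2) = std_normal_density (x - w)" for x
    by (simp add: std_normal_density_def power2_diff field_simps flip: exp_add)
  have "(\<integral>\<^sup>+x. f (x + w) \<partial>std_normal_distribution) = (\<integral>\<^sup>+x. std_normal_density x * f (x + w) \<partial>lborel)"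
    by (subst nn_integral_density) auto
  also have "\<dots> = (\<integral>\<^sup>+x. std_normal_density (x - w) * f x \<partial>lborel)"
    by (subst nn_integral_real_affine[of _ 1 "- w"]) (auto simp: add.commute)
  also have "\<dots> = (\<integral>\<^sup>+x. std_normal_density x * (f x * ennreal (exp (w * x - w\<^sup>2 / 2))) \<partial>lborel)"
    by (intro nn_integral_cong) (simp flip: \<phi> add: ennreal_mult' mult_ac)
  also have "\<dots> = (\<integral>\<^sup>+x. f x * ennreal (exp (w * x - w\<^sup>2 / 2)) \<partial>std_normal_distribution)"
    by (subst nn_integral_density) auto
  finally show ?thesis .
qed

definition shift :: "nat \<Rightarrow> (nat \<Rightarrow> real) \<Rightarrow> (nat \<Rightarrow> real) \<Rightarrow> nat \<Rightarrow> real" where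
  "shift n w x = (\<lambda>i\<in>{..<n}. x i + w i)"

lemma shift_Rn [simp]: "shift n w x \<in> Rn n"
  by (simp add: shift_def Rn_def)

lemma shift_fun_upd: "shift (Suc n) w (x(n := y)) = (shift n w x)(n := y + w n)"
  by (auto simp: shift_def fun_eq_iff less_Suc_eq)

lemma measurable_coord_gaussian [measurable]: "i < n \<Longrightarrow> (\<lambda>x. x i) \<in> borel_measurable (gaussian n)"
  unfolding gaussian_def by measurable

lemma measurable_inner_prod [measurable]: "(\<lambda>x. inner_prod n w x) \<in> borel_measurable (gaussian n)"
  unfolding inner_prod_def by measurable

lemma measurable_shift [measurable]: "shift n w \<in> gaussian n \<rightarrow>\<^sub>M gaussian n"
proof -
  have "(\<lambda>x. \<lambda>i\<in>{..<n}. x i + w i) \<in> gaussian n \<rightarrow>\<^sub>M (\<Pi>\<^sub>M i\<in>{..<n}. std_normal_distribution)"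
  proof (rule measurable_restrict)
    fix i assume "i \<in> {..<n}"
    then have [measurable]: "(\<lambda>x. x i) \<in> borel_measurable (gaussian n)" by simp
    have "(\<lambda>x. x i + w i) \<in> borel_measurable (gaussian n)" by measurable
    then show "(\<lambda>x. x i + w i) \<in> gaussian n \<rightarrow>\<^sub>M std_normal_distribution" by simp
  qed
  then show ?thesis unfolding gaussian_def[of n, symmetric] shift_def[abs_def] .
qed

lemma inner_prod_shift: "inner_prod n t (shift n w x) = inner_prod n t x + inner_prod n t w"
  by (simp add: inner_prod_def shift_def distrib_left sum.distrib)

text \<open>Coordinate by coordinate from the shift of the normal density. It gives the exponential
  moments (with f = 1), moves the signals in Sudakov minoration and moves the cells in the
  anticoncentration bound.\<close>

lemma Cameron_Martin_nn_integral:
  assumes "f \<in> borel_measurable (gaussian n)"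
  shows "(\<integral>\<^sup>+x. f (shift n w x) \<partial>gaussian n)
    = (\<integral>\<^sup>+x. f x * ennreal (exp (inner_prod n w x - inner_prod n w w / 2)) \<partial>gaussian n)"
  using assms
proof (induction n arbitrary: f)
  case 0
  have "gaussian 0 = count_space {\<lambda>_. undefined}" by (simp add: gaussian_def PiM_empty)
  moreover have "shift 0 w (\<lambda>_. undefined) = (\<lambda>_. undefined)" by (simp add: shift_def fun_eq_iff)
  ultimately show ?case by (simp add: nn_integral_count_space_finite inner_prod_def)
next
  case (Suc n)
  let ?N = std_normal_distribution
  interpret N: prob_space ?N by (rule prob_space_std_normal)
  interpret product_sigma_finite "\<lambda>_::nat. ?N" by (rule product_sigma_finite_std_normal)
  note f = Suc.prems
  have eq: "(\<integral>\<^sup>+x. u x \<partial>gaussian (Suc n)) = (\<integral>\<^sup>+x. \<integral>\<^sup>+y. u (x(n := y)) \<partial>?N \<partial>gaussian n)"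
    if "u \<in> borel_measurable (gaussian (Suc n))" for u :: "(nat \<Rightarrow> real) \<Rightarrow> ennreal"
    using that unfolding gaussian_Suc by (subst product_nn_integral_insert) (auto simp: gaussian_def)
  have sec: "(\<lambda>y. f (x(n := y))) \<in> borel_measurable borel" if "x \<in> Rn n" for x
    using f that by (rule measurable_gaussian_Suc_section)
  define F where "F x = (\<integral>\<^sup>+y. f (x(n := y)) * ennreal (exp (w n * y - (w n)\<^sup>2 / 2)) \<partial>?N)" for x
  have [measurable]: "F \<in> borel_measurable (gaussian n)"
  proof -
    have [measurable]: "(\<lambda>p. f ((fst p)(n := snd p))) \<in> borel_measurable (gaussian n \<Otimes>\<^sub>M ?N)"
      using measurable_gaussian_Suc_upd[OF f] unfolding case_prod_beta' .
    have "(\<lambda>p. f ((fst p)(n := snd p)) * ennreal (exp (w n * snd p - (w n)\<^sup>2 / 2))) \<in> borel_measurable (gaussian n \<Otimes>\<^sub>M ?N)"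
      by measurable
    then show ?thesis
      unfolding F_def by (intro N.borel_measurable_nn_integral) (simp only: case_prod_beta')
  qed
  have "(\<integral>\<^sup>+x. f (shift (Suc n) w x) \<partial>gaussian (Suc n))
     = (\<integral>\<^sup>+x. \<integral>\<^sup>+y. f ((shift n w x)(n := y + w n)) \<partial>?N \<partial>gaussian n)"
    using f by (subst eq) (auto simp: shift_fun_upd)
  also have "\<dots> = (\<integral>\<^sup>+x. F (shift n w x) \<partial>gaussian n)"
    unfolding F_def by (intro nn_integral_cong nn_integral_std_normal_shift sec) simp
  also have "\<dots> = (\<integral>\<^sup>+x. F x * ennreal (exp (inner_prod n w x - inner_prod n w w / 2)) \<partial>gaussian n)"
    by (rule Suc.IH) measurable
  also have "\<dots> = (\<integral>\<^sup>+x. \<integral>\<^sup>+y. f (x(n := y)) * ennreal (exp (inner_prod (Suc n) w (x(n := y)) - inner_prod (Suc n) w w / 2)) \<partial>?N \<partial>gaussian n)"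
  proof (intro nn_integral_cong)
    fix x assume "x \<in> space (gaussian n)"
    then have [measurable]: "(\<lambda>y. f (x(n := y))) \<in> borel_measurable borel"
      by (intro sec) (simp add: space_gaussian)
    have ip: "exp (inner_prod (Suc n) w (x(n := y)) - inner_prod (Suc n) w w / 2)
      = exp (w n * y - (w n)\<^sup>2 / 2) * exp (inner_prod n w x - inner_prod n w w / 2)" for y
      by (simp add: inner_prod_def power2_eq_square add_divide_distrib flip: exp_add)
    show "F x * ennreal (exp (inner_prod n w x - inner_prod n w w / 2))
      = (\<integral>\<^sup>+y. f (x(n := y)) * ennreal (exp (inner_prod (Suc n) w (x(n := y)) - inner_prod (Suc n) w w / 2)) \<partial>?N)"
      unfolding F_def ip
      by (subst nn_integral_multc[symmetric]) (auto simp: ennreal_mult mult.assoc intro!: nn_integral_cong)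
  qed
  also have "\<dots> = (\<integral>\<^sup>+x. f x * ennreal (exp (inner_prod (Suc n) w x - inner_prod (Suc n) w w / 2)) \<partial>gaussian (Suc n))"
    using f by (subst eq) auto
  finally show ?case .
qed

lemma nn_integral_exp_inner_prod:
  "(\<integral>\<^sup>+x. ennreal (exp (inner_prod n w x)) \<partial>gaussian n) = ennreal (exp (inner_prod n w w / 2))"
proof -
  interpret prob_space "gaussian n" by (rule prob_space_gaussian)
  have "1 = (\<integral>\<^sup>+x. ennreal (exp (inner_prod n w x - inner_prod n w w / 2)) \<partial>gaussian n)"
    using Cameron_Martin_nn_integral[of "\<lambda>_. 1" n w] by (simp add: emeasure_space_1)
  also have "\<dots> = ennreal (exp (- inner_prod n w w / 2)) * (\<integral>\<^sup>+x. ennreal (exp (inner_prod n w x)) \<partial>gaussian n)"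
    by (subst nn_integral_cmult[symmetric]) (auto simp flip: ennreal_mult exp_add)
  finally have "ennreal (exp (inner_prod n w w / 2)) * 1 = ennreal (exp (inner_prod n w w / 2)) * (ennreal (exp (- inner_prod n w w / 2)) * (\<integral>\<^sup>+x. ennreal (exp (inner_prod n w x)) \<partial>gaussian n))"
    by simp
  then show ?thesis by (simp add: mult.assoc[symmetric] flip: ennreal_mult exp_add)
qed

lemma integrable_exp_inner_prod: "integrable (gaussian n) (\<lambda>x. exp (inner_prod n w x))"
  by (intro integrableI_nonneg) (auto simp: nn_integral_exp_inner_prod)

lemma integral_exp_inner_prod:
  "(LINT x|gaussian n. exp (inner_prod n w x)) = exp (inner_prod n w w / 2)"
  by (subst integral_eq_nn_integral) (auto simp: nn_integral_exp_inner_prod)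

lemma inner_prod_scale_left: "inner_prod n (\<lambda>i. c * w i) x = c * inner_prod n w x"
  by (simp add: inner_prod_def sum_distrib_left mult.assoc)

lemma inner_prod_scale_right: "inner_prod n w (\<lambda>i. c * x i) = c * inner_prod n w x"
  by (simp add: inner_prod_def sum_distrib_left mult_ac)

lemma inner_prod_diff_left: "inner_prod n (\<lambda>i. v i - w i) x = inner_prod n v x - inner_prod n w x"
  by (simp add: inner_prod_def sum_subtractf left_diff_distrib)

lemma inner_prod_convex_comb:
  "inner_prod n w (convex_comb n \<theta> x y) = (1 - \<theta>) * inner_prod n w x + \<theta> * inner_prod n w y"
  by (simp add: inner_prod_def convex_comb_def distrib_left sum.distrib sum_distrib_left mult_ac)

text \<open>Young's inequality in each coordinate with a free weight \<open>c\<close>; the sign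
  \<open>s\<close> treats both directions at once. The weight is later chosen so that the
  \<open>sq_dist\<close> term is absorbed by the Gaussian gain in Prekopa-Leindler.\<close>

lemma inner_prod_le_sq_dist:
  assumes "0 < c"
  shows "\<bar>inner_prod n w x - inner_prod n w y\<bar> \<le> inner_prod n w w / (2 * c) + c / 2 * sq_dist n x y"
proof -
  have *: "s * (w i * (x i - y i)) \<le> w i * w i / (2 * c) + c / 2 * (x i - y i)\<^sup>2" if "s\<^sup>2 = 1" for s i
  proof -
    have "0 \<le> (s * w i - c * (x i - y i))\<^sup>2" by simp
    also have "\<dots> = w i * w i + c\<^sup>2 * (x i - y i)\<^sup>2 - 2 * c * (s * (w i * (x i - y i)))"
      using that by (simp add: power2_diff power_mult_distrib) (simp add: power2_eq_square)
    finally show ?thesis using assms by (simp add: field_simps power2_eq_square)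
  qed
  have "s * (inner_prod n w x - inner_prod n w y) \<le> inner_prod n w w / (2 * c) + c / 2 * sq_dist n x y" if "s\<^sup>2 = 1" for s
  proof -
    have "s * (inner_prod n w x - inner_prod n w y) = (\<Sum>i<n. s * (w i * (x i - y i)))"
      by (simp add: inner_prod_def right_diff_distrib sum_subtractf sum_distrib_left)
    also have "\<dots> \<le> (\<Sum>i<n. w i * w i / (2 * c) + c / 2 * (x i - y i)\<^sup>2)"
      by (intro sum_mono * that)
    also have "\<dots> = inner_prod n w w / (2 * c) + c / 2 * sq_dist n x y"
      by (simp add: inner_prod_def sq_dist_def sum.distrib sum_divide_distrib sum_distrib_left)
    finally show ?thesis .
  qed
  from this[of 1] this[of "-1"] show ?thesis by (simp add: abs_le_iff)
qed

text \<open>Chernoff's bound with \<open>k\<close> left free, which avoids a division by the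
  possibly vanishing \<open>inner_prod n w w\<close>.\<close>

lemma gaussian_tail:
  assumes "0 \<le> k"
  shows "measure (gaussian n) {x \<in> Rn n. \<tau> \<le> inner_prod n w x} \<le> exp (k\<^sup>2 * inner_prod n w w / 2 - k * \<tau>)"
proof -
  interpret prob_space "gaussian n" by (rule prob_space_gaussian)
  have ip: "k * inner_prod n w x = inner_prod n (\<lambda>i. k * w i) x" for x
    by (simp add: inner_prod_scale_left)
  have int: "integrable (gaussian n) (\<lambda>x. exp (k * inner_prod n w x))"
    unfolding ip by (rule integrable_exp_inner_prod)
  have "measure (gaussian n) {x \<in> Rn n. \<tau> \<le> inner_prod n w x}
    \<le> measure (gaussian n) {x \<in> space (gaussian n). exp (k * \<tau>) \<le> exp (k * inner_prod n w x)}"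
  proof (rule finite_measure_mono)
    show "{x \<in> space (gaussian n). exp (k * \<tau>) \<le> exp (k * inner_prod n w x)} \<in> events"
      by measurable
  qed (use assms in \<open>auto simp: space_gaussian intro: mult_left_mono\<close>)
  also have "\<dots> \<le> (LINT x|gaussian n. exp (k * inner_prod n w x)) / exp (k * \<tau>)"
    by (intro integral_Markov_inequality_measure[where A="{}"] int) auto
  also have "\<dots> = exp (k\<^sup>2 * inner_prod n w w / 2 - k * \<tau>)"
    unfolding ip integral_exp_inner_prod
    by (simp add: inner_prod_scale_left inner_prod_scale_right exp_diff power2_eq_square)
  finally show ?thesis .
qed

section \<open>Sub-Gaussian increments under log-concave weights\<close>

lemma abs_le_exp_add_exp: "\<bar>y::real\<bar> \<le> exp y + exp (- y)"
  using exp_ge_add_one_self[of y] exp_ge_add_one_self[of "- y"] exp_ge_zero[of y] exp_ge_zero[of "- y"]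
  by linarith

lemma inner_prod_minus_left: "inner_prod n (\<lambda>i. - w i) x = - inner_prod n w x"
  by (simp add: inner_prod_def sum_negf)

lemma integrable_inner_prod: "integrable (gaussian n) (\<lambda>x. inner_prod n w x)"
proof (rule Bochner_Integration.integrable_bound)
  show "integrable (gaussian n) (\<lambda>x. exp (inner_prod n w x) + exp (inner_prod n (\<lambda>i. - w i) x))"
    by (intro Bochner_Integration.integrable_add integrable_exp_inner_prod)
qed (auto intro!: AE_I2 simp: inner_prod_minus_left abs_le_exp_add_exp intro: order_trans[OF _ abs_ge_self])

lemma integrable_weight_mult:
  fixes p f :: "'a \<Rightarrow> real"
  assumes "p \<in> borel_measurable M" "integrable M f"
    and "\<And>x. x \<in> space M \<Longrightarrow> 0 \<le> p x" "\<And>x. x \<in> space M \<Longrightarrow> p x \<le> 1"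
  shows "integrable M (\<lambda>x. p x * f x)"
proof (rule Bochner_Integration.integrable_bound[OF assms(2)])
  show "(\<lambda>x. p x * f x) \<in> borel_measurable M" using assms by measurable
  show "AE x in M. norm (p x * f x) \<le> norm (f x)"
    using assms(3,4) by (intro AE_I2) (auto simp: abs_mult intro: mult_left_le_one_le)
qed

text \<open>Prekopa-Leindler at \<theta> = 1/2 for p exp (v.x), p exp (- v.x) and p exp (|v|^2 / 2):
  the gain exp (- |x - y|^2 / 8) absorbs v.(x - y) / 2. The product of the two moments does not
  change when v.x is centred, and the bound is relative to the mass of \<open>p\<close>, so a rare
  cell is no worse than a large one.\<close>

lemma log_concave_weight_mgf_prod:
  assumes p: "p \<in> borel_measurable (gaussian n)" "\<And>x. x \<in> Rn n \<Longrightarrow> 0 \<le> p x" "\<And>x. x \<in> Rn n \<Longrightarrow> p x \<le> 1"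
    and lc: "\<And>x y. x \<in> Rn n \<Longrightarrow> y \<in> Rn n \<Longrightarrow> sqrt (p x * p y) \<le> p (convex_comb n (1/2) x y)"
  shows "(LINT x|gaussian n. p x * exp (inner_prod n v x)) * (LINT x|gaussian n. p x * exp (- inner_prod n v x))
    \<le> (LINT x|gaussian n. p x)\<^sup>2 * exp (inner_prod n v v)"
proof -
  interpret prob_space "gaussian n" by (rule prob_space_gaussian)
  let ?F = "LINT x|gaussian n. p x * exp (inner_prod n v x)"
  let ?G = "LINT x|gaussian n. p x * exp (- inner_prod n v x)"
  have int: "integrable (gaussian n) (\<lambda>x. p x * exp (inner_prod n w x))" for w
    using p by (intro integrable_weight_mult integrable_exp_inner_prod) (auto simp: space_gaussian)
  have intp: "integrable (gaussian n) p"
    using int[of "\<lambda>_. 0"] by (simp add: inner_prod_def)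
  have 1: "?F powr (1 - 1/2) * ?G powr (1/2) \<le> (LINT x|gaussian n. p x * exp (inner_prod n v v / 2))"
  proof (rule Prekopa_Leindler_gaussian)
    show "integrable (gaussian n) (\<lambda>x. p x * exp (- inner_prod n v x))"
      using int[of "\<lambda>i. - v i"] by (simp add: inner_prod_minus_left)
    fix x y assume xy: "x \<in> Rn n" "y \<in> Rn n"
    let ?s = "sq_dist n x y"
    have half: "(c * exp u) powr (1/2) = sqrt c * exp (u / 2)" if "0 \<le> c" for c u :: real
      using that by (simp add: powr_mult powr_half_sqrt exp_powr_real)
    have "(p x * exp (inner_prod n v x)) powr (1 - 1/2) * (p y * exp (- inner_prod n v y)) powr (1/2) * exp (- (1/2 * (1 - 1/2) / 2 * ?s))
      = (sqrt (p x) * exp (inner_prod n v x / 2)) * (sqrt (p y) * exp (- inner_prod n v y / 2)) * exp (- (?s / 8))"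
      using half[of "p x" "inner_prod n v x"] half[of "p y" "- inner_prod n v y"] p xy by simp
    also have "\<dots> = sqrt (p x * p y) * (exp ((inner_prod n v x - inner_prod n v y) / 2) * exp (- (?s / 8)))"
    proof -
      have "exp (inner_prod n v x / 2) * exp (- inner_prod n v y / 2) = exp ((inner_prod n v x - inner_prod n v y) / 2)"
        by (simp add: diff_divide_distrib flip: exp_add)
      then show ?thesis by (simp add: real_sqrt_mult)
    qed
    also have "exp ((inner_prod n v x - inner_prod n v y) / 2) * exp (- (?s / 8)) \<le> exp (inner_prod n v v / 2)"
    proof -
      have "(inner_prod n v x - inner_prod n v y) / 2 - ?s / 8 \<le> inner_prod n v v / 2"
        using abs_le_D1[OF inner_prod_le_sq_dist[of "1/2" n v x y]] by (simp add: field_simps)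
      then show ?thesis by (simp flip: exp_add)
    qed
    also have "sqrt (p x * p y) * exp (inner_prod n v v / 2) \<le> p (convex_comb n (1/2) x y) * exp (inner_prod n v v / 2)"
      using lc[OF xy] by (intro mult_right_mono) auto
    finally show "(p x * exp (inner_prod n v x)) powr (1 - 1/2) * (p y * exp (- inner_prod n v y)) powr (1/2) * exp (- (1/2 * (1 - 1/2) / 2 * ?s))
      \<le> p (convex_comb n (1/2) x y) * exp (inner_prod n v v / 2)"
      using p xy by (auto simp: mult_left_mono)
  qed (use p int intp in auto)
  have "sqrt (?F * ?G) \<le> (LINT x|gaussian n. p x) * exp (inner_prod n v v / 2)"
  proof -
    have "0 \<le> ?F" "0 \<le> ?G"
      using p by (auto intro!: integral_nonneg_AE AE_I2 simp: space_gaussian)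
    then show ?thesis
      using 1 by (simp add: powr_half_sqrt real_sqrt_mult)
  qed
  moreover have "0 \<le> ?F * ?G"
    using p by (intro mult_nonneg_nonneg integral_nonneg_AE AE_I2) (auto simp: space_gaussian)
  ultimately have "?F * ?G \<le> ((LINT x|gaussian n. p x) * exp (inner_prod n v v / 2))\<^sup>2"
    by (metis sqrt_le_D)
  then show ?thesis
    by (simp add: power_mult_distrib flip: exp_double)
qed

text \<open>By Jensen the centred moment at -k is at least the mass of \<open>p\<close>, so the
  bound on the product of the moments at k and -k becomes a bound on the moment at k alone. The
  exponent is twice that of the unweighted Gaussian moment.\<close>

lemma log_concave_weight_centered_mgf:
  assumes p: "p \<in> borel_measurable (gaussian n)" "\<And>x. x \<in> Rn n \<Longrightarrow> 0 \<le> p x" "\<And>x. x \<in> Rn n \<Longrightarrow> p x \<le> 1"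
    and lc: "\<And>x y. x \<in> Rn n \<Longrightarrow> y \<in> Rn n \<Longrightarrow> sqrt (p x * p y) \<le> p (convex_comb n (1/2) x y)"
    and pos: "0 < (LINT x|gaussian n. p x)"
    and m: "m = (LINT x|gaussian n. p x * inner_prod n v x) / (LINT x|gaussian n. p x)"
  shows "(LINT x|gaussian n. p x * exp (k * (inner_prod n v x - m)))
    \<le> (LINT x|gaussian n. p x) * exp (k\<^sup>2 * inner_prod n v v)"
proof -
  let ?P = "LINT x|gaussian n. p x"
  have intw: "integrable (gaussian n) (\<lambda>x. p x * exp (inner_prod n w x))" for w
    using p by (intro integrable_weight_mult integrable_exp_inner_prod) (auto simp: space_gaussian)
  have int: "integrable (gaussian n) (\<lambda>x. p x * exp (c * inner_prod n v x))" for c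
    using intw[of "\<lambda>i. c * v i"] by (simp add: inner_prod_scale_left)
  have intp: "integrable (gaussian n) p"
    using int[of 0] by simp
  have intv: "integrable (gaussian n) (\<lambda>x. p x * inner_prod n v x)"
    using p by (intro integrable_weight_mult integrable_inner_prod) (auto simp: space_gaussian)
  \<comment> \<open>Jensen in the form 1 + y \<le> exp y: the linear terms cancel because
    \<open>m\<close> is the mean of v.x under the weight \<open>p\<close>.\<close>
  have "?P = (LINT x|gaussian n. p x + k * m * p x - k * (p x * inner_prod n v x))"
    using pos intp intv by (simp add: m)
  also have "\<dots> \<le> (LINT x|gaussian n. exp (k * m) * (p x * exp (- k * inner_prod n v x)))"
  proof (rule integral_mono)
    fix x assume "x \<in> space (gaussian n)"
    then have "0 \<le> p x" using p by (simp add: space_gaussian)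
    then have "p x * (1 + k * (m - inner_prod n v x)) \<le> p x * exp (k * (m - inner_prod n v x))"
      by (intro mult_left_mono exp_ge_add_one_self)
    then show "p x + k * m * p x - k * (p x * inner_prod n v x) \<le> exp (k * m) * (p x * exp (- k * inner_prod n v x))"
      by (simp add: right_diff_distrib exp_diff exp_minus divide_inverse mult_ac) (simp add: algebra_simps)
  qed (use intp intv int[of "- k"] in auto)
  finally have 1: "?P \<le> exp (k * m) * (LINT x|gaussian n. p x * exp (- k * inner_prod n v x))" by simp
  let ?F = "LINT x|gaussian n. p x * exp (k * inner_prod n v x)"
  let ?G = "LINT x|gaussian n. p x * exp (- k * inner_prod n v x)"
  have F: "0 \<le> ?F" using p by (intro integral_nonneg_AE AE_I2) (auto simp: space_gaussian)
  have 2: "?F * ?G \<le> ?P\<^sup>2 * exp (k\<^sup>2 * inner_prod n v v)"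
  proof -
    have *: "inner_prod n (\<lambda>i. k * v i) x = k * inner_prod n v x"
      "inner_prod n (\<lambda>i. k * v i) (\<lambda>i. k * v i) = k\<^sup>2 * inner_prod n v v" for x
      by (simp_all add: inner_prod_scale_left inner_prod_scale_right power2_eq_square)
    show ?thesis
      using log_concave_weight_mgf_prod[where p = p and n = n and v = "\<lambda>i. k * v i", OF p lc]
      unfolding *(2) unfolding *(1) by simp
  qed
  have "?F * ?P \<le> ?F * (exp (k * m) * ?G)"
    by (intro mult_left_mono 1 F)
  also have "\<dots> = exp (k * m) * (?F * ?G)" by simp
  also have "\<dots> \<le> exp (k * m) * (?P\<^sup>2 * exp (k\<^sup>2 * inner_prod n v v))"
    by (intro mult_left_mono 2) simp
  finally have "?F * ?P \<le> exp (k * m) * (?P\<^sup>2 * exp (k\<^sup>2 * inner_prod n v v))" .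
  then have "?F \<le> exp (k * m) * (?P * exp (k\<^sup>2 * inner_prod n v v))"
    using pos by (simp add: power2_eq_square field_simps)
  then have "exp (- k * m) * ?F \<le> ?P * exp (k\<^sup>2 * inner_prod n v v)"
    by (simp add: exp_minus field_simps)
  also have "exp (- k * m) * ?F = (LINT x|gaussian n. p x * exp (k * (inner_prod n v x - m)))"
  proof -
    have *: "p x * exp (k * (inner_prod n v x - m)) = exp (- k * m) * (p x * exp (k * inner_prod n v x))" for x
      by (simp add: right_diff_distrib exp_diff exp_minus divide_inverse)
    show ?thesis unfolding * by simp
  qed
  finally show ?thesis .
qed

lemma integral_abs_inner_prod_le:
  "(LINT x|gaussian n. \<bar>inner_prod n w x\<bar>) \<le> 2 * exp (inner_prod n w w / 2)"
proof -
  have "(LINT x|gaussian n. \<bar>inner_prod n w x\<bar>)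
    \<le> (LINT x|gaussian n. exp (inner_prod n w x) + exp (inner_prod n (\<lambda>i. - w i) x))"
    by (intro integral_mono Bochner_Integration.integrable_add integrable_exp_inner_prod integrable_abs integrable_inner_prod)
      (simp add: inner_prod_minus_left abs_le_exp_add_exp)
  also have "\<dots> = 2 * exp (inner_prod n w w / 2)"
    by (simp add: integrable_exp_inner_prod integral_exp_inner_prod)
      (simp add: inner_prod_def)
  finally show ?thesis .
qed

text \<open>Summing the bounds over the cells brings in the total mass 1 rather than a factor
  \<open>card T\<close>. The bound on \<open>m\<close> does grow with \<open>card T\<close>, but it
  does not involve the weights; therefore the number of time steps can be fixed before the weights
  of the later steps are known.\<close>

lemma centering_of_log_concave_partition:
  fixes p :: "'i \<Rightarrow> (nat \<Rightarrow> real) \<Rightarrow> real" and v :: "'i \<Rightarrow> nat \<Rightarrow> real"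
  assumes T: "finite T" "T \<noteq> {}"
    and p: "\<And>t. t \<in> T \<Longrightarrow> p t \<in> borel_measurable (gaussian n)"
      "\<And>t x. t \<in> T \<Longrightarrow> x \<in> Rn n \<Longrightarrow> 0 \<le> p t x"
      "\<And>x. x \<in> Rn n \<Longrightarrow> (\<Sum>t\<in>T. p t x) = 1"
      "\<And>t x y. t \<in> T \<Longrightarrow> x \<in> Rn n \<Longrightarrow> y \<in> Rn n \<Longrightarrow> sqrt (p t x * p t y) \<le> p t (convex_comb n (1/2) x y)"
    and v: "\<And>t. t \<in> T \<Longrightarrow> inner_prod n (v t) (v t) \<le> d"
  shows "\<exists>m. (\<forall>t\<in>T. \<bar>m t\<bar> \<le> (real (card T))\<^sup>2 * (2 * exp (d / 2))) \<and>
    (\<forall>k. (\<Sum>t\<in>T. LINT x|gaussian n. p t x * exp (k * (inner_prod n (v t) x - m t))) \<le> 2 * exp (2 * k\<^sup>2 * d))"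
proof -
  interpret prob_space "gaussian n" by (rule prob_space_gaussian)
  define N where "N = real (card T)"
  have N: "1 \<le> N" using T unfolding N_def by (simp add: Suc_le_eq card_gt_0_iff)
  have p1: "p t x \<le> 1" if "t \<in> T" "x \<in> Rn n" for t x
    using p(3)[OF that(2)] member_le_sum[of t T "\<lambda>t. p t x"] T p(2) that by simp
  define P where "P t = (LINT x|gaussian n. p t x)" for t
  have intw: "integrable (gaussian n) (\<lambda>x. p t x * f x)" if "t \<in> T" "integrable (gaussian n) f" for t f
    using p p1 that by (intro integrable_weight_mult) (auto simp: space_gaussian)
  have intp: "integrable (gaussian n) (p t)" if "t \<in> T" for t
    using intw[OF that, of "\<lambda>_. 1"] by simp
  have sumP: "(\<Sum>t\<in>T. P t) = 1"
  proof -
    have "(\<Sum>t\<in>T. P t) = (LINT x|gaussian n. (\<Sum>t\<in>T. p t x))"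
      unfolding P_def using intp by (intro Bochner_Integration.integral_sum[symmetric])
    also have "\<dots> = (LINT x|gaussian n. 1)"
      using p(3) by (intro Bochner_Integration.integral_cong) (auto simp: space_gaussian)
    finally show ?thesis by (simp add: prob_space)
  qed
  (* Weights of mass below 1/N^2 are left uncentred: they contribute little to the sum, and in
     this way m stays bounded uniformly in p. *)
  define m where "m t = (if P t < 1 / N\<^sup>2 then 0 else (LINT x|gaussian n. p t x * inner_prod n (v t) x) / P t)" for t
  have "\<bar>m t\<bar> \<le> N\<^sup>2 * (2 * exp (d / 2))" if t: "t \<in> T" for t
  proof (cases "P t < 1 / N\<^sup>2")
    case False
    then have P: "1 / N\<^sup>2 \<le> P t" by simp
    have P0: "0 < P t" using P N by (smt (verit) divide_pos_pos zero_less_power)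
    have "\<bar>LINT x|gaussian n. p t x * inner_prod n (v t) x\<bar> \<le> (LINT x|gaussian n. \<bar>p t x * inner_prod n (v t) x\<bar>)"
      by (rule integral_abs_bound)
    also have "\<dots> \<le> (LINT x|gaussian n. \<bar>inner_prod n (v t) x\<bar>)"
      using p(2)[OF t] p1[OF t] t
      by (intro integral_mono integrable_abs intw integrable_inner_prod)
        (auto simp: abs_mult space_gaussian intro: mult_left_le_one_le)
    also have "\<dots> \<le> 2 * exp (inner_prod n (v t) (v t) / 2)" by (rule integral_abs_inner_prod_le)
    also have "\<dots> \<le> 2 * exp (d / 2)" using v[OF t] by simp
    finally have "\<bar>m t\<bar> \<le> 2 * exp (d / 2) / P t"
      using False P0 by (simp add: m_def divide_right_mono)
    also have "\<dots> \<le> 2 * exp (d / 2) / (1 / N\<^sup>2)"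
      using P P0 N by (intro divide_left_mono) auto
    finally show ?thesis by (simp add: mult.commute)
  qed (use N in \<open>simp add: m_def\<close>)
  moreover have "(\<Sum>t\<in>T. LINT x|gaussian n. p t x * exp (k * (inner_prod n (v t) x - m t))) \<le> 2 * exp (2 * k\<^sup>2 * d)" for k
  proof -
    let ?E = "exp (2 * k\<^sup>2 * d)"
    have "(LINT x|gaussian n. p t x * exp (k * (inner_prod n (v t) x - m t))) \<le> (P t + 1 / N) * ?E" if t: "t \<in> T" for t
    proof (cases "P t < 1 / N\<^sup>2")
      case False
      then have "1 / N\<^sup>2 \<le> P t" by simp
      then have P0: "0 < P t" using N by (smt (verit) divide_pos_pos zero_less_power)
      have "(LINT x|gaussian n. p t x * exp (k * (inner_prod n (v t) x - m t))) \<le> P t * exp (k\<^sup>2 * inner_prod n (v t) (v t))"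
        unfolding P_def
        by (rule log_concave_weight_centered_mgf) (use p p1 t False P0 in \<open>auto simp: m_def P_def\<close>)
      also have "k\<^sup>2 * inner_prod n (v t) (v t) \<le> k\<^sup>2 * d"
        using v[OF t] by (intro mult_left_mono) auto
      also have "k\<^sup>2 * d \<le> 2 * k\<^sup>2 * d"
      proof -
        have "0 \<le> d" using v[OF t] by (smt (verit) inner_prod_def sum_nonneg zero_le_square)
        then show ?thesis by simp
      qed
      finally have "(LINT x|gaussian n. p t x * exp (k * (inner_prod n (v t) x - m t))) \<le> P t * ?E"
        using P0 by (simp add: mult_left_mono)
      also have "\<dots> \<le> (P t + 1 / N) * ?E" using N by (intro mult_right_mono) auto
      finally show ?thesis .
    next
      case True
      have ip: "exp (2 * (k * inner_prod n (v t) x)) = exp (inner_prod n (\<lambda>i. 2 * k * v t i) x)" for x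
        by (simp add: inner_prod_scale_left mult.assoc)
      have int2: "integrable (gaussian n) (\<lambda>x. exp (2 * (k * inner_prod n (v t) x)))"
        unfolding ip by (rule integrable_exp_inner_prod)
      have int1: "integrable (gaussian n) (\<lambda>x. p t x * exp (k * inner_prod n (v t) x))"
        using integrable_exp_inner_prod[of n "\<lambda>i. k * v t i"] t by (intro intw) (auto simp: inner_prod_scale_left)
      have "(LINT x|gaussian n. p t x * exp (k * (inner_prod n (v t) x - m t))) = (LINT x|gaussian n. p t x * exp (k * inner_prod n (v t) x))"
        using True by (simp add: m_def)
      also have "\<dots> \<le> (LINT x|gaussian n. N / 2 * p t x + 1 / (2 * N) * exp (2 * (k * inner_prod n (v t) x)))"
      proof (intro integral_mono int1 Bochner_Integration.integrable_add integrable_mult_right intp t int2)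
        fix x assume "x \<in> space (gaussian n)"
        then have px: "0 \<le> p t x" "p t x \<le> 1" using p p1 t by (auto simp: space_gaussian)
        let ?e = "exp (k * inner_prod n (v t) x)"
        \<comment> \<open>The weight N balances a mass below 1/N^2 against the square of
          \<open>?e\<close>: an uncentred cell contributes at most \<open>?E\<close> / N, so all of
          them together at most \<open>?E\<close>. That square is the source of the factor 2 in the
          final exponent.\<close>
        have "0 \<le> (N * p t x - ?e)\<^sup>2" by simp
        also have "\<dots> = N\<^sup>2 * (p t x)\<^sup>2 + exp (2 * (k * inner_prod n (v t) x)) - 2 * N * (p t x * ?e)"
          by (simp add: power2_diff power_mult_distrib exp_double)
        also have "N\<^sup>2 * (p t x)\<^sup>2 \<le> N\<^sup>2 * p t x"
          using px by (intro mult_left_mono) (auto simp: power2_eq_square mult_left_le_one_le)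
        finally have "2 * N * (p t x * ?e) \<le> N\<^sup>2 * p t x + exp (2 * (k * inner_prod n (v t) x))" by simp
        then show "p t x * ?e \<le> N / 2 * p t x + 1 / (2 * N) * exp (2 * (k * inner_prod n (v t) x))"
          using N by (simp add: field_simps power2_eq_square)
      qed
      also have "\<dots> = N / 2 * P t + 1 / (2 * N) * exp (2 * k\<^sup>2 * inner_prod n (v t) (v t))"
      proof -
        have "(LINT x|gaussian n. exp (2 * (k * inner_prod n (v t) x))) = exp (2 * k\<^sup>2 * inner_prod n (v t) (v t))"
          unfolding ip integral_exp_inner_prod
          by (simp add: inner_prod_scale_left inner_prod_scale_right power2_eq_square)
        then show ?thesis using int2 intp[OF t] by (simp add: P_def)
      qed
      also have "\<dots> \<le> N / 2 * (1 / N\<^sup>2) + 1 / (2 * N) * ?E"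
        using True N v[OF t] by (intro add_mono mult_left_mono) (auto intro: mult_left_mono)
      also have "\<dots> = 1 / (2 * N) * (1 + ?E)"
        using N by (simp add: field_simps power2_eq_square)
      also have "\<dots> \<le> 1 / (2 * N) * (?E + ?E)"
      proof -
        have "0 \<le> d" using v[OF t] by (smt (verit) inner_prod_def sum_nonneg zero_le_square)
        then show ?thesis using N by (intro mult_left_mono add_mono) auto
      qed
      also have "\<dots> \<le> (P t + 1 / N) * ?E"
      proof -
        have "0 \<le> P t" unfolding P_def using p(2)[OF t] by (intro integral_nonneg_AE AE_I2) (auto simp: space_gaussian)
        then show ?thesis by (simp add: distrib_right)
      qed
      finally show ?thesis .
    qed
    then have "(\<Sum>t\<in>T. LINT x|gaussian n. p t x * exp (k * (inner_prod n (v t) x - m t))) \<le> (\<Sum>t\<in>T. (P t + 1 / N) * ?E)"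
      by (rule sum_mono)
    also have "\<dots> = 2 * ?E"
      using N by (simp add: sum_distrib_right[symmetric] sum.distrib sumP N_def)
    finally show ?thesis .
  qed
  ultimately show ?thesis unfolding N_def by blast
qed

section \<open>Perturbing the points of a maximum of affine functions\<close>

text \<open>Jensen for exp, by the tangent line at the weighted mean \<open>c\<close>.\<close>

lemma exp_weighted_sum_le:
  fixes q y :: "'i \<Rightarrow> real"
  assumes "\<And>t. t \<in> T \<Longrightarrow> 0 \<le> q t" "(\<Sum>t\<in>T. q t) = 1"
  shows "exp (\<Sum>t\<in>T. q t * y t) \<le> (\<Sum>t\<in>T. q t * exp (y t))"
proof -
  define c where "c = (\<Sum>t\<in>T. q t * y t)"
  have "exp c = (\<Sum>t\<in>T. q t * (exp c * (1 + (y t - c))))"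
  proof -
    have "(\<Sum>t\<in>T. q t * (exp c * (1 + (y t - c)))) = exp c * ((\<Sum>t\<in>T. q t) * (1 - c) + (\<Sum>t\<in>T. q t * y t))"
      by (simp add: sum_distrib_left sum_distrib_right sum.distrib[symmetric] algebra_simps)
    then show ?thesis using assms(2) by (simp add: c_def[symmetric])
  qed
  also have "\<dots> \<le> (\<Sum>t\<in>T. q t * exp (y t))"
  proof (intro sum_mono mult_left_mono assms)
    fix t
    have "exp c * (1 + (y t - c)) \<le> exp c * exp (y t - c)"
      by (intro mult_left_mono exp_ge_add_one_self) simp
    then show "exp c * (1 + (y t - c)) \<le> exp (y t)" by (simp flip: exp_add)
  qed
  finally show ?thesis unfolding c_def .
qed

lemma exp_le_quadratic:
  fixes y :: real
  assumes "\<bar>y\<bar> \<le> 1"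
  shows "exp y \<le> 1 + y + y\<^sup>2"
proof (cases "0 \<le> y")
  case True
  then show ?thesis using assms by (intro exp_bound) auto
next
  case False
  define z where "z = - y"
  have z: "0 \<le> z" "z \<le> 1" using False assms by (auto simp: z_def)
  have "1 \<le> 1 + z\<^sup>2 / 2 + z ^ 3 / 2 + z ^ 4 / 2" using z by simp
  also have "\<dots> = (1 - z + z\<^sup>2) * (1 + z + z\<^sup>2 / 2)"
    by (simp add: field_simps power2_eq_square power3_eq_cube power4_eq_xxxx)
  also have "\<dots> \<le> (1 - z + z\<^sup>2) * exp z"
    using z by (intro mult_left_mono exp_lower_Taylor_quadratic) auto
  finally have "exp (- z) \<le> 1 - z + z\<^sup>2"
    by (simp add: exp_minus field_simps)
  then show ?thesis by (simp add: z_def)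
qed

section \<open>Soft maxima and their weights\<close>

definition softmax :: "'i set \<Rightarrow> ('i \<Rightarrow> real) \<Rightarrow> 'i \<Rightarrow> real" where
  "softmax T a t = exp (a t) / (\<Sum>u\<in>T. exp (a u))"

text \<open>A smooth substitute for the maximum whose gradient is \<open>softmax\<close>, so that
  small changes of the arguments can be expanded to second order. When the arguments are scaled by a
  large \<beta>, \<open>softmax\<close> is a soft indicator of the cell on which t is the
  maximiser.\<close>

definition log_sum_exp :: "'i set \<Rightarrow> ('i \<Rightarrow> real) \<Rightarrow> real" where
  "log_sum_exp T a = ln (\<Sum>u\<in>T. exp (a u))"

context
  fixes T :: "'i set"
  assumes T: "finite T" "T \<noteq> {}"
begin

lemma sum_exp_pos: "0 < (\<Sum>u\<in>T. exp (a u :: real))"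
  using T by (intro sum_pos) auto

lemma softmax_nonneg: "0 \<le> softmax T a t"
  using sum_exp_pos[of a] by (simp add: softmax_def)

lemma sum_softmax: "(\<Sum>t\<in>T. softmax T a t) = 1"
  using sum_exp_pos[of a] by (simp add: softmax_def sum_divide_distrib[symmetric])

text \<open>The numerator is log-linear in the arguments, and the denominator is midpoint log-convex
  by Cauchy-Schwarz. Midpoints suffice because the moment bound uses Prekopa-Leindler at \<theta> =
  1/2.\<close>

lemma softmax_log_concave:
  "sqrt (softmax T a t * softmax T b t) \<le> softmax T (\<lambda>u. (a u + b u) / 2) t"
proof -
  let ?A = "\<Sum>u\<in>T. exp (a u)" and ?B = "\<Sum>u\<in>T. exp (b u)"
  let ?C = "\<Sum>u\<in>T. exp ((a u + b u) / 2)"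
  have half: "exp ((r + s) / 2) = exp (r / 2) * exp (s / 2)" "(exp (r / 2))\<^sup>2 = exp r" for r s :: real
    by (simp_all add: add_divide_distrib flip: exp_add exp_double)
  have "?C\<^sup>2 = (\<Sum>u\<in>T. exp (a u / 2) * exp (b u / 2))\<^sup>2"
    by (simp add: half)
  also have "\<dots> \<le> (\<Sum>u\<in>T. (exp (a u / 2))\<^sup>2) * (\<Sum>u\<in>T. (exp (b u / 2))\<^sup>2)"
    by (rule Cauchy_Schwarz_ineq_sum)
  also have "\<dots> = ?A * ?B" by (simp only: half)
  finally have C: "?C \<le> sqrt (?A * ?B)" by (rule real_le_rsqrt)
  have "sqrt (exp (a t) * exp (b t)) = exp ((a t + b t) / 2)"
    by (rule real_sqrt_unique) (simp_all add: half exp_add power_mult_distrib)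
  then have "sqrt (softmax T a t * softmax T b t) = exp ((a t + b t) / 2) / sqrt (?A * ?B)"
    by (simp add: softmax_def real_sqrt_divide)
  also have "\<dots> \<le> exp ((a t + b t) / 2) / ?C"
    using C sum_exp_pos[of "\<lambda>u. (a u + b u) / 2"]
    by (intro divide_left_mono mult_pos_pos) (auto intro: mult_pos_pos sum_exp_pos)
  finally show ?thesis by (simp add: softmax_def)
qed

lemma log_sum_exp_add:
  "log_sum_exp T (\<lambda>t. a t + e t) = log_sum_exp T a + ln (\<Sum>t\<in>T. softmax T a t * exp (e t))"
proof -
  have "(\<Sum>t\<in>T. exp (a t + e t)) = (\<Sum>u\<in>T. exp (a u)) * (\<Sum>t\<in>T. softmax T a t * exp (e t))"
    using sum_exp_pos[of a] by (simp add: softmax_def sum_distrib_left exp_add)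
  moreover have "0 < (\<Sum>t\<in>T. softmax T a t * exp (e t))"
    using T sum_exp_pos[of a] by (intro sum_pos) (auto simp: softmax_def)
  ultimately show ?thesis
    using sum_exp_pos[of a] by (simp add: log_sum_exp_def ln_mult)
qed

lemma log_sum_exp_add_ge:
  "log_sum_exp T a + (\<Sum>t\<in>T. softmax T a t * e t) \<le> log_sum_exp T (\<lambda>t. a t + e t)"
proof -
  have "exp (\<Sum>t\<in>T. softmax T a t * e t) \<le> (\<Sum>t\<in>T. softmax T a t * exp (e t))"
    by (intro exp_weighted_sum_le softmax_nonneg sum_softmax)
  then show ?thesis
    unfolding log_sum_exp_add by (simp add: ln_ge_iff order_less_le_trans[OF exp_gt_zero])
qed

text \<open>Together with the lower bound from Jensen, this pins the increment of the soft maximum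
  to the \<open>softmax\<close> mean of the \<open>e t\<close>, up to B^2.\<close>

lemma log_sum_exp_add_le:
  assumes e: "\<And>t. t \<in> T \<Longrightarrow> \<bar>e t\<bar> \<le> B" and B: "B \<le> 1"
  shows "log_sum_exp T (\<lambda>t. a t + e t) \<le> log_sum_exp T a + (\<Sum>t\<in>T. softmax T a t * e t) + B\<^sup>2"
proof -
  have "(\<Sum>t\<in>T. softmax T a t * exp (e t)) \<le> (\<Sum>t\<in>T. softmax T a t * (1 + e t + B\<^sup>2))"
  proof (intro sum_mono mult_left_mono softmax_nonneg)
    fix t assume t: "t \<in> T"
    have "(e t)\<^sup>2 \<le> B\<^sup>2" using e[OF t] by (metis abs_ge_zero power2_abs power_mono)
    then show "exp (e t) \<le> 1 + e t + B\<^sup>2"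
      using exp_le_quadratic[of "e t"] e[OF t] B by linarith
  qed
  also have "\<dots> = 1 + ((\<Sum>t\<in>T. softmax T a t * e t) + B\<^sup>2)"
    by (simp add: distrib_left sum.distrib sum_softmax sum_distrib_right[symmetric])
  finally have "(\<Sum>t\<in>T. softmax T a t * exp (e t)) - 1 \<le> (\<Sum>t\<in>T. softmax T a t * e t) + B\<^sup>2" by simp
  moreover have "0 < (\<Sum>t\<in>T. softmax T a t * exp (e t))"
    using T sum_exp_pos[of a] by (intro sum_pos) (auto simp: softmax_def)
  ultimately show ?thesis
    unfolding log_sum_exp_add using ln_le_minus_one[of "\<Sum>t\<in>T. softmax T a t * exp (e t)"] by linarith
qed

lemma log_sum_exp_Max:
  assumes "0 < \<beta>"
  shows "\<bar>log_sum_exp T (\<lambda>t. \<beta> * a t) / \<beta> - Max (a ` T)\<bar> \<le> ln (card T) / \<beta>"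
proof -
  have "Max (a ` T) \<in> a ` T" using T by (intro Max_in) auto
  then obtain s where s: "s \<in> T" "Max (a ` T) = a s" by auto
  have "exp (\<beta> * a s) \<le> (\<Sum>t\<in>T. exp (\<beta> * a t))"
    using T s by (intro member_le_sum) auto
  then have 1: "\<beta> * a s \<le> log_sum_exp T (\<lambda>t. \<beta> * a t)"
    unfolding log_sum_exp_def by (simp add: ln_ge_iff sum_exp_pos)
  have "a t \<le> a s" if "t \<in> T" for t
    unfolding s(2)[symmetric] using T that by (intro Max_ge) auto
  then have "(\<Sum>t\<in>T. exp (\<beta> * a t)) \<le> (\<Sum>t\<in>T. exp (\<beta> * a s))"
    using assms by (intro sum_mono) simp
  then have "ln (\<Sum>t\<in>T. exp (\<beta> * a t)) \<le> ln (card T * exp (\<beta> * a s))"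
    using sum_exp_pos[of "\<lambda>t. \<beta> * a t"] by (subst ln_le_cancel_iff) (auto intro: order_less_le_trans)
  also have "\<dots> = ln (card T) + \<beta> * a s"
    using T by (subst ln_mult) (auto simp: card_gt_0_iff)
  finally have 2: "log_sum_exp T (\<lambda>t. \<beta> * a t) \<le> ln (card T) + \<beta> * a s"
    unfolding log_sum_exp_def .
  have "log_sum_exp T (\<lambda>t. \<beta> * a t) / \<beta> - a s = (log_sum_exp T (\<lambda>t. \<beta> * a t) - \<beta> * a s) / \<beta>"
    using assms by (simp add: field_simps)
  then show ?thesis unfolding s(2) using 1 2 assms by (simp add: divide_right_mono)
qed

text \<open>The arguments are affine in x and so respect midpoints; hence the softmax weights form a
  log-concave partition of unity. A single \<open>m\<close> serves all k, in particular both
  signs.\<close>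

lemma softmax_centering:
  fixes a v :: "'i \<Rightarrow> nat \<Rightarrow> real" and c :: "'i \<Rightarrow> real"
  assumes v: "\<And>t. t \<in> T \<Longrightarrow> inner_prod n (v t) (v t) \<le> d"
  shows "\<exists>m. (\<forall>t\<in>T. \<bar>m t\<bar> \<le> (real (card T))\<^sup>2 * (2 * exp (d / 2))) \<and>
    (\<forall>k. (\<Sum>t\<in>T. LINT x|gaussian n. softmax T (\<lambda>u. \<beta> * (inner_prod n (a u) x - c u)) t * exp (k * (inner_prod n (v t) x - m t)))
      \<le> 2 * exp (2 * k\<^sup>2 * d))"
proof (rule centering_of_log_concave_partition[OF T])
  let ?l = "\<lambda>x u. \<beta> * (inner_prod n (a u) x - c u)"
  show "(\<lambda>x. softmax T (?l x) t) \<in> borel_measurable (gaussian n)" for t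
    unfolding softmax_def by measurable
  show "sqrt (softmax T (?l x) t * softmax T (?l y) t) \<le> softmax T (?l (convex_comb n (1/2) x y)) t" for t x y
  proof -
    have "?l (convex_comb n (1/2) x y) = (\<lambda>u. (?l x u + ?l y u) / 2)"
      by (simp add: inner_prod_convex_comb fun_eq_iff field_simps)
    then show ?thesis using softmax_log_concave[of "?l x" t "?l y"] by simp
  qed
qed (simp_all add: softmax_nonneg sum_softmax v)

text \<open>The tilt of the points is spread over \<open>M\<close> small steps. In each step every affine function is
  recentred by the mean of its increment over its own soft cell, which is where its increment
  is sub-Gaussian; no union bound over the cells is needed.\<close>

lemma Max_affine_perturbation:
  fixes a s :: "'i \<Rightarrow> nat \<Rightarrow> real" and b :: "'i \<Rightarrow> real"
  assumes d: "\<And>t. t \<in> T \<Longrightarrow> sq_dist n (a t) (s t) \<le> d"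
    and \<alpha>: "0 < \<alpha>" and k: "0 \<le> k" and \<eta>: "0 < \<eta>"
  shows "\<exists>c. measure (gaussian n) {x \<in> Rn n. \<alpha> < \<bar>Max ((\<lambda>t. inner_prod n (a t) x - b t) ` T)
      - Max ((\<lambda>t. inner_prod n (s t) x - c t) ` T)\<bar>} \<le> 4 * exp (2 * k\<^sup>2 * d - k * \<alpha> / 2) + \<eta>"
proof -
  interpret prob_space "gaussian n" by (rule prob_space_gaussian)
  define v where "v t i = a t i - s t i" for t i
  have v: "inner_prod n (v t) (v t) \<le> d" if "t \<in> T" for t
    using d[OF that] by (simp add: v_def[abs_def] inner_prod_def sq_dist_def power2_eq_square)
  define N where "N = real (card T)"
  have N: "1 \<le> N" using T unfolding N_def by (simp add: Suc_le_eq card_gt_0_iff)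
  \<comment> \<open>Brings the soft maximum within \<alpha>/8 of the maximum; the summand 1 keeps
    \<open>\<beta>\<close> positive when N = 1.\<close>
  define \<beta> where "\<beta> = 8 * ln N / \<alpha> + 1"
  have \<beta>: "0 < \<beta>" "ln N / \<beta> \<le> \<alpha> / 8"
  proof -
    have "0 \<le> 8 * ln N / \<alpha>" using N \<alpha> by simp
    then show "0 < \<beta>" by (simp add: \<beta>_def)
    have "ln N = \<alpha> / 8 * (8 * ln N / \<alpha>)" using \<alpha> by simp
    also have "\<dots> \<le> \<alpha> / 8 * \<beta>" using \<alpha> by (intro mult_left_mono) (auto simp: \<beta>_def)
    finally show "ln N / \<beta> \<le> \<alpha> / 8" using \<open>0 < \<beta>\<close> by (simp add: pos_divide_le_eq)
  qed
  \<comment> \<open>\<open>Bm\<close> bounds the means. \<open>B0\<close> is a level that each of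
    the 2 N linear forms v.x and - v.x reaches with probability at most \<eta> / (2 N); when none of
    them does, \<open>W\<close> bounds every centred increment.\<close>
  define Bm where "Bm = N\<^sup>2 * (2 * exp (d / 2))"
  define B0 where "B0 = d / 2 + ln (2 * N / \<eta>)"
  define W where "W = max 0 B0 + Bm"
  have W: "0 \<le> W" unfolding W_def Bm_def by simp
  \<comment> \<open>So many steps that the second-order expansion is valid (\<beta> h W \<le> 1) and
    that all second-order errors together stay below \<alpha>/4.\<close>
  obtain M :: nat where M: "max 1 (max (\<beta> * W) (4 * \<beta> * W\<^sup>2 / \<alpha>)) \<le> real M"
    using real_arch_simple by blast
  define h where "h = 1 / real M"
  have M1: "1 \<le> real M" and M2: "\<beta> * h * W \<le> 1" and M3: "\<beta> * h * W\<^sup>2 \<le> \<alpha> / 4" and h: "0 < h" "h * real M = 1"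
    using M \<alpha> unfolding h_def by (auto simp: field_simps)
  define A where "A k t i = a t i - real k * h * v t i" for k :: nat and t i
  define good where "good j c m \<longleftrightarrow> (\<forall>t\<in>T. \<bar>m t\<bar> \<le> Bm) \<and>
    (\<forall>k. (\<Sum>t\<in>T. LINT x|gaussian n. softmax T (\<lambda>u. \<beta> * (inner_prod n (A j u) x - c u)) t * exp (k * (inner_prod n (v t) x - m t)))
      \<le> 2 * exp (2 * k\<^sup>2 * d))" for j c m
  have "\<exists>m. good j c m" for j c
    unfolding good_def Bm_def N_def using softmax_centering[OF v] .
  \<comment> \<open>The means are chosen for every possible offset function \<open>c\<close>,
    because the weights of step j depend on the offsets that all earlier steps have
    produced.\<close>
  then obtain mm where mm: "\<And>j c. good j c (mm j c)" by metis
  define cs where "cs = rec_nat b (\<lambda>j c t. c t - h * mm j c t)"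
  have cs: "cs 0 = b" "cs (Suc j) t = cs j t - h * mm j (cs j) t" for j t
    by (simp_all add: cs_def)
  define m where "m j t = mm j (cs j) t" for j t
  define l where "l j x t = inner_prod n (A j t) x - cs j t" for j x t
  define w where "w j x t = inner_prod n (v t) x - m j t" for j x t
  define p where "p j x t = softmax T (\<lambda>u. \<beta> * l j x u) t" for j x t
  define f where "f j x = log_sum_exp T (\<lambda>u. \<beta> * l j x u) / \<beta>" for j x
  define S where "S j x = (\<Sum>t\<in>T. p j x t * w j x t)" for j x
  \<comment> \<open>The accumulated drift: up to second-order errors, the soft maximum changes by -
    \<open>U x\<close> between time 0, with points \<open>a t\<close>, and time M, with points
    \<open>s t\<close>.\<close>
  define U where "U x = h * (\<Sum>j<M. S j x)" for x
  have good: "good j (cs j) (m j)" for j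
    unfolding m_def using mm[of j "cs j"] by simp
  have l_Suc: "l (Suc j) x t = l j x t + (- h * w j x t)" for j x t
  proof -
    have "A (Suc j) t = (\<lambda>i. A j t i - h * v t i)"
      by (auto simp: A_def fun_eq_iff algebra_simps)
    then show ?thesis
      by (simp add: l_def w_def cs m_def inner_prod_diff_left inner_prod_scale_left algebra_simps)
  qed
  have meas_l [measurable]: "(\<lambda>x. l j x t) \<in> borel_measurable (gaussian n)" for j t
    unfolding l_def by measurable
  have meas_w [measurable]: "(\<lambda>x. w j x t) \<in> borel_measurable (gaussian n)" for j t
    unfolding w_def by measurable
  have meas_p [measurable]: "(\<lambda>x. p j x t) \<in> borel_measurable (gaussian n)" for j t
    unfolding p_def softmax_def by measurable
  have meas_U [measurable]: "U \<in> borel_measurable (gaussian n)"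
    unfolding U_def S_def by measurable
  have step: "\<bar>f (Suc j) x - f j x + h * S j x\<bar> \<le> \<beta> * h\<^sup>2 * W\<^sup>2"
    if x: "\<And>t. t \<in> T \<Longrightarrow> \<bar>inner_prod n (v t) x\<bar> \<le> B0" for j x
  proof -
    have e: "\<bar>\<beta> * (- h * w j x t)\<bar> \<le> \<beta> * h * W" if t: "t \<in> T" for t
    proof -
      have "\<bar>m j t\<bar> \<le> Bm" using good[of j] t by (simp add: good_def)
      then have "\<bar>w j x t\<bar> \<le> W" using x[OF t] by (simp add: w_def W_def)
      then show ?thesis using \<beta> h by (simp add: abs_mult)
    qed
    have lS: "(\<lambda>u. \<beta> * l (Suc j) x u) = (\<lambda>u. \<beta> * l j x u + \<beta> * (- h * w j x u))"
      by (simp add: l_Suc algebra_simps fun_eq_iff)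
    have S: "(\<Sum>t\<in>T. softmax T (\<lambda>u. \<beta> * l j x u) t * (\<beta> * (- h * w j x t))) = - \<beta> * h * S j x"
      by (simp add: S_def p_def sum_distrib_left mult_ac sum_negf)
    have "\<beta> * f j x + - \<beta> * h * S j x \<le> \<beta> * f (Suc j) x"
      "\<beta> * f (Suc j) x \<le> \<beta> * f j x + - \<beta> * h * S j x + (\<beta> * h * W)\<^sup>2"
      using log_sum_exp_add_ge[of "\<lambda>u. \<beta> * l j x u" "\<lambda>u. \<beta> * (- h * w j x u)"]
        log_sum_exp_add_le[of "\<lambda>u. \<beta> * (- h * w j x u)", OF e M2, of "\<lambda>u. \<beta> * l j x u"] \<beta>
      unfolding S lS[symmetric] by (simp_all add: f_def)
    then have "\<beta> * (f j x - h * S j x) \<le> \<beta> * f (Suc j) x"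
      "\<beta> * f (Suc j) x \<le> \<beta> * (f j x - h * S j x + \<beta> * h\<^sup>2 * W\<^sup>2)"
      by (simp_all add: algebra_simps power2_eq_square)
    then show ?thesis using \<beta> by simp
  qed
  have total: "\<bar>f M x - f 0 x + U x\<bar> \<le> \<alpha> / 4"
    if x: "\<And>t. t \<in> T \<Longrightarrow> \<bar>inner_prod n (v t) x\<bar> \<le> B0" for x
  proof -
    have "\<bar>f j x - f 0 x + h * (\<Sum>i<j. S i x)\<bar> \<le> real j * (\<beta> * h\<^sup>2 * W\<^sup>2)" for j
    proof (induction j)
      case (Suc j)
      with step[OF x, of j] show ?case by (simp add: algebra_simps)
    qed simp
    from this[of M] have "\<bar>f M x - f 0 x + U x\<bar> \<le> (h * real M) * (\<beta> * h * W\<^sup>2)"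
      by (simp add: U_def power2_eq_square mult_ac)
    with M3 show ?thesis by (simp add: h)
  qed
  \<comment> \<open>Jensen twice, over time with the weights h and over the cells with the softmax
    weights: the exponential moment of the average is at most the average of the moments of the
    single steps, so the number of steps drops out.\<close>
  have U_mgf: "integrable (gaussian n) (\<lambda>x. exp (\<kappa> * U x)) \<and> (LINT x|gaussian n. exp (\<kappa> * U x)) \<le> 2 * exp (2 * \<kappa>\<^sup>2 * d)" for \<kappa>
  proof -
    let ?R = "\<lambda>x. \<Sum>j<M. \<Sum>t\<in>T. h * (p j x t * exp (\<kappa> * w j x t))"
    have le: "exp (\<kappa> * U x) \<le> ?R x" for x
    proof -
      have "exp (\<kappa> * U x) = exp (\<Sum>j<M. h * (\<kappa> * S j x))"
        by (simp add: U_def sum_distrib_left mult_ac)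
      also have "\<dots> \<le> (\<Sum>j<M. h * exp (\<kappa> * S j x))"
        using h by (intro exp_weighted_sum_le) (auto simp: mult.commute)
      also have "\<dots> \<le> (\<Sum>j<M. h * (\<Sum>t\<in>T. p j x t * exp (\<kappa> * w j x t)))"
      proof (intro sum_mono mult_left_mono)
        fix j
        have "\<kappa> * S j x = (\<Sum>t\<in>T. p j x t * (\<kappa> * w j x t))"
          by (simp add: S_def sum_distrib_left mult_ac)
        then show "exp (\<kappa> * S j x) \<le> (\<Sum>t\<in>T. p j x t * exp (\<kappa> * w j x t))"
          unfolding p_def by (simp add: exp_weighted_sum_le softmax_nonneg sum_softmax)
      qed (use h in simp)
      finally show ?thesis by (simp add: sum_distrib_left)
    qed
    have intw: "integrable (gaussian n) (\<lambda>x. p j x t * exp (\<kappa> * w j x t))" if t: "t \<in> T" for j t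
    proof (rule integrable_weight_mult)
      have "exp (\<kappa> * w j x t) = exp (- \<kappa> * m j t) * exp (inner_prod n (\<lambda>i. \<kappa> * v t i) x)" for x
        by (simp add: w_def inner_prod_scale_left right_diff_distrib flip: exp_add)
      then show "integrable (gaussian n) (\<lambda>x. exp (\<kappa> * w j x t))"
        by (simp add: integrable_exp_inner_prod)
      show "p j x t \<le> 1" for x
        using member_le_sum[of t T "p j x"] T t sum_softmax[of "\<lambda>u. \<beta> * l j x u"]
        by (simp add: p_def[abs_def] softmax_nonneg)
    qed (auto simp: p_def softmax_nonneg intro: meas_p[unfolded p_def])
    have intR: "integrable (gaussian n) ?R"
      using intw by (intro Bochner_Integration.integrable_sum integrable_mult_right)
    have int: "integrable (gaussian n) (\<lambda>x. exp (\<kappa> * U x))"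
      by (rule Bochner_Integration.integrable_bound[OF intR]) (auto intro!: AE_I2 order_trans[OF le])
    have "(LINT x|gaussian n. exp (\<kappa> * U x)) \<le> (LINT x|gaussian n. ?R x)"
      by (intro integral_mono int intR le)
    also have "\<dots> = (\<Sum>j<M. h * (\<Sum>t\<in>T. LINT x|gaussian n. p j x t * exp (\<kappa> * w j x t)))"
      using intw by (simp add: Bochner_Integration.integral_sum sum_distrib_left)
    also have "\<dots> \<le> (\<Sum>j<M. h * (2 * exp (2 * \<kappa>\<^sup>2 * d)))"
      using good h by (intro sum_mono mult_left_mono) (auto simp: good_def p_def w_def l_def)
    also have "\<dots> = (h * real M) * (2 * exp (2 * \<kappa>\<^sup>2 * d))" by simp
    finally show ?thesis using int by (simp only: h mult_1_left simp_thms)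
  qed
  have U_tail: "measure (gaussian n) {x \<in> space (gaussian n). exp (k * \<alpha> / 2) \<le> exp (\<kappa> * U x)} \<le> 2 * exp (2 * k\<^sup>2 * d - k * \<alpha> / 2)"
    if "\<kappa>\<^sup>2 = k\<^sup>2" for \<kappa>
  proof -
    have "measure (gaussian n) {x \<in> space (gaussian n). exp (k * \<alpha> / 2) \<le> exp (\<kappa> * U x)} \<le> (LINT x|gaussian n. exp (\<kappa> * U x)) / exp (k * \<alpha> / 2)"
      using U_mgf by (intro integral_Markov_inequality_measure[where A="{}"]) auto
    also have "\<dots> \<le> 2 * exp (2 * k\<^sup>2 * d) / exp (k * \<alpha> / 2)"
      using U_mgf[of \<kappa>] that by (intro divide_right_mono) auto
    finally show ?thesis by (simp add: exp_diff)
  qed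
  \<comment> \<open>A union bound over \<open>T\<close> is harmless here: \<open>B0\<close>
    influences only the number of steps.\<close>
  have v_tail: "measure (gaussian n) (\<Union>t\<in>T. {x \<in> Rn n. B0 \<le> inner_prod n (v t) x} \<union> {x \<in> Rn n. B0 \<le> inner_prod n (\<lambda>i. - v t i) x}) \<le> \<eta>"
  proof -
    have sets: "{x \<in> Rn n. B0 \<le> inner_prod n u x} \<in> events" for u
      unfolding space_gaussian[symmetric] by measurable
    have one: "measure (gaussian n) {x \<in> Rn n. B0 \<le> inner_prod n u x} \<le> \<eta> / (2 * N)"
      if "inner_prod n u u \<le> d" for u
    proof -
      have "measure (gaussian n) {x \<in> Rn n. B0 \<le> inner_prod n u x} \<le> exp (1\<^sup>2 * inner_prod n u u / 2 - 1 * B0)"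
        by (rule gaussian_tail) simp
      also have "\<dots> \<le> exp (- ln (2 * N / \<eta>))" using that by (simp add: B0_def)
      also have "\<dots> = \<eta> / (2 * N)" using N \<eta> by (simp add: exp_minus)
      finally show ?thesis .
    qed
    have "measure (gaussian n) (\<Union>t\<in>T. {x \<in> Rn n. B0 \<le> inner_prod n (v t) x} \<union> {x \<in> Rn n. B0 \<le> inner_prod n (\<lambda>i. - v t i) x})
      \<le> (\<Sum>t\<in>T. measure (gaussian n) ({x \<in> Rn n. B0 \<le> inner_prod n (v t) x} \<union> {x \<in> Rn n. B0 \<le> inner_prod n (\<lambda>i. - v t i) x}))"
      using T sets by (intro finite_measure_subadditive_finite) auto
    also have "\<dots> \<le> (\<Sum>t\<in>T. \<eta> / (2 * N) + \<eta> / (2 * N))"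
    proof (intro sum_mono)
      fix t assume t: "t \<in> T"
      have "inner_prod n (\<lambda>i. - v t i) (\<lambda>i. - v t i) \<le> d" using v[OF t] by (simp add: inner_prod_def)
      then show "measure (gaussian n) ({x \<in> Rn n. B0 \<le> inner_prod n (v t) x} \<union> {x \<in> Rn n. B0 \<le> inner_prod n (\<lambda>i. - v t i) x}) \<le> \<eta> / (2 * N) + \<eta> / (2 * N)"
        using one[OF v[OF t]] one[of "\<lambda>i. - v t i"] measure_Un_le[OF sets sets, of "v t" "\<lambda>i. - v t i"] by linarith
    qed
    also have "\<dots> = \<eta>" using N by (simp add: N_def)
    finally show ?thesis .
  qed
  define E1 where "E1 = {x \<in> space (gaussian n). exp (k * \<alpha> / 2) \<le> exp (k * U x)}"
  define E2 where "E2 = {x \<in> space (gaussian n). exp (k * \<alpha> / 2) \<le> exp (- k * U x)}"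
  define E3 where "E3 = (\<Union>t\<in>T. {x \<in> Rn n. B0 \<le> inner_prod n (v t) x} \<union> {x \<in> Rn n. B0 \<le> inner_prod n (\<lambda>i. - v t i) x})"
  have ev [measurable]: "E1 \<in> events" "E2 \<in> events"
    unfolding E1_def E2_def by measurable
  have ev3 [measurable]: "E3 \<in> events"
    unfolding E3_def space_gaussian[symmetric] using T by (intro sets.finite_UN sets.Un) measurable
  let ?D = "{x \<in> Rn n. \<alpha> < \<bar>Max ((\<lambda>t. inner_prod n (a t) x - b t) ` T) - Max ((\<lambda>t. inner_prod n (s t) x - cs M t) ` T)\<bar>}"
  have "?D \<subseteq> (E1 \<union> E2) \<union> E3"
  proof (rule subsetI, rule ccontr)
    fix x assume x: "x \<in> ?D" and "x \<notin> (E1 \<union> E2) \<union> E3"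
    then have nE: "x \<notin> E1" "x \<notin> E2" "x \<notin> E3" and xR: "x \<in> Rn n" by auto
    have vx: "\<bar>inner_prod n (v t) x\<bar> \<le> B0" if "t \<in> T" for t
      using nE(3) xR that by (auto simp: E3_def inner_prod_minus_left abs_le_iff not_le intro: less_imp_le)
    have "k * U x < k * (\<alpha> / 2)" "k * (- U x) < k * (\<alpha> / 2)"
      using nE(1,2) xR by (auto simp: E1_def E2_def space_gaussian)
    then have "\<bar>U x\<bar> \<le> \<alpha> / 2"
      using mult_left_less_imp_less[OF _ k] by (smt (verit))
    moreover have "\<bar>f 0 x - Max ((\<lambda>t. inner_prod n (a t) x - b t) ` T)\<bar> \<le> \<alpha> / 8"
    proof -
      have "l 0 x = (\<lambda>t. inner_prod n (a t) x - b t)"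
        by (simp add: l_def[abs_def] A_def[abs_def] cs)
      then show ?thesis
        using log_sum_exp_Max[OF \<beta>(1), of "l 0 x"] order_trans[OF _ \<beta>(2)] by (simp add: f_def N_def)
    qed
    moreover have "\<bar>f M x - Max ((\<lambda>t. inner_prod n (s t) x - cs M t) ` T)\<bar> \<le> \<alpha> / 8"
    proof -
      have "A M t = s t" for t
        using h(2) by (simp add: A_def v_def fun_eq_iff mult.commute)
      then have "l M x = (\<lambda>t. inner_prod n (s t) x - cs M t)"
        by (simp add: l_def[abs_def])
      then show ?thesis
        using log_sum_exp_Max[OF \<beta>(1), of "l M x"] order_trans[OF _ \<beta>(2)] by (simp add: f_def N_def)
    qed
    \<comment> \<open>The tolerance is spent as \<alpha>/2 on the drift, \<alpha>/4 on second-order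
      errors and \<alpha>/8 on each of the two comparisons of a soft with a true maximum.\<close>
    ultimately show False using total[OF vx] x by (simp add: abs_if split: if_splits)
  qed
  then have "measure (gaussian n) ?D \<le> measure (gaussian n) ((E1 \<union> E2) \<union> E3)"
    by (intro finite_measure_mono) auto
  also have "\<dots> \<le> measure (gaussian n) E1 + measure (gaussian n) E2 + measure (gaussian n) E3"
    using measure_Un_le[of "E1 \<union> E2" "gaussian n" E3] measure_Un_le[of E1 "gaussian n" E2] ev ev3 by auto
  also have "\<dots> \<le> 4 * exp (2 * k\<^sup>2 * d - k * \<alpha> / 2) + \<eta>"
    using U_tail[of k] U_tail[of "- k"] v_tail unfolding E1_def E2_def E3_def by simp
  finally show ?thesis by blast
qed

end

section \<open>Sudakov minoration and anticoncentration\<close>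

lemma integrable_exp_Max_inner_prod:
  assumes S: "finite S" "S \<noteq> {}" and k: "0 \<le> k"
  shows "integrable (gaussian n) (\<lambda>x. exp (k * Max ((\<lambda>s. inner_prod n s x) ` S)))"
proof (rule Bochner_Integration.integrable_bound)
  have "integrable (gaussian n) (\<lambda>x. exp (k * inner_prod n s x))" for s
    using integrable_exp_inner_prod[of n "\<lambda>i. k * s i"] by (simp add: inner_prod_scale_left)
  then show "integrable (gaussian n) (\<lambda>x. \<Sum>s\<in>S. exp (k * inner_prod n s x))" by simp
  show "(\<lambda>x. exp (k * Max ((\<lambda>s. inner_prod n s x) ` S))) \<in> borel_measurable (gaussian n)"
    using S by measurable
  show "AE x in gaussian n. norm (exp (k * Max ((\<lambda>s. inner_prod n s x) ` S))) \<le> norm (\<Sum>s\<in>S. exp (k * inner_prod n s x))"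
  proof (rule AE_I2)
    fix x
    have "Max ((\<lambda>s. inner_prod n s x) ` S) \<in> (\<lambda>s. inner_prod n s x) ` S"
      using S by (intro Max_in) auto
    then obtain s where "s \<in> S" "Max ((\<lambda>s. inner_prod n s x) ` S) = inner_prod n s x" by auto
    then have "exp (k * Max ((\<lambda>s. inner_prod n s x) ` S)) \<le> (\<Sum>s\<in>S. exp (k * inner_prod n s x))"
      using S member_le_sum[of s S "\<lambda>s. exp (k * inner_prod n s x)"] by simp
    then show "norm (exp (k * Max ((\<lambda>s. inner_prod n s x) ` S))) \<le> norm (\<Sum>s\<in>S. exp (k * inner_prod n s x))"
      by simp
  qed
qed

text \<open>Sharp in \<open>k\<close>: the parameter \<open>\<theta>\<close> close to \<open>1\<close> gives the Gaussian constant \<open>1/2\<close> at the price of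
  a worse dependence on the measure of \<open>{x. M x \<le> r}\<close>.\<close>

lemma exp_Max_inner_prod_upper:
  assumes S: "finite S" "S \<noteq> {}" and unit: "\<And>s. s \<in> S \<Longrightarrow> inner_prod n s s = 1"
    and k: "0 < k" and \<theta>: "0 < \<theta>" "\<theta> < 1"
    and K: "K = {x \<in> Rn n. \<forall>s\<in>S. inner_prod n s x \<le> r}" and K0: "0 < measure (gaussian n) K"
  shows "(1 - \<theta>) * ln (LINT x|gaussian n. exp (k * Max ((\<lambda>s. inner_prod n s x) ` S)))
    \<le> (1 - \<theta>) * (k * r + k\<^sup>2 / (2 * \<theta>)) - \<theta> * ln (measure (gaussian n) K)"
proof -
  interpret prob_space "gaussian n" by (rule prob_space_gaussian)
  let ?M = "\<lambda>x. Max ((\<lambda>s. inner_prod n s x) ` S)"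
  let ?C = "exp ((1 - \<theta>) * (k * r + k\<^sup>2 / (2 * \<theta>)))"
  have Kev: "K \<in> events"
    unfolding K space_gaussian[symmetric] using S by measurable
  have int: "integrable (gaussian n) (\<lambda>x. exp (k * ?M x))"
    using S k by (intro integrable_exp_Max_inner_prod) auto
  have "(LINT x|gaussian n. exp (k * ?M x)) powr (1 - \<theta>) * (LINT x|gaussian n. indicator K x) powr \<theta>
    \<le> (LINT x|gaussian n. ?C)"
  proof (rule Prekopa_Leindler_gaussian)
    fix x y assume xy: "x \<in> Rn n" "y \<in> Rn n"
    let ?d = "sq_dist n x y"
    show "exp (k * ?M x) powr (1 - \<theta>) * indicat_real K y powr \<theta> * exp (- (\<theta> * (1 - \<theta>) / 2 * ?d)) \<le> ?C"
    proof (cases "y \<in> K")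
      case True
      have "?M x \<in> (\<lambda>s. inner_prod n s x) ` S" using S by (intro Max_in) auto
      then obtain s where s: "s \<in> S" "?M x = inner_prod n s x" by auto
      \<comment> \<open>With weight \<theta>/k the distance term, once multiplied by k (1 -
        \<theta>), equals the exponent of the Gaussian gain and cancels against it.\<close>
      have "inner_prod n s x \<le> inner_prod n s y + (k / (2 * \<theta>) + \<theta> / (2 * k) * ?d)"
        using abs_le_D1[OF inner_prod_le_sq_dist[of "\<theta> / k" n s x y]] unit[OF s(1)] k \<theta> by simp
      also have "inner_prod n s y \<le> r" using True s(1) K by simp
      finally have "k * ?M x \<le> k * (r + (k / (2 * \<theta>) + \<theta> / (2 * k) * ?d))"
        using k s(2) by (intro mult_left_mono) auto
      also have "\<dots> = k * r + k\<^sup>2 / (2 * \<theta>) + \<theta> / 2 * ?d"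
        using k by (simp add: field_simps power2_eq_square)
      finally have "(1 - \<theta>) * (k * ?M x) \<le> (1 - \<theta>) * (k * r + k\<^sup>2 / (2 * \<theta>) + \<theta> / 2 * ?d)"
        using \<theta> by (intro mult_left_mono) auto
      then have "(1 - \<theta>) * (k * ?M x) - \<theta> * (1 - \<theta>) / 2 * ?d \<le> (1 - \<theta>) * (k * r + k\<^sup>2 / (2 * \<theta>))"
        by (simp add: algebra_simps)
      then show ?thesis using True by (simp add: exp_powr_real mult_ac flip: exp_add)
    qed simp
  qed (use int \<theta> Kev in \<open>auto simp: emeasure_eq_measure intro!: integrable_real_indicator\<close>)
  also have "\<dots> = ?C" by (simp add: prob_space)
  finally have *: "(LINT x|gaussian n. exp (k * ?M x)) powr (1 - \<theta>) * measure (gaussian n) K powr \<theta> \<le> ?C"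
    using Kev by simp
  have pos: "0 < (LINT x|gaussian n. exp (k * ?M x))"
    by (rule integral_less_AE_space[of "\<lambda>_. 0", simplified]) (use int in \<open>auto simp: emeasure_space_1\<close>)
  have "ln ((LINT x|gaussian n. exp (k * ?M x)) powr (1 - \<theta>) * measure (gaussian n) K powr \<theta>) \<le> ln ?C"
    using * pos K0 by (subst ln_le_cancel_iff) auto
  then show "(1 - \<theta>) * ln (LINT x|gaussian n. exp (k * ?M x))
    \<le> (1 - \<theta>) * (k * r + k\<^sup>2 / (2 * \<theta>)) - \<theta> * ln (measure (gaussian n) K)"
    using pos K0 by (simp add: ln_mult ln_powr)
qed

text \<open>Send one of \<open>N\<close> well separated signals \<open>k s\<close> over the Gaussian channel: decoding by the largest
  correlation succeeds with probability at least \<open>1/2\<close>, and its success probability is at most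
  \<open>E (exp (k M - k\<^sup>2 / 2)) / N\<close>.\<close>

lemma exp_Max_inner_prod_lower:
  assumes S: "finite S" "S \<noteq> {}" and unit: "\<And>s. s \<in> S \<Longrightarrow> inner_prod n s s = 1"
    and sep: "\<And>s t. s \<in> S \<Longrightarrow> t \<in> S \<Longrightarrow> s \<noteq> t \<Longrightarrow> \<delta> \<le> sq_dist n s t"
    and k: "0 < k" and N: "real (card S) * exp (- (k\<^sup>2 * \<delta> / 8)) \<le> 1 / 2"
  shows "real (card S) / 2 * exp (k\<^sup>2 / 2) \<le> (LINT x|gaussian n. exp (k * Max ((\<lambda>s. inner_prod n s x) ` S)))"
proof -
  interpret prob_space "gaussian n" by (rule prob_space_gaussian)
  let ?M = "\<lambda>x. Max ((\<lambda>s. inner_prod n s x) ` S)"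
  \<comment> \<open>The decoding region of s; strict inequalities make these regions
    disjoint.\<close>
  define A where "A s = {x \<in> Rn n. \<forall>t\<in>S - {s}. inner_prod n t x < inner_prod n s x}" for s
  have Aev [measurable]: "A s \<in> events" for s
    unfolding A_def space_gaussian[symmetric] using S by (intro sets.sets_Collect_finite_All) auto
  have half: "1 / 2 \<le> measure (gaussian n) {x \<in> Rn n. shift n (\<lambda>i. k * s i) x \<in> A s}" if s: "s \<in> S" for s
  proof -
    let ?w = "\<lambda>t i. t i - s i"
    \<comment> \<open>The event that t correlates with the received point k s + x at least as well
      as s does.\<close>
    let ?B = "\<lambda>t. {x \<in> Rn n. k * sq_dist n t s / 2 \<le> inner_prod n (?w t) x}"
    have Bev: "?B t \<in> events" for t
      unfolding space_gaussian[symmetric] by measurable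
    have B: "measure (gaussian n) (?B t) \<le> exp (- (k\<^sup>2 * \<delta> / 8))" if t: "t \<in> S - {s}" for t
    proof -
      have q: "inner_prod n (?w t) (?w t) = sq_dist n t s"
        by (simp add: inner_prod_def sq_dist_def power2_eq_square)
      \<comment> \<open>k/2 is the optimal Chernoff parameter for this threshold.\<close>
      have "measure (gaussian n) (?B t) \<le> exp ((k / 2)\<^sup>2 * sq_dist n t s / 2 - (k / 2) * (k * sq_dist n t s / 2))"
        using gaussian_tail[of "k / 2" n "k * sq_dist n t s / 2" "?w t"] k unfolding q by simp
      also have "(k / 2)\<^sup>2 * sq_dist n t s / 2 - (k / 2) * (k * sq_dist n t s / 2) = - (k\<^sup>2 * sq_dist n t s / 8)"
        by (simp add: power2_eq_square field_simps)
      also have "\<dots> \<le> - (k\<^sup>2 * \<delta> / 8)"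
        using sep[of t s] t s k by (auto intro: mult_left_mono)
      finally show ?thesis by simp
    qed
    have "space (gaussian n) - (\<Union>t\<in>S - {s}. ?B t) \<subseteq> {x \<in> Rn n. shift n (\<lambda>i. k * s i) x \<in> A s}"
    proof
      fix x assume x: "x \<in> space (gaussian n) - (\<Union>t\<in>S - {s}. ?B t)"
      then have xR: "x \<in> Rn n" by (simp add: space_gaussian)
      have "inner_prod n t (shift n (\<lambda>i. k * s i) x) < inner_prod n s (shift n (\<lambda>i. k * s i) x)" if t: "t \<in> S - {s}" for t
      proof -
        have "sq_dist n t s = inner_prod n t t - 2 * inner_prod n t s + inner_prod n s s"
          by (simp add: sq_dist_def inner_prod_def power2_eq_square algebra_simps sum.distrib sum_subtractf sum_distrib_left)
        then have q: "inner_prod n t s = 1 - sq_dist n t s / 2" using unit t s by (simp add: field_simps)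
        have "inner_prod n (?w t) x < k * sq_dist n t s / 2"
        proof -
          have "x \<notin> ?B t" using x t by blast
          then show ?thesis using xR by simp
        qed
        then show ?thesis
          by (simp add: inner_prod_shift inner_prod_scale_right inner_prod_diff_left q unit[OF s] right_diff_distrib)
      qed
      then show "x \<in> {x \<in> Rn n. shift n (\<lambda>i. k * s i) x \<in> A s}" using xR by (simp add: A_def)
    qed
    moreover have "{x \<in> Rn n. shift n (\<lambda>i. k * s i) x \<in> A s} \<in> events"
      unfolding space_gaussian[symmetric] by measurable
    ultimately have "measure (gaussian n) (space (gaussian n) - (\<Union>t\<in>S - {s}. ?B t)) \<le> measure (gaussian n) {x \<in> Rn n. shift n (\<lambda>i. k * s i) x \<in> A s}"
      by (intro finite_measure_mono)
    moreover have "measure (gaussian n) (space (gaussian n) - (\<Union>t\<in>S - {s}. ?B t)) = 1 - measure (gaussian n) (\<Union>t\<in>S - {s}. ?B t)"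
      using S Bev by (intro prob_compl sets.finite_UN) auto
    moreover have "measure (gaussian n) (\<Union>t\<in>S - {s}. ?B t) \<le> 1 / 2"
    proof -
      have "measure (gaussian n) (\<Union>t\<in>S - {s}. ?B t) \<le> (\<Sum>t\<in>S - {s}. measure (gaussian n) (?B t))"
        using S Bev by (intro finite_measure_subadditive_finite) auto
      also have "\<dots> \<le> (\<Sum>t\<in>S - {s}. exp (- (k\<^sup>2 * \<delta> / 8)))" by (intro sum_mono B)
      also have "\<dots> \<le> real (card S) * exp (- (k\<^sup>2 * \<delta> / 8))"
        using S by (auto intro!: mult_right_mono card_mono)
      finally show ?thesis using N by simp
    qed
    ultimately show ?thesis by simp
  qed
  have ww: "inner_prod n (\<lambda>i. k * s i) (\<lambda>i. k * s i) = k\<^sup>2" if "s \<in> S" for s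
    using unit[OF that] by (simp add: inner_prod_scale_left inner_prod_scale_right power2_eq_square)
  have cell: "ennreal (1 / 2) \<le> (\<integral>\<^sup>+x. indicator (A s) x * ennreal (exp (k * inner_prod n s x - k\<^sup>2 / 2)) \<partial>gaussian n)" if s: "s \<in> S" for s
  proof -
    have "ennreal (1 / 2) \<le> ennreal (measure (gaussian n) {x \<in> Rn n. shift n (\<lambda>i. k * s i) x \<in> A s})"
      using half[OF s] by (rule ennreal_leI)
    also have "\<dots> = emeasure (gaussian n) {x \<in> space (gaussian n). shift n (\<lambda>i. k * s i) x \<in> A s}"
      by (simp add: emeasure_eq_measure space_gaussian)
    also have "\<dots> = (\<integral>\<^sup>+x. indicator {x \<in> space (gaussian n). shift n (\<lambda>i. k * s i) x \<in> A s} x \<partial>gaussian n)"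
      by (rule nn_integral_indicator[symmetric]) measurable
    also have "\<dots> = (\<integral>\<^sup>+x. indicator (A s) (shift n (\<lambda>i. k * s i) x) \<partial>gaussian n)"
      by (intro nn_integral_cong) (simp add: indicator_def)
    also have "\<dots> = (\<integral>\<^sup>+x. indicator (A s) x * ennreal (exp (inner_prod n (\<lambda>i. k * s i) x - inner_prod n (\<lambda>i. k * s i) (\<lambda>i. k * s i) / 2)) \<partial>gaussian n)"
      by (rule Cameron_Martin_nn_integral) measurable
    finally show ?thesis unfolding ww[OF s] by (simp only: inner_prod_scale_left)
  qed
  have int: "integrable (gaussian n) (\<lambda>x. exp (k * ?M x))"
    using S k by (intro integrable_exp_Max_inner_prod) auto
  have "ennreal (real (card S) / 2) = ennreal (\<Sum>s\<in>S. 1 / 2)" by simp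
  also have "\<dots> = (\<Sum>s\<in>S. ennreal (1 / 2))" by (rule sum_ennreal[symmetric]) simp
  also have "\<dots> \<le> (\<Sum>s\<in>S. \<integral>\<^sup>+x. indicator (A s) x * ennreal (exp (k * inner_prod n s x - k\<^sup>2 / 2)) \<partial>gaussian n)"
    by (intro sum_mono cell)
  also have "\<dots> = (\<integral>\<^sup>+x. (\<Sum>s\<in>S. indicator (A s) x * ennreal (exp (k * inner_prod n s x - k\<^sup>2 / 2))) \<partial>gaussian n)"
    by (rule nn_integral_sum[symmetric]) measurable
  also have "\<dots> \<le> (\<integral>\<^sup>+x. ennreal (exp (- (k\<^sup>2 / 2)) * exp (k * ?M x)) \<partial>gaussian n)"
  proof (intro nn_integral_mono)
    fix x
    show "(\<Sum>s\<in>S. indicator (A s) x * ennreal (exp (k * inner_prod n s x - k\<^sup>2 / 2))) \<le> ennreal (exp (- (k\<^sup>2 / 2)) * exp (k * ?M x))"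
    proof (cases "\<exists>s\<in>S. x \<in> A s")
      case True
      then obtain s where s: "s \<in> S" "x \<in> A s" by auto
      have "x \<notin> A t" if "t \<in> S - {s}" for t
        using s that by (auto simp: A_def intro!: bexI[of _ s] dest: bspec[of _ _ t])
      then have "(\<Sum>s\<in>S. indicator (A s) x * ennreal (exp (k * inner_prod n s x - k\<^sup>2 / 2))) = ennreal (exp (k * inner_prod n s x - k\<^sup>2 / 2))"
        using S s by (subst sum.remove[of S s]) auto
      also have "\<dots> \<le> ennreal (exp (k * ?M x - k\<^sup>2 / 2))"
        using S s k by (intro ennreal_leI) (auto intro!: mult_left_mono Max_ge)
      finally show ?thesis by (simp flip: exp_add)
    next
      case False
      then show ?thesis by (simp add: sum.neutral)
    qed
  qed
  also have "\<dots> = ennreal (exp (- (k\<^sup>2 / 2)) * (LINT x|gaussian n. exp (k * ?M x)))"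
    using int by (subst nn_integral_eq_integral) auto
  finally have "real (card S) / 2 \<le> exp (- (k\<^sup>2 / 2)) * (LINT x|gaussian n. exp (k * ?M x))"
    by (subst (asm) ennreal_le_iff) (auto intro!: mult_nonneg_nonneg integral_nonneg_AE)
  then have "exp (k\<^sup>2 / 2) * (real (card S) / 2) \<le> exp (k\<^sup>2 / 2) * (exp (- (k\<^sup>2 / 2)) * (LINT x|gaussian n. exp (k * ?M x)))"
    by (intro mult_left_mono) auto
  then show ?thesis by (simp add: mult.assoc[symmetric] mult.commute flip: exp_add)
qed

text \<open>Both bounds on the exponential moment of the maximum contain k^2/2, which cancels; this
  is why the upper bound has to be sharp. What remains is linear in k, and k is of order sqrt L /
  \<delta>, so L is at most of order (r + q)^2 / \<delta>^2. The usual expected maximum is replaced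
  by a level r below which the maximum stays with probability at least \<epsilon>, at the price of
  q.\<close>

lemma Sudakov_minoration:
  assumes S: "finite S" "4 \<le> card S" and unit: "\<And>s. s \<in> S \<Longrightarrow> inner_prod n s s = 1"
    and sep: "\<And>s t. s \<in> S \<Longrightarrow> t \<in> S \<Longrightarrow> s \<noteq> t \<Longrightarrow> \<delta>\<^sup>2 \<le> sq_dist n s t" and \<delta>: "0 < \<delta>"
    and \<epsilon>: "0 < \<epsilon>" "\<epsilon> < 1" "\<epsilon> \<le> measure (gaussian n) {x \<in> Rn n. \<forall>s\<in>S. inner_prod n s x \<le> r}"
    and r: "0 \<le> r" and q: "q = sqrt (ln (1 / \<epsilon>))"
  shows "ln (2 * real (card S)) \<le> 72 * (r + 3 / 2 * q)\<^sup>2 / \<delta>\<^sup>2"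
proof -
  define N where "N = real (card S)"
  define L where "L = ln (2 * N)"
  have N: "4 \<le> N" using S(2) by (simp add: N_def)
  have S': "S \<noteq> {}" using S by auto
  have L: "0 < L" using N by (simp add: L_def)
  \<comment> \<open>Makes the decoding error N exp (- k^2 \<delta>^2 / 8) equal to 1/2.\<close>
  define k where "k = sqrt (8 * L) / \<delta>"
  have k: "0 < k" using L \<delta> by (simp add: k_def)
  have k2: "k\<^sup>2 * \<delta>\<^sup>2 = 8 * L" using L \<delta> by (simp add: k_def power_divide)
  have q0: "0 < q" "q\<^sup>2 = ln (1 / \<epsilon>)" using \<epsilon> by (auto simp: q)
  \<comment> \<open>Keeps two losses at order k q: after division by 1 - \<theta>, the Gaussian term
    exceeds k^2/2 by k q / 2, and the measure of the set costs at most k q.\<close>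
  define \<theta> where "\<theta> = k / (k + q)"
  have \<theta>: "0 < \<theta>" "\<theta> < 1" "1 - \<theta> = q / (k + q)"
    using k q0 by (auto simp: \<theta>_def field_simps)
  let ?I = "LINT x|gaussian n. exp (k * Max ((\<lambda>s. inner_prod n s x) ` S))"
  let ?K = "{x \<in> Rn n. \<forall>s\<in>S. inner_prod n s x \<le> r}"
  have "exp (- (k\<^sup>2 * \<delta>\<^sup>2 / 8)) = exp (- L)" unfolding k2 by simp
  then have "exp (- (k\<^sup>2 * \<delta>\<^sup>2 / 8)) = 1 / (2 * N)"
    using N by (simp add: L_def exp_minus inverse_eq_divide)
  then have low: "N / 2 * exp (k\<^sup>2 / 2) \<le> ?I"
    using N unfolding N_def
    by (intro exp_Max_inner_prod_lower[OF S(1) S' unit sep k]) (auto simp: field_simps)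
  have "ln (N / 2) + k\<^sup>2 / 2 = ln (N / 2 * exp (k\<^sup>2 / 2))"
    using N by (subst ln_mult) auto
  also have "\<dots> \<le> ln ?I"
    using low N by (subst ln_le_cancel_iff) (auto intro: order_less_le_trans[OF _ low])
  finally have 1: "ln (N / 2) + k\<^sup>2 / 2 \<le> ln ?I" .
  have K: "0 < measure (gaussian n) ?K" using \<epsilon> by linarith
  have "- ln (measure (gaussian n) ?K) \<le> q\<^sup>2"
    using \<epsilon> K unfolding q0(2) by (simp add: ln_div)
  then have "\<theta> * - ln (measure (gaussian n) ?K) \<le> \<theta> * q\<^sup>2"
    using \<theta> by (intro mult_left_mono) auto
  with exp_Max_inner_prod_upper[OF S(1) S' unit k \<theta>(1,2) refl K]
  have "(1 - \<theta>) * ln ?I \<le> (1 - \<theta>) * (k * r + k\<^sup>2 / (2 * \<theta>)) + \<theta> * q\<^sup>2" by simp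
  also have "\<theta> * q\<^sup>2 = (1 - \<theta>) * (k * q)"
    using k q0 unfolding \<theta>(3) by (simp add: \<theta>_def power2_eq_square)
  also have "k\<^sup>2 / (2 * \<theta>) = k\<^sup>2 / 2 + k * q / 2"
    using k q0 by (simp add: \<theta>_def field_simps power2_eq_square)
  also have "(1 - \<theta>) * (k * r + (k\<^sup>2 / 2 + k * q / 2)) + (1 - \<theta>) * (k * q) = (1 - \<theta>) * (k\<^sup>2 / 2 + k * (r + 3 / 2 * q))"
    by (simp add: field_simps)
  finally have "(1 - \<theta>) * ln ?I \<le> (1 - \<theta>) * (k\<^sup>2 / 2 + k * (r + 3 / 2 * q))" .
  then have "ln ?I \<le> k\<^sup>2 / 2 + k * (r + 3 / 2 * q)"
    by (rule mult_left_le_imp_le) (use \<theta>(2) in simp)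
  with 1 have 2: "ln (N / 2) \<le> k * (r + 3 / 2 * q)" by linarith
  \<comment> \<open>N \<ge> 4 gives 2 N \<le> (N/2)^3, so ln (N/2) controls
    \<open>L\<close>.\<close>
  have "L \<le> 3 * ln (N / 2)"
  proof -
    have "2 * N \<le> (N / 2) ^ 3"
    proof -
      have "4 * 4 * N \<le> N * N * N" using N by (intro mult_mono) auto
      then show ?thesis by (simp add: power3_eq_cube)
    qed
    then have "L \<le> ln ((N / 2) ^ 3)" unfolding L_def using N by (subst ln_le_cancel_iff) auto
    then show ?thesis using N by (simp add: ln_realpow)
  qed
  with 2 have "L \<le> 3 * (k * (r + 3 / 2 * q))" by linarith
  then have "L\<^sup>2 \<le> (3 * (k * (r + 3 / 2 * q)))\<^sup>2" using L by (intro power_mono) auto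
  also have "\<dots> = 72 * (r + 3 / 2 * q)\<^sup>2 / \<delta>\<^sup>2 * L"
  proof -
    have "k\<^sup>2 = 8 * L / \<delta>\<^sup>2" using k2 \<delta> by (simp add: field_simps)
    then show ?thesis by (simp add: power_mult_distrib)
  qed
  finally have "L * L \<le> 72 * (r + 3 / 2 * q)\<^sup>2 / \<delta>\<^sup>2 * L" by (simp add: power2_eq_square)
  then show ?thesis using L unfolding L_def N_def by (simp only: mult_le_cancel_right_pos)
qed

text \<open>The band \<open>I 0\<close>, which contains |F| \<le> \<alpha>, is compared with the
  bands \<open>I j\<close> of the same width 3 \<alpha> above it, up to height 1/r. Translation by u
  t carries the part of \<open>I 0\<close> in the cell of t into \<open>I j\<close> within the same
  cell, because every other function grows by u s.t \<le> u. On the former part t.x = F + b t \<le>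
  3 r, so for u \<le> 1/r the density ratio is at most exp (7/2) \<le> 81. At least 1 / (3 \<alpha>
  r) disjoint bands share a mass of at most 1, hence the constant 3 * 81 = 243.\<close>

lemma Max_affine_anticoncentration:
  fixes b :: "(nat \<Rightarrow> real) \<Rightarrow> real"
  assumes T: "finite T" "T \<noteq> {}" and unit: "\<And>t. t \<in> T \<Longrightarrow> inner_prod n t t = 1"
    and b: "\<And>t. t \<in> T \<Longrightarrow> b t \<le> r" and r: "1 \<le> r" and \<alpha>: "0 < \<alpha>" "\<alpha> \<le> 1"
  shows "measure (gaussian n) {x \<in> Rn n. \<bar>Max ((\<lambda>t. inner_prod n t x - b t) ` T)\<bar> \<le> \<alpha>} \<le> 243 * \<alpha> * r"
proof -
  interpret prob_space "gaussian n" by (rule prob_space_gaussian)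
  define l where "l t x = inner_prod n t x - b t" for t x
  define F where "F x = Max ((\<lambda>t. l t x) ` T)" for x
  \<comment> \<open>A numbering of \<open>T\<close> that breaks ties between maximisers, so that the
    cells are disjoint.\<close>
  obtain e :: "(nat \<Rightarrow> real) \<Rightarrow> nat" where e: "inj_on e T"
    using finite_imp_inj_to_nat_seg[OF T(1)] by blast
  define A where "A t = {x \<in> Rn n. \<forall>s\<in>T. l s x \<le> l t x \<and> (e s < e t \<longrightarrow> l s x < l t x)}" for t
  \<comment> \<open>Width 3 \<alpha> rather than 2 \<alpha>: half-open bands are disjoint, and
    \<open>I 0\<close>, where F ranges over [-\<alpha>, 2 \<alpha>), still contains the closed
    condition |F| \<le> \<alpha>.\<close>
  define I where "I j = {x \<in> Rn n. real j * (3 * \<alpha>) - \<alpha> \<le> F x \<and> F x < real (Suc j) * (3 * \<alpha>) - \<alpha>}" for j :: nat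
  have meas_l [measurable]: "(\<lambda>x. l t x) \<in> borel_measurable (gaussian n)" for t
    unfolding l_def by measurable
  have meas_F [measurable]: "F \<in> borel_measurable (gaussian n)"
    unfolding F_def using T by measurable
  have A_ev: "A t \<in> events" for t
    unfolding A_def space_gaussian[symmetric]
    by (intro sets.sets_Collect_finite_All[OF _ T(1)] sets.sets_Collect_conj sets.sets_Collect_imp
        sets.sets_Collect_const borel_measurable_le borel_measurable_less meas_l)
  have I_ev: "I j \<in> events" for j
    unfolding I_def space_gaussian[symmetric] by measurable
  have F_A: "F x = l t x" if "t \<in> T" "x \<in> A t" for t x
    unfolding F_def using T that by (intro Max_eqI) (auto simp: A_def)
  have A_disj: "disjoint_family_on A T"
    unfolding disjoint_family_on_def
  proof (intro ballI impI equals0I)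
    fix s t x assume "s \<in> T" "t \<in> T" "s \<noteq> t" "x \<in> A s \<inter> A t"
    moreover have "e s < e t \<or> e t < e s"
      using e \<open>s \<in> T\<close> \<open>t \<in> T\<close> \<open>s \<noteq> t\<close> by (meson inj_onD linorder_neqE_nat)
    ultimately show False by (fastforce simp: A_def)
  qed
  have A_cover: "\<exists>t\<in>T. x \<in> A t" if x: "x \<in> Rn n" for x
  proof -
    have "F x \<in> (\<lambda>t. l t x) ` T" unfolding F_def using T by (intro Max_in) auto
    then have "{t \<in> T. l t x = F x} \<noteq> {}" by auto
    then obtain t where t: "t \<in> T" "l t x = F x" and min: "\<And>s. s \<in> T \<Longrightarrow> l s x = F x \<Longrightarrow> e t \<le> e s"
      using arg_min_nat_lemma[of "\<lambda>t. t \<in> T \<and> l t x = F x" _ e] by blast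
    have "l s x \<le> F x" if "s \<in> T" for s
      unfolding F_def using T that by (intro Max_ge) auto
    then have "x \<in> A t" using x t min by (fastforce simp: A_def)
    then show ?thesis using t by blast
  qed
  have split: "measure (gaussian n) (I j) = (\<Sum>t\<in>T. measure (gaussian n) (A t \<inter> I j))" for j
  proof -
    have "I j = (\<Union>t\<in>T. A t \<inter> I j)" using A_cover by (auto simp: I_def)
    then have "measure (gaussian n) (I j) = measure (gaussian n) (\<Union>t\<in>T. A t \<inter> I j)" by simp
    also have "\<dots> = (\<Sum>t\<in>T. measure (gaussian n) (A t \<inter> I j))"
    proof (rule finite_measure_finite_Union)
      show "disjoint_family_on (\<lambda>t. A t \<inter> I j) T"
        using A_disj unfolding disjoint_family_on_def by blast
    qed (use T A_ev I_ev in auto)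
    finally show ?thesis .
  qed
  define c where "c = (81 :: real)"
  have exp4: "exp (7 / 2) \<le> c"
  proof -
    have "exp (7 / 2 :: real) \<le> exp 1 ^ 4" by (simp flip: exp_of_nat_mult)
    also have "\<dots> \<le> 3 ^ 4" using exp_le by (intro power_mono) auto
    finally show ?thesis by (simp add: c_def)
  qed
  have shift_le: "measure (gaussian n) (A t \<inter> I 0) \<le> c * measure (gaussian n) (A t \<inter> I j)"
    if t: "t \<in> T" and j: "real j * (3 * \<alpha>) \<le> 1 / r" for t j
  proof -
    define u where "u = real j * (3 * \<alpha>)"
    have u: "0 \<le> u" "u \<le> 1 / r" using j \<alpha> by (auto simp: u_def)
    have u1: "u \<le> 1" using u r by (smt (verit) divide_le_eq_1)
    define w where "w i = u * t i" for i
    have ipw: "inner_prod n w x = u * inner_prod n t x" for x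
      by (simp add: w_def[abs_def] inner_prod_scale_left)
    have ip_tw: "inner_prod n s w = u * inner_prod n s t" for s
      by (simp add: w_def[abs_def] inner_prod_scale_right)
    have st: "inner_prod n s t \<le> 1" if "s \<in> T" for s
    proof -
      have "0 \<le> sq_dist n s t" by (simp add: sq_dist_def sum_nonneg)
      also have "\<dots> = inner_prod n s s - 2 * inner_prod n s t + inner_prod n t t"
        by (simp add: sq_dist_def inner_prod_def power2_eq_square algebra_simps sum.distrib sum_subtractf sum_distrib_left)
      finally show ?thesis using unit[OF that] unit[OF t] by simp
    qed
    have l_shift: "l s (shift n w x) = l s x + u * inner_prod n s t" for s x
      by (simp add: l_def inner_prod_shift ip_tw)
    have mem: "shift n w x \<in> A t \<inter> I j" if x: "x \<in> A t \<inter> I 0" for x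
    proof
      have le: "l s (shift n w x) \<le> l s x + u" if "s \<in> T" for s
        unfolding l_shift using mult_left_mono[OF st[OF that] u(1)] by simp
      have eq: "l t (shift n w x) = l t x + u"
        unfolding l_shift unit[OF t] by simp
      show A: "shift n w x \<in> A t"
        unfolding A_def using x le eq by (fastforce simp: A_def)
      show "shift n w x \<in> I j"
        using x t F_A[OF t A] F_A[OF t, of x] eq by (auto simp: I_def u_def algebra_simps)
    qed
    have dens: "inner_prod n w x + inner_prod n w w / 2 \<le> 7 / 2" if x: "x \<in> A t \<inter> I 0" for x
    proof -
      have "inner_prod n t x = F x + b t" using F_A[OF t, of x] x by (simp add: l_def)
      also have "\<dots> \<le> 2 * \<alpha> + r" using x b[OF t] by (simp add: I_def)
      also have "\<dots> \<le> 3 * r" using \<alpha> r by simp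
      finally have "u * inner_prod n t x \<le> u * (3 * r)" using u by (intro mult_left_mono) auto
      also have "\<dots> \<le> 1 / r * (3 * r)" using u r by (intro mult_right_mono) auto
      also have "\<dots> = 3" using r by simp
      finally have "inner_prod n w x \<le> 3" by (simp add: ipw)
      moreover have "inner_prod n w w \<le> 1"
        using u u1 by (simp add: ipw ip_tw unit[OF t] mult_le_one)
      ultimately show ?thesis by simp
    qed
    have "ennreal (measure (gaussian n) (A t \<inter> I 0)) = (\<integral>\<^sup>+x. indicator (A t \<inter> I 0) x \<partial>gaussian n)"
      using A_ev I_ev by (simp add: emeasure_eq_measure)
    also have "\<dots> \<le> (\<integral>\<^sup>+x. ennreal c * (indicator (A t \<inter> I j) (shift n w x) * ennreal (exp (- (inner_prod n w (shift n w x) - inner_prod n w w / 2)))) \<partial>gaussian n)"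
    proof (intro nn_integral_mono)
      fix x
      show "indicator (A t \<inter> I 0) x \<le> ennreal c * (indicator (A t \<inter> I j) (shift n w x) * ennreal (exp (- (inner_prod n w (shift n w x) - inner_prod n w w / 2))))"
      proof (cases "x \<in> A t \<inter> I 0")
        case True
        have "1 = exp (7 / 2) * exp (- (7 / 2 :: real))" by (simp flip: exp_add)
        also have "\<dots> \<le> c * exp (- (inner_prod n w (shift n w x) - inner_prod n w w / 2))"
          using exp4 dens[OF True] by (intro mult_mono) (auto simp: inner_prod_shift c_def)
        finally have "ennreal 1 \<le> ennreal (c * exp (- (inner_prod n w (shift n w x) - inner_prod n w w / 2)))"
          by (rule ennreal_leI)
        then show ?thesis using True mem[OF True] by (simp add: ennreal_mult c_def)
      qed simp
    qed
    also have "\<dots> = ennreal c * (\<integral>\<^sup>+x. indicator (A t \<inter> I j) (shift n w x) * ennreal (exp (- (inner_prod n w (shift n w x) - inner_prod n w w / 2))) \<partial>gaussian n)"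
      by (rule nn_integral_cmult) (use A_ev I_ev in measurable)
    also have "(\<integral>\<^sup>+x. indicator (A t \<inter> I j) (shift n w x) * ennreal (exp (- (inner_prod n w (shift n w x) - inner_prod n w w / 2))) \<partial>gaussian n)
       = (\<integral>\<^sup>+x. indicator (A t \<inter> I j) x * ennreal (exp (- (inner_prod n w x - inner_prod n w w / 2))) * ennreal (exp (inner_prod n w x - inner_prod n w w / 2)) \<partial>gaussian n)"
      by (rule Cameron_Martin_nn_integral) (use A_ev I_ev in measurable)
    also have "\<dots> = (\<integral>\<^sup>+x. indicator (A t \<inter> I j) x \<partial>gaussian n)"
      by (intro nn_integral_cong) (simp add: mult.assoc flip: ennreal_mult exp_add)
    also have "\<dots> = ennreal (measure (gaussian n) (A t \<inter> I j))"
      using A_ev I_ev by (simp add: emeasure_eq_measure)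
    finally have "ennreal (measure (gaussian n) (A t \<inter> I 0)) \<le> ennreal (c * measure (gaussian n) (A t \<inter> I j))"
      by (simp add: ennreal_mult c_def)
    then show ?thesis by (subst (asm) ennreal_le_iff) (auto simp: c_def)
  qed
  have I0: "measure (gaussian n) (I 0) \<le> c * measure (gaussian n) (I j)" if "real j * (3 * \<alpha>) \<le> 1 / r" for j
    unfolding split using that by (simp add: sum_distrib_left sum_mono shift_le)
  define J where "J = nat \<lfloor>1 / (r * (3 * \<alpha>))\<rfloor>"
  have J: "real J * (3 * \<alpha>) \<le> 1 / r" "1 / (r * (3 * \<alpha>)) \<le> real (Suc J)"
  proof -
    have "0 \<le> 1 / (r * (3 * \<alpha>))" using r \<alpha> by simp
    then have "real J \<le> 1 / (r * (3 * \<alpha>))" unfolding J_def by linarith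
    then have "real J * (3 * \<alpha>) \<le> 1 / (r * (3 * \<alpha>)) * (3 * \<alpha>)" using \<alpha> by (intro mult_right_mono) auto
    then show "real J * (3 * \<alpha>) \<le> 1 / r" using \<alpha> by simp
    show "1 / (r * (3 * \<alpha>)) \<le> real (Suc J)"
      unfolding J_def by linarith
  qed
  have "real (Suc J) * measure (gaussian n) (I 0) = (\<Sum>j<Suc J. measure (gaussian n) (I 0))" by simp
  also have "\<dots> \<le> (\<Sum>j<Suc J. c * measure (gaussian n) (I j))"
  proof (intro sum_mono I0)
    fix j assume "j \<in> {..<Suc J}"
    then have "real j * (3 * \<alpha>) \<le> real J * (3 * \<alpha>)" using \<alpha> by (intro mult_right_mono) auto
    then show "real j * (3 * \<alpha>) \<le> 1 / r" using J by linarith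
  qed
  also have "\<dots> = c * measure (gaussian n) (\<Union>j<Suc J. I j)"
  proof -
    have "disjoint_family_on I {..<Suc J}"
      unfolding disjoint_family_on_def
    proof (intro ballI impI equals0I)
      fix i j x assume ij: "i \<noteq> j" and "x \<in> I i \<inter> I j"
      then have "real i * (3 * \<alpha>) < real (Suc j) * (3 * \<alpha>)" "real j * (3 * \<alpha>) < real (Suc i) * (3 * \<alpha>)"
        by (auto simp: I_def)
      then have "real i < real (Suc j)" "real j < real (Suc i)"
        using \<alpha> by (auto simp only: mult_less_cancel_right_pos)
      then show False using ij by simp
    qed
    then have "measure (gaussian n) (\<Union>j<Suc J. I j) = (\<Sum>j<Suc J. measure (gaussian n) (I j))"
      using I_ev by (intro finite_measure_finite_Union) auto
    then show ?thesis by (simp only: sum_distrib_left)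
  qed
  also have "\<dots> \<le> c * 1" unfolding c_def by (intro mult_left_mono prob_le_1) auto
  finally have "real (Suc J) * measure (gaussian n) (I 0) \<le> c" by simp
  moreover have "1 / (r * (3 * \<alpha>)) * measure (gaussian n) (I 0) \<le> real (Suc J) * measure (gaussian n) (I 0)"
    using J(2) by (intro mult_right_mono) auto
  ultimately have "1 / (r * (3 * \<alpha>)) * measure (gaussian n) (I 0) \<le> c" by linarith
  then have "measure (gaussian n) (I 0) \<le> 243 * \<alpha> * r"
    using \<alpha> r by (simp add: field_simps c_def)
  moreover have "measure (gaussian n) {x \<in> Rn n. \<bar>F x\<bar> \<le> \<alpha>} \<le> measure (gaussian n) (I 0)"
  proof (rule finite_measure_mono)
    show "{x \<in> Rn n. \<bar>F x\<bar> \<le> \<alpha>} \<subseteq> I 0" using \<alpha> by (auto simp: I_def)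
  qed (rule I_ev)
  ultimately show ?thesis unfolding F_def l_def by linarith
qed

section \<open>Approximation by few halfspaces\<close>

text \<open>A countable family dense among the pairs (t, b t) cuts out exactly \<open>K\<close>, and
  continuity from above allows stopping after finitely many of them. Density of the points t alone
  would not do, since \<open>b\<close> is arbitrary and may jump, whereas the constraint is closed
  in the pair.\<close>

lemma finite_subfamily_approximation:
  assumes K: "K = {x \<in> Rn n. \<forall>t\<in>T. inner_prod n t x \<le> b t}" and Kev: "K \<in> sets (gaussian n)" and \<eta>: "0 < \<eta>"
  shows "\<exists>T0\<subseteq>T. finite T0 \<and> measure (gaussian n) ({x \<in> Rn n. \<forall>t\<in>T0. inner_prod n t x \<le> b t} - K) \<le> \<eta>"
proof -
  interpret prob_space "gaussian n" by (rule prob_space_gaussian)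
  define S where "S = (\<lambda>t. (t, b t)) ` T"
  obtain D where D: "countable D" "D \<subseteq> S" "S \<subseteq> closure D"
    using separable by blast
  have dense: "inner_prod n t x \<le> b t"
    if t: "t \<in> T" and x: "\<forall>(s, c)\<in>D. inner_prod n s x \<le> c" for t x
  proof -
    have "continuous_on UNIV (\<lambda>p :: (nat \<Rightarrow> real) \<times> real. inner_prod n (fst p) x)"
      unfolding inner_prod_def
      by (intro continuous_intros continuous_on_product_then_coordinatewise)
    then have "closed {p. inner_prod n (fst p) x \<le> snd p}"
      by (intro closed_Collect_le continuous_intros)
    moreover have "D \<subseteq> {p. inner_prod n (fst p) x \<le> snd p}"
      using x by auto
    ultimately have "closure D \<subseteq> {p. inner_prod n (fst p) x \<le> snd p}"
      by (rule closure_minimal[rotated])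
    moreover have "(t, b t) \<in> closure D"
      using D(3) t by (auto simp: S_def)
    ultimately show ?thesis by auto
  qed
  define P where "P U = {x \<in> Rn n. \<forall>t\<in>U. inner_prod n t x \<le> b t}" for U
  show ?thesis
  proof (cases "D = {}")
    case True
    then have "T = {}" using D(3) by (auto simp: S_def)
    then show ?thesis using K \<eta> by (intro exI[of _ "{}"]) simp
  next
    case False
    define g where "g = fst \<circ> from_nat_into D"
    have g: "(g i, b (g i)) \<in> D \<and> g i \<in> T" for i
      using from_nat_into[OF False, of i] D(2) by (auto simp: g_def S_def)
    have g_onto: "\<exists>i. p = (g i, b (g i))" if p: "p \<in> D" for p
    proof -
      obtain i where "p = from_nat_into D i"
        using from_nat_into_surj[OF D(1) p] by blast
      moreover have "p = (fst p, b (fst p))" using p D(2) by (auto simp: S_def)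
      ultimately show ?thesis by (intro exI[of _ i]) (simp add: g_def)
    qed
    define Q where "Q k = P (g ` {..<k})" for k :: nat
    have Qev: "Q k \<in> events" for k
      unfolding Q_def P_def space_gaussian[symmetric]
      by (intro sets.sets_Collect_finite_All borel_measurable_le measurable_inner_prod borel_measurable_const) simp
    have sub: "K \<subseteq> Q k" for k using g unfolding K Q_def P_def by auto
    have "(\<Inter>k. Q k) = K"
    proof (intro equalityI subsetI)
      fix x assume x: "x \<in> (\<Inter>k. Q k)"
      have "inner_prod n (g i) x \<le> b (g i)" for i
        using INT_D[OF x, of "Suc i"] by (auto simp: Q_def P_def)
      then have "\<forall>(s, c)\<in>D. inner_prod n s x \<le> c" using g_onto by fastforce
      moreover have "x \<in> Rn n" using INT_D[OF x, of 0] by (auto simp: Q_def P_def)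
      ultimately show "x \<in> K" using dense unfolding K by auto
    qed (use sub in auto)
    moreover have "decseq Q" unfolding decseq_def Q_def P_def by fastforce
    ultimately have "(\<lambda>k. measure (gaussian n) (Q k)) \<longlonglongrightarrow> measure (gaussian n) K"
      using finite_Lim_measure_decseq[of Q] Qev by (auto simp: image_subset_iff)
    then have "\<forall>\<^sub>F k in sequentially. measure (gaussian n) (Q k) < measure (gaussian n) K + \<eta>"
      by (rule order_tendstoD) (use \<eta> in simp)
    then obtain k where "measure (gaussian n) (Q k) < measure (gaussian n) K + \<eta>"
      by (auto simp: eventually_sequentially)
    moreover have "measure (gaussian n) (Q k - K) = measure (gaussian n) (Q k) - measure (gaussian n) K"
      using sub Qev Kev by (intro finite_measure_Diff) auto
    ultimately have "measure (gaussian n) (P (g ` {..<k}) - K) \<le> \<eta>" unfolding Q_def by simp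
    then show ?thesis using g unfolding P_def by (intro exI[of _ "g ` {..<k}"]) auto
  qed
qed

section \<open>Nets and the number of halfspaces\<close>

lemma sq_dist_commute: "sq_dist n x y = sq_dist n y x"
  by (simp add: sq_dist_def power2_commute)

text \<open>Greedy selection: a point joins the net only if no chosen point is near, which gives
  separation and covering at the same scale. Here \<open>\<delta>\<close> is a squared
  distance.\<close>

lemma separated_net:
  assumes "finite T" "0 \<le> \<delta>"
  shows "\<exists>S\<subseteq>T. (\<forall>s\<in>S. \<forall>t\<in>S. s \<noteq> t \<longrightarrow> \<delta> \<le> sq_dist n s t) \<and> (\<forall>t\<in>T. \<exists>s\<in>S. sq_dist n t s \<le> \<delta>)"
  using assms
proof (induction T rule: finite_induct)
  case empty
  show ?case by (intro exI[of _ "{}"]) simp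
next
  case (insert x T)
  then obtain S where S: "S \<subseteq> T" "\<forall>s\<in>S. \<forall>t\<in>S. s \<noteq> t \<longrightarrow> \<delta> \<le> sq_dist n s t" "\<forall>t\<in>T. \<exists>s\<in>S. sq_dist n t s \<le> \<delta>"
    by blast
  show ?case
  proof (cases "\<exists>s\<in>S. sq_dist n x s \<le> \<delta>")
    case True
    with S show ?thesis by (intro exI[of _ S]) auto
  next
    case False
    then have "\<delta> \<le> sq_dist n x s \<and> \<delta> \<le> sq_dist n s x" if "s \<in> S" for s
      using that by (auto simp: sq_dist_commute[of n s x] not_le intro: less_imp_le)
    moreover have "sq_dist n x x \<le> \<delta>" using insert by (simp add: sq_dist_def)
    ultimately show ?thesis using S by (intro exI[of _ "insert x S"]) auto
  qed
qed

text \<open>Two disjoint parallel halfspaces, x 0 \<le> -1 and x 0 \<ge> 0; they serve when K has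
  measure at most \<epsilon>.\<close>

lemma empty_inter_of_halfspaces:
  assumes "1 \<le> n" "2 \<le> m"
  shows "inter_of_halfspaces n m {}"
proof -
  define e where "e c = (\<lambda>i\<in>{..<n}. if i = 0 then c else 0 :: real)" for c
  have e: "e c \<in> Rn n" "inner_prod n (e c) x = c * x 0" for c x
  proof -
    show "e c \<in> Rn n" by (simp add: e_def Rn_def)
    have "inner_prod n (e c) x = (\<Sum>i<n. if i = 0 then c * x i else 0)"
      unfolding inner_prod_def e_def by (intro sum.cong) auto
    then show "inner_prod n (e c) x = c * x 0" using assms(1) by simp
  qed
  let ?H = "\<lambda>c d. {x \<in> Rn n. inner_prod n (e c) x \<le> d}"
  have "is_halfspace n (?H c d)" if "c \<noteq> 0" for c d
    unfolding is_halfspace_def using e(1)[of c] that assms(1)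
    by (intro exI[of _ "e c"] exI[of _ d]) (auto simp: e_def intro!: exI[of _ 0])
  then have "\<forall>H\<in>{?H 1 (- 1), ?H (- 1) 0}. is_halfspace n H" by auto
  moreover have "real (card {?H 1 (- 1), ?H (- 1) 0}) \<le> m"
    using assms(2) card_insert_le_m1[of 2 "{?H (- 1) 0}" "?H 1 (- 1)"] by simp
  moreover have "{} = Rn n \<inter> \<Inter>{?H 1 (- 1), ?H (- 1) 0}" by (auto simp: e(2))
  ultimately show ?thesis
    unfolding inter_of_halfspaces_def by (intro exI[of _ "{?H 1 (- 1), ?H (- 1) 0}"]) auto
qed

lemma Max_affine_le_0_iff:
  assumes "finite T" "T \<noteq> {}"
  shows "Max ((\<lambda>t. inner_prod n (s t) x - c t) ` T) \<le> 0 \<longleftrightarrow> (\<forall>t\<in>T. inner_prod n (s t) x \<le> c t)"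
  using assms by (subst Max_le_iff) auto

text \<open>Constraints with the same normal collapse to the one with the least offset, so only the
  distinct values of \<open>s\<close> are counted, however large \<open>T\<close> is.\<close>

lemma inter_of_halfspaces_indexed:
  assumes T: "finite T" and m: "real (card (s ` T)) \<le> m"
    and s: "\<And>t. t \<in> T \<Longrightarrow> s t \<in> unit_sphere n"
  shows "inter_of_halfspaces n m {x \<in> Rn n. \<forall>t\<in>T. inner_prod n (s t) x \<le> c t}"
proof -
  define H where "H u = {x \<in> Rn n. inner_prod n u x \<le> Min (c ` {t \<in> T. s t = u})}" for u
  have "is_halfspace n (H u)" if u: "u \<in> s ` T" for u
  proof -
    have us: "u \<in> unit_sphere n" using s u by auto
    have "\<exists>i<n. u i \<noteq> 0"
    proof (rule ccontr)
      assume "\<not> (\<exists>i<n. u i \<noteq> 0)"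
      then have "inner_prod n u u = 0" by (simp add: inner_prod_def)
      then show False using us by (simp add: unit_sphere_def)
    qed
    then show ?thesis using us unfolding is_halfspace_def H_def unit_sphere_def by blast
  qed
  moreover have "real (card (H ` s ` T)) \<le> m"
    using card_image_le[of "s ` T" H] T m by simp
  moreover have "{x \<in> Rn n. \<forall>t\<in>T. inner_prod n (s t) x \<le> c t} = Rn n \<inter> \<Inter>(H ` s ` T)"
  proof -
    have "x \<in> H u \<longleftrightarrow> x \<in> Rn n \<and> (\<forall>t\<in>T. s t = u \<longrightarrow> inner_prod n u x \<le> c t)" if "u \<in> s ` T" for x u
      unfolding H_def using T that by (subst Min_ge_iff) auto
    then show ?thesis by (auto; metis)
  qed
  ultimately show ?thesis
    unfolding inter_of_halfspaces_def using T by (intro exI[of _ "H ` s ` T"]) auto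
qed

text \<open>Sudakov minoration with the chosen \<open>\<delta>\<close> inserted. The universal
  constant comes from 72 (3/2)^2 * 160 * 1000^2 = 25920000000 \<le> 3 * 10^10. Since
  \<open>alpha\<close> is at least 4 here, it also covers sets of fewer than 4 points and the two
  halfspaces of the empty set.\<close>

lemma separated_card_le_alpha:
  assumes S: "finite S" and unit: "\<And>s. s \<in> S \<Longrightarrow> inner_prod n s s = 1"
    and r: "1 \<le> r" and \<epsilon>: "0 < \<epsilon>" "\<epsilon> < 1 / 2"
    and \<delta>: "\<delta>\<^sup>2 = (\<epsilon> / (1000 * r))\<^sup>2 / (160 * ln (1 / \<epsilon>))" "0 < \<delta>"
    and sep: "\<And>s t. s \<in> S \<Longrightarrow> t \<in> S \<Longrightarrow> s \<noteq> t \<Longrightarrow> \<delta>\<^sup>2 \<le> sq_dist n s t"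
    and K: "\<epsilon> \<le> measure (gaussian n) {x \<in> Rn n. \<forall>s\<in>S. inner_prod n s x \<le> r}"
  shows "real (card S) \<le> alpha (3 * 10 ^ 10) r \<epsilon>" "2 \<le> alpha (3 * 10 ^ 10) r \<epsilon>"
proof -
  define q where "q = sqrt (ln (1 / \<epsilon>))"
  have "ln (1 / \<epsilon>) \<ge> ln 2" using \<epsilon> by (subst ln_le_cancel_iff) (auto simp: field_simps)
  then have ln: "1 / 2 \<le> ln (1 / \<epsilon>)" using ln2_ge_two_thirds by linarith
  have q: "0 < q" "q\<^sup>2 = ln (1 / \<epsilon>)" using ln by (auto simp: q_def)
  define X where "X = ln (1 / \<epsilon>) * (r + q) ^ 4 / \<epsilon>\<^sup>2"
  have "1 / 2 * 1 / 1 \<le> X"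
    unfolding X_def using ln r q \<epsilon>
    by (intro frac_le mult_mono) (auto intro!: one_le_power power_le_one)
  then have X: "1 / 2 \<le> X" by simp
  have al: "alpha (3 * 10 ^ 10) r \<epsilon> = exp (3 * 10 ^ 10 * X)" by (simp add: alpha_def X_def q_def)
  have "4 \<le> 1 + 3 * 10 ^ 10 * X" using X by simp
  also have "\<dots> \<le> alpha (3 * 10 ^ 10) r \<epsilon>" unfolding al by (rule exp_ge_add_one_self)
  finally have 4: "4 \<le> alpha (3 * 10 ^ 10) r \<epsilon>" .
  then show "2 \<le> alpha (3 * 10 ^ 10) r \<epsilon>" by simp
  show "real (card S) \<le> alpha (3 * 10 ^ 10) r \<epsilon>"
  proof (cases "4 \<le> card S")
    case True
    have "ln (2 * real (card S)) \<le> 72 * (r + 3 / 2 * q)\<^sup>2 / \<delta>\<^sup>2"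
      by (rule Sudakov_minoration[OF S True unit sep \<delta>(2) \<epsilon>(1) _ K _ q_def]) (use \<epsilon> r in auto)
    also have "\<dots> \<le> 72 * (3 / 2 * (r + q))\<^sup>2 / \<delta>\<^sup>2"
      using r q \<delta>(2) by (intro divide_right_mono mult_left_mono power_mono) auto
    also have "\<dots> = 25920000000 * (ln (1 / \<epsilon>) * ((r + q)\<^sup>2 * r\<^sup>2) / \<epsilon>\<^sup>2)"
    proof -
      have "(3 / 2 * (r + q))\<^sup>2 = 9 / 4 * (r + q)\<^sup>2" by (simp only: power_mult_distrib) (simp add: power2_eq_square)
      then show ?thesis
        unfolding \<delta>(1) using r \<epsilon> by (simp only: power_divide power_mult_distrib) (simp add: field_simps)
    qed
    also have "\<dots> \<le> 3 * 10 ^ 10 * (ln (1 / \<epsilon>) * ((r + q)\<^sup>2 * (r + q)\<^sup>2) / \<epsilon>\<^sup>2)"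
      using r q ln \<epsilon>
      by (intro mult_mono divide_right_mono power_mono) (auto intro!: mult_nonneg_nonneg divide_nonneg_nonneg)
    also have "\<dots> = 3 * 10 ^ 10 * X" unfolding X_def by (simp flip: power_add)
    finally have *: "ln (2 * real (card S)) \<le> 3 * 10 ^ 10 * X" .
    have "2 * real (card S) \<le> exp (3 * 10 ^ 10 * X)"
    proof -
      have "2 * real (card S) = exp (ln (2 * real (card S)))" using True by simp
      also have "\<dots> \<le> exp (3 * 10 ^ 10 * X)" using * by simp
      finally show ?thesis .
    qed
    then show ?thesis unfolding al by simp
  next
    case False
    then show ?thesis using 4 by linarith
  qed
qed

theorem theorem4:
  shows "\<exists>C::real. C > 0 \<and>
    (\<forall>(n::nat) (r::real) (\<epsilon>::real) K.
       n \<ge> 1 \<and> r \<ge> 1 \<and> 0 < \<epsilon> \<and> \<epsilon> < 1/2 \<and> geom_width_le n K r \<longrightarrow>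
       (\<exists>L. inter_of_halfspaces n (alpha C r \<epsilon>) L \<and> dist_G n K L \<le> \<epsilon>))"
proof (intro exI[of _ "3 * 10 ^ 10"] conjI allI impI)
  fix n :: nat and r \<epsilon> :: real and K
  assume H: "n \<ge> 1 \<and> r \<ge> 1 \<and> 0 < \<epsilon> \<and> \<epsilon> < 1/2 \<and> geom_width_le n K r"
  then have n: "1 \<le> n" and r: "1 \<le> r" and \<epsilon>: "0 < \<epsilon>" "\<epsilon> < 1 / 2" and Kw: "geom_width_le n K r" by auto
  interpret prob_space "gaussian n" by (rule prob_space_gaussian)
  have Kev: "K \<in> events" by (rule sets_geom_width_le[OF Kw])
  obtain T b where T: "T \<subseteq> unit_sphere n" "\<And>t. t \<in> T \<Longrightarrow> \<bar>b t\<bar> \<le> r"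
    and K: "K = {x \<in> Rn n. \<forall>t\<in>T. inner_prod n t x \<le> b t}"
    using Kw unfolding geom_width_le_def by blast
  have ln0: "0 < ln (1 / \<epsilon>)" using \<epsilon> by simp
  define \<alpha> where "\<alpha> = \<epsilon> / (1000 * r)"
  define \<delta> where "\<delta> = sqrt (\<alpha>\<^sup>2 / (160 * ln (1 / \<epsilon>)))"
  have \<alpha>: "0 < \<alpha>" "\<alpha> \<le> 1" using \<epsilon> r by (auto simp: \<alpha>_def field_simps)
  have \<delta>: "\<delta>\<^sup>2 = \<alpha>\<^sup>2 / (160 * ln (1 / \<epsilon>))" "0 < \<delta>" using \<alpha> ln0 by (auto simp: \<delta>_def)
  note card = separated_card_le_alpha[OF _ _ r \<epsilon> \<delta>[unfolded \<alpha>_def]]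
  show "\<exists>L. inter_of_halfspaces n (alpha (3 * 10 ^ 10) r \<epsilon>) L \<and> dist_G n K L \<le> \<epsilon>"
  proof (cases "measure (gaussian n) K \<le> \<epsilon>")
    case True
    \<comment> \<open>The instance with the empty family, for which the set in the measure
      hypothesis is the whole space.\<close>
    have "2 \<le> alpha (3 * 10 ^ 10) r \<epsilon>"
      using card(2)[of "{}" n] \<epsilon> by (simp add: space_gaussian[symmetric] prob_space)
    then show ?thesis
      using True empty_inter_of_halfspaces[OF n] by (intro exI[of _ "{}"]) (simp add: dist_G_def)
  next
    case False
    obtain T0 where T0: "T0 \<subseteq> T" "finite T0"
      and K0: "measure (gaussian n) ({x \<in> Rn n. \<forall>t\<in>T0. inner_prod n t x \<le> b t} - K) \<le> \<epsilon> / 4"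
      using finite_subfamily_approximation[OF K Kev, of "\<epsilon> / 4"] \<epsilon> by auto
    let ?K0 = "{x \<in> Rn n. \<forall>t\<in>T0. inner_prod n t x \<le> b t}"
    show ?thesis
    proof (cases "T0 = {}")
      case True
      have "inter_of_halfspaces n (alpha (3 * 10 ^ 10) r \<epsilon>) (Rn n)"
        unfolding inter_of_halfspaces_def by (intro exI[of _ "{}"]) (simp add: alpha_def)
      moreover have "(K - Rn n) \<union> (Rn n - K) = ?K0 - K" using True K by auto
      ultimately show ?thesis using K0 \<epsilon> by (intro exI[of _ "Rn n"]) (simp add: dist_G_def)
    next
      case ne: False
      have unit: "inner_prod n t t = 1" if "t \<in> T0" for t
        using T(1) T0(1) that by (auto simp: unit_sphere_def)
      obtain S where S: "S \<subseteq> T0" "\<And>s t. s \<in> S \<Longrightarrow> t \<in> S \<Longrightarrow> s \<noteq> t \<Longrightarrow> \<delta>\<^sup>2 \<le> sq_dist n s t"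
        and net: "\<And>t. t \<in> T0 \<Longrightarrow> \<exists>s\<in>S. sq_dist n t s \<le> \<delta>\<^sup>2"
        using separated_net[OF T0(2), of "\<delta>\<^sup>2" n] by auto
      obtain \<sigma> where \<sigma>: "\<And>t. t \<in> T0 \<Longrightarrow> \<sigma> t \<in> S \<and> sq_dist n t (\<sigma> t) \<le> \<delta>\<^sup>2"
        using net by metis
      have finS: "finite S" using S(1) T0(2) by (rule finite_subset)
      \<comment> \<open>\<open>K\<close> lies in this set because all offsets are at most
        \<open>r\<close>; so a mass of \<open>K\<close> above \<epsilon> limits the size of the
        net.\<close>
      have "\<epsilon> \<le> measure (gaussian n) {x \<in> Rn n. \<forall>s\<in>S. inner_prod n s x \<le> r}"
      proof -
        have "{x \<in> Rn n. \<forall>s\<in>S. inner_prod n s x \<le> r} \<in> events"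
          unfolding space_gaussian[symmetric] using finS
          by (intro sets.sets_Collect_finite_All borel_measurable_le measurable_inner_prod borel_measurable_const)
        moreover have "inner_prod n s x \<le> r" if "x \<in> K" "s \<in> S" for x s
          using that K S(1) T0(1) T(2)[of s] by fastforce
        then have "K \<subseteq> {x \<in> Rn n. \<forall>s\<in>S. inner_prod n s x \<le> r}" using K by auto
        ultimately show ?thesis using False finite_measure_mono[of K] by (smt (verit))
      qed
      then have N: "real (card S) \<le> alpha (3 * 10 ^ 10) r \<epsilon>"
        using S(1) unit by (intro card(1)[OF finS _ S(2)]) auto
      \<comment> \<open>The parameter \<alpha> / (8 \<delta>^2) minimises 2 k^2 \<delta>^2 - k
        \<alpha> / 2 over k, with minimum - \<alpha>^2 / (32 \<delta>^2).\<close>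
      obtain c where c: "measure (gaussian n) {x \<in> Rn n. \<alpha> < \<bar>Max ((\<lambda>t. inner_prod n t x - b t) ` T0)
          - Max ((\<lambda>t. inner_prod n (\<sigma> t) x - c t) ` T0)\<bar>} \<le> 4 * exp (2 * (\<alpha> / (8 * \<delta>\<^sup>2))\<^sup>2 * \<delta>\<^sup>2 - \<alpha> / (8 * \<delta>\<^sup>2) * \<alpha> / 2) + \<epsilon> / 4"
        using Max_affine_perturbation[OF T0(2) ne, of n "\<lambda>t. t" \<sigma> "\<delta>\<^sup>2" \<alpha> "\<alpha> / (8 * \<delta>\<^sup>2)" "\<epsilon> / 4" b] \<sigma> \<alpha> \<delta> \<epsilon> by auto
      let ?F = "\<lambda>x. Max ((\<lambda>t. inner_prod n t x - b t) ` T0)"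
      let ?G = "\<lambda>x. Max ((\<lambda>t. inner_prod n (\<sigma> t) x - c t) ` T0)"
      have "2 * (\<alpha> / (8 * \<delta>\<^sup>2))\<^sup>2 * \<delta>\<^sup>2 - \<alpha> / (8 * \<delta>\<^sup>2) * \<alpha> / 2 = - (\<alpha>\<^sup>2 / \<delta>\<^sup>2 / 32)"
        using \<delta>(2) by (simp add: field_simps power2_eq_square)
      also have "\<alpha>\<^sup>2 / \<delta>\<^sup>2 = 160 * ln (1 / \<epsilon>)" unfolding \<delta>(1) using \<alpha> ln0 by simp
      also have "- (160 * ln (1 / \<epsilon>) / 32) = 5 * ln \<epsilon>" using \<epsilon> by (simp add: ln_div)
      also have "exp (5 * ln \<epsilon>) = \<epsilon> ^ 5" 
      proof -
        have "exp (5 * ln \<epsilon>) = exp (ln \<epsilon>) ^ 5" by (simp flip: exp_of_nat_mult)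
        then show ?thesis using \<epsilon> by simp
      qed
      finally have exp: "exp (2 * (\<alpha> / (8 * \<delta>\<^sup>2))\<^sup>2 * \<delta>\<^sup>2 - \<alpha> / (8 * \<delta>\<^sup>2) * \<alpha> / 2) = \<epsilon> ^ 5" .
      \<comment> \<open>\<epsilon>^4 \<le> 1/16 turns the tail 4 \<epsilon>^5 into at most
        \<epsilon>/4; the other \<epsilon>/4 is the \<open>\<eta>\<close> of the perturbation
        lemma.\<close>
      have "\<epsilon> ^ 4 \<le> (1 / 2) ^ 4" using \<epsilon> by (intro power_mono) auto
      then have "4 * \<epsilon> ^ 5 \<le> \<epsilon> / 4"
        using \<epsilon> mult_left_mono[of "\<epsilon> ^ 4" "(1 / 2) ^ 4" \<epsilon>] by (simp add: power_Suc[symmetric] eval_nat_numeral)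
      with c exp have FG: "measure (gaussian n) {x \<in> Rn n. \<alpha> < \<bar>?F x - ?G x\<bar>} \<le> \<epsilon> / 2" by simp
      have "measure (gaussian n) {x \<in> Rn n. \<bar>?F x\<bar> \<le> \<alpha>} \<le> 243 * \<alpha> * r"
        using T(2) T0(1) unit by (intro Max_affine_anticoncentration[OF T0(2) ne _ _ r \<alpha>]) (auto simp: abs_le_iff)
      also have "\<dots> \<le> \<epsilon> / 4" using r \<epsilon> by (simp add: \<alpha>_def)
      finally have F: "measure (gaussian n) {x \<in> Rn n. \<bar>?F x\<bar> \<le> \<alpha>} \<le> \<epsilon> / 4" .
      define L where "L = {x \<in> Rn n. \<forall>t\<in>T0. inner_prod n (\<sigma> t) x \<le> c t}"
      have "card (\<sigma> ` T0) \<le> card S" using \<sigma> finS by (intro card_mono) auto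
      then have "inter_of_halfspaces n (alpha (3 * 10 ^ 10) r \<epsilon>) L"
        unfolding L_def using N \<sigma> S(1) T0 T(1) by (intro inter_of_halfspaces_indexed) (linarith | blast)+
      moreover have "dist_G n K L \<le> \<epsilon>"
      proof -
        have [measurable]: "?F \<in> borel_measurable (gaussian n)" "?G \<in> borel_measurable (gaussian n)"
          using T0(2) ne by measurable
        have ev: "?K0 - K \<in> events" "{x \<in> Rn n. \<bar>?F x\<bar> \<le> \<alpha>} \<in> events" "{x \<in> Rn n. \<alpha> < \<bar>?F x - ?G x\<bar>} \<in> events"
        proof -
          have "?K0 \<in> events"
            unfolding space_gaussian[symmetric] using T0(2)
            by (intro sets.sets_Collect_finite_All borel_measurable_le measurable_inner_prod borel_measurable_const)
          then show "?K0 - K \<in> events" using Kev by auto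
          show "{x \<in> Rn n. \<bar>?F x\<bar> \<le> \<alpha>} \<in> events" "{x \<in> Rn n. \<alpha> < \<bar>?F x - ?G x\<bar>} \<in> events"
            unfolding space_gaussian[symmetric] by measurable
        qed
        have "(K - L) \<union> (L - K) \<subseteq> (?K0 - K) \<union> ({x \<in> Rn n. \<bar>?F x\<bar> \<le> \<alpha>} \<union> {x \<in> Rn n. \<alpha> < \<bar>?F x - ?G x\<bar>})"
        proof
          fix x assume x: "x \<in> (K - L) \<union> (L - K)"
          then have xR: "x \<in> Rn n" by (auto simp: K L_def)
          have K0_iff: "x \<in> ?K0 \<longleftrightarrow> ?F x \<le> 0" and L_iff: "x \<in> L \<longleftrightarrow> ?G x \<le> 0"
            using Max_affine_le_0_iff[OF T0(2) ne, of n "\<lambda>t. t" x b] Max_affine_le_0_iff[OF T0(2) ne, of n \<sigma> x c] xR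
            by (auto simp: L_def)
          have "x \<in> K \<Longrightarrow> x \<in> ?K0" using T0(1) by (auto simp: K)
          \<comment> \<open>If exactly one of F and G is at most 0, then |F| \<le> |F - G|, so |F| >
            \<alpha> forces |F - G| > \<alpha>.\<close>
          then have "x \<in> ?K0 - K \<or> \<bar>?F x\<bar> \<le> \<alpha> \<or> \<alpha> < \<bar>?F x - ?G x\<bar>"
            using x K0_iff L_iff by (smt (verit) Diff_iff Un_iff)
          then show "x \<in> (?K0 - K) \<union> ({x \<in> Rn n. \<bar>?F x\<bar> \<le> \<alpha>} \<union> {x \<in> Rn n. \<alpha> < \<bar>?F x - ?G x\<bar>})"
            using xR by blast
        qed
        then have "dist_G n K L \<le> measure (gaussian n) ((?K0 - K) \<union> ({x \<in> Rn n. \<bar>?F x\<bar> \<le> \<alpha>} \<union> {x \<in> Rn n. \<alpha> < \<bar>?F x - ?G x\<bar>}))"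
          unfolding dist_G_def using ev by (intro finite_measure_mono sets.Un)
        also have "\<dots> \<le> measure (gaussian n) (?K0 - K) + (measure (gaussian n) {x \<in> Rn n. \<bar>?F x\<bar> \<le> \<alpha>} + measure (gaussian n) {x \<in> Rn n. \<alpha> < \<bar>?F x - ?G x\<bar>})"
          using ev by (intro order_trans[OF measure_Un_le] add_left_mono measure_Un_le sets.Un)
        also have "\<dots> \<le> \<epsilon>" using K0 F FG by simp
        finally show ?thesis .
      qed
      ultimately show ?thesis by blast
    qed
  qed
qed simp

end
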